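(* Let $d \geq 1$ and let $\mathfrak{g}$ be a finite-dimensional real $\mathbb{Z}^d$-graded Lie algebra, so that $\mathfrak{g} = \sum_{m \in \mathbb{Z}^d} \mathfrak{g}_m$ (direct sum of vector subspaces), where $[\mathfrak{g}_m, \mathfrak{g}_n] \subseteq \mathfrak{g}_{m+n}$ for all $m, n \in \mathbb{Z}^d$. Let $\mathfrak{r}$ be the radical of $\mathfrak{g}$. Then $\mathfrak{r} = \sum_{m} \mathfrak{r}_m$, where $\mathfrak{r}_m = \mathfrak{r} \cap \mathfrak{g}_m$, and there is a Levi subalgebra $\mathfrak{l}$ of $\mathfrak{g}$ such that $\mathfrak{l} = \sum_{m} \mathfrak{l}_m$, where $\mathfrak{l}_m = \mathfrak{l} \cap \mathfrak{g}_m$.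
   Context: All Lie algebras are real and finite-dimensional. In a grading, $\mathfrak{g}_m = \{0\}$ for all but finitely many $m$, and the sum of the subspaces $\mathfrak{g}_m$ is direct. The radical $\mathfrak{r}$ of $\mathfrak{g}$ is its maximal solvable ideal. A Levi subalgebra of $\mathfrak{g}$ is a semisimple Lie subalgebra $\mathfrak{l}$ of $\mathfrak{g}$ such that $\mathfrak{g} = \mathfrak{l} \oplus \mathfrak{r}$ as vector spaces (the zero algebra is counted as semisimple). *)

theory Defs
  imports "HOL-Analysis.Analysis"
begin

text \<open>A Lie algebra is given by a carrier, a finite-dimensional subspace of a real vector
  space type, and a bracket that is only constrained on the carrier.  Thus a subalgebra is a
  Lie algebra in its own right, with the same bracket.\<close>

locale lie_algebra =
  fixes L :: "'a::real_vector set"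
    and br :: "'a \<Rightarrow> 'a \<Rightarrow> 'a"
  assumes subspace_carrier: "subspace L"
    and finite_dim: "\<exists>B. finite B \<and> L = span B"
    and bracket_closed: "\<And>x y. x \<in> L \<Longrightarrow> y \<in> L \<Longrightarrow> br x y \<in> L"
    and add_left: "\<And>x y z. x \<in> L \<Longrightarrow> y \<in> L \<Longrightarrow> z \<in> L \<Longrightarrow> br (x + y) z = br x z + br y z"
    and add_right: "\<And>x y z. x \<in> L \<Longrightarrow> y \<in> L \<Longrightarrow> z \<in> L \<Longrightarrow> br x (y + z) = br x y + br x z"
    and scale_left: "\<And>c x y. x \<in> L \<Longrightarrow> y \<in> L \<Longrightarrow> br (c *\<^sub>R x) y = c *\<^sub>R br x y"
    and scale_right: "\<And>c x y. x \<in> L \<Longrightarrow> y \<in> L \<Longrightarrow> br x (c *\<^sub>R y) = c *\<^sub>R br x y"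
    and alternating: "\<And>x. x \<in> L \<Longrightarrow> br x x = 0"
    and jacobi: "\<And>x y z. x \<in> L \<Longrightarrow> y \<in> L \<Longrightarrow> z \<in> L \<Longrightarrow>
      br x (br y z) + br y (br z x) + br z (br x y) = 0"

definition lie_subalgebra :: "'a::real_vector set \<Rightarrow> ('a \<Rightarrow> 'a \<Rightarrow> 'a) \<Rightarrow> 'a set \<Rightarrow> bool" where
  "lie_subalgebra L br K \<longleftrightarrow> subspace K \<and> K \<subseteq> L \<and> (\<forall>x\<in>K. \<forall>y\<in>K. br x y \<in> K)"

definition lie_ideal :: "'a::real_vector set \<Rightarrow> ('a \<Rightarrow> 'a \<Rightarrow> 'a) \<Rightarrow> 'a set \<Rightarrow> bool" where
  "lie_ideal L br I \<longleftrightarrow> subspace I \<and> I \<subseteq> L \<and> (\<forall>x\<in>L. \<forall>y\<in>I. br x y \<in> I)"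

primrec derived_series :: "('a::real_vector \<Rightarrow> 'a \<Rightarrow> 'a) \<Rightarrow> 'a set \<Rightarrow> nat \<Rightarrow> 'a set" where
  "derived_series br K 0 = K"
| "derived_series br K (Suc n) =
     span {br x y | x y. x \<in> derived_series br K n \<and> y \<in> derived_series br K n}"

definition lie_solvable :: "('a::real_vector \<Rightarrow> 'a \<Rightarrow> 'a) \<Rightarrow> 'a set \<Rightarrow> bool" where
  "lie_solvable br K \<longleftrightarrow> (\<exists>n. derived_series br K n = {0})"

definition maximal_solvable_ideal ::
    "'a::real_vector set \<Rightarrow> ('a \<Rightarrow> 'a \<Rightarrow> 'a) \<Rightarrow> 'a set \<Rightarrow> bool" where
  "maximal_solvable_ideal L br R \<longleftrightarrow>
     lie_ideal L br R \<and> lie_solvable br R \<and>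
     (\<forall>I. lie_ideal L br I \<and> lie_solvable br I \<and> R \<subseteq> I \<longrightarrow> I = R)"

text \<open>The definite description is justified by \<open>ex1_maximal_solvable_ideal\<close> below.\<close>

definition lie_radical :: "'a::real_vector set \<Rightarrow> ('a \<Rightarrow> 'a \<Rightarrow> 'a) \<Rightarrow> 'a set" where
  "lie_radical L br = (THE R. maximal_solvable_ideal L br R)"

definition lie_semisimple :: "'a::real_vector set \<Rightarrow> ('a \<Rightarrow> 'a \<Rightarrow> 'a) \<Rightarrow> bool" where
  "lie_semisimple L br \<longleftrightarrow> lie_radical L br = {0}"

definition levi_subalgebra :: "'a::real_vector set \<Rightarrow> ('a \<Rightarrow> 'a \<Rightarrow> 'a) \<Rightarrow> 'a set \<Rightarrow> bool" where
  "levi_subalgebra L br K \<longleftrightarrow>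
     lie_subalgebra L br K \<and> lie_semisimple K br \<and>
     L = {x + y | x y. x \<in> K \<and> y \<in> lie_radical L br} \<and> K \<inter> lie_radical L br = {0}"

definition subspace_sum :: "('i \<Rightarrow> 'a::real_vector set) \<Rightarrow> 'a set" where
  "subspace_sum V = {\<Sum>m\<in>M. x m | M x. finite M \<and> (\<forall>m\<in>M. x m \<in> V m)}"

definition direct_family :: "('i \<Rightarrow> 'a::real_vector set) \<Rightarrow> bool" where
  "direct_family V \<longleftrightarrow>
     (\<forall>M x. finite M \<and> (\<forall>m\<in>M. x m \<in> V m) \<and> (\<Sum>m\<in>M. x m) = 0 \<longrightarrow> (\<forall>m\<in>M. x m = 0))"

definition lie_grading ::
    "'a::real_vector set \<Rightarrow> ('a \<Rightarrow> 'a \<Rightarrow> 'a) \<Rightarrow> ('i::ab_group_add \<Rightarrow> 'a set) \<Rightarrow> bool" where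
  "lie_grading L br G \<longleftrightarrow>
     (\<forall>m. subspace (G m)) \<and> finite {m. G m \<noteq> {0}} \<and>
     L = subspace_sum G \<and> direct_family G \<and>
     (\<forall>m n. \<forall>x\<in>G m. \<forall>y\<in>G n. br x y \<in> G (m + n))"

lemma derived_series_add:
  "derived_series br K (m + n) = derived_series br (derived_series br K m) n"
  by (induction n) auto

lemma derived_series_mono:
  "K \<subseteq> K' \<Longrightarrow> derived_series br K n \<subseteq> derived_series br K' n"
  by (induction n) (auto intro!: span_mono)

lemma subspace_derived_series: "subspace K \<Longrightarrow> subspace (derived_series br K n)"
  by (cases n) auto

context lie_algebra
begin

lemma lie_ideal_right:
  assumes "lie_ideal L br I" "x \<in> I" "y \<in> L"
  shows "br x y \<in> I"
proof -
  have xL: "x \<in> L" and I: "subspace I" and yx: "br y x \<in> I"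
    using assms by (auto simp: lie_ideal_def)
  have "br (x + y) (x + y) = br x x + br x y + (br y x + br y y)"
    using xL assms(3) subspace_carrier by (simp add: add_left add_right subspace_add)
  then have "br x y = - br y x"
    using xL assms(3) subspace_carrier
    by (simp add: alternating subspace_add add_eq_0_iff2)
  then show ?thesis using I yx by (simp add: subspace_neg)
qed

lemma derived_series_subset:
  assumes "subspace K" "\<And>x y. x \<in> K \<Longrightarrow> y \<in> K \<Longrightarrow> br x y \<in> K"
  shows "derived_series br K n \<subseteq> K"
proof (induction n)
  case (Suc n)
  then have "{br x y | x y. x \<in> derived_series br K n \<and> y \<in> derived_series br K n} \<subseteq> K"
    using assms(2) by blast
  then show ?case using assms(1) by (simp add: span_minimal)
qed simp

lemma solvable_ideal_sum:
  assumes I: "lie_ideal L br I" "lie_solvable br I"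
    and J: "lie_ideal L br J" "lie_solvable br J"
  shows "lie_ideal L br {x + y | x y. x \<in> I \<and> y \<in> J}"
    and "lie_solvable br {x + y | x y. x \<in> I \<and> y \<in> J}"
proof -
  let ?S = "{x + y | x y. x \<in> I \<and> y \<in> J}"
  have sI: "subspace I" "I \<subseteq> L" and sJ: "subspace J" "J \<subseteq> L"
    using I J by (auto simp: lie_ideal_def)
  have sS: "subspace ?S" using subspace_sums[OF sI(1) sJ(1)] by simp
  have SL: "?S \<subseteq> L" using sI sJ subspace_carrier by (auto intro: subspace_add)
  have "br x z \<in> ?S" if x: "x \<in> L" and z: "z \<in> ?S" for x z
  proof -
    obtain a b where ab: "z = a + b" "a \<in> I" "b \<in> J" using z by auto
    have "br x z = br x a + br x b" using ab x sI sJ by (auto intro: add_right)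
    moreover have "br x a \<in> I" "br x b \<in> J" using I J ab x by (auto simp: lie_ideal_def)
    ultimately show ?thesis by blast
  qed
  then show idS: "lie_ideal L br ?S" using sS SL by (auto simp: lie_ideal_def)
  obtain n where n: "derived_series br I n = {0}" using I by (auto simp: lie_solvable_def)
  obtain m where m: "derived_series br J m = {0}" using J by (auto simp: lie_solvable_def)
  have DI: "derived_series br I k \<subseteq> I" for k
    using I sI by (intro derived_series_subset) (auto simp: lie_ideal_def)
  have step: "derived_series br ?S k \<subseteq> {x + y | x y. x \<in> derived_series br I k \<and> y \<in> J}" for k
  proof (induction k)
    case (Suc k)
    let ?A = "derived_series br I k"
    let ?B = "derived_series br I (Suc k)"
    let ?T = "{x + y | x y. x \<in> ?B \<and> y \<in> J}"
    have sT: "subspace ?T" using subspace_sums[OF _ sJ(1), of ?B] by simp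
    have "br u v \<in> ?T" if u: "u \<in> derived_series br ?S k" and v: "v \<in> derived_series br ?S k" for u v
    proof -
      obtain a b where ab: "u = a + b" "a \<in> ?A" "b \<in> J" using u Suc by blast
      obtain c d where cd: "v = c + d" "c \<in> ?A" "d \<in> J" using v Suc by blast
      have L: "a \<in> L" "b \<in> L" "c \<in> L" "d \<in> L" using ab cd DI sI sJ by blast+
      have vL: "v \<in> L" using L cd subspace_carrier by (simp add: subspace_add)
      have "br u v = br a c + (br a d + br b v)"
        using L vL ab cd by (simp add: add_left add_right)
      moreover have "br a c \<in> ?B" using ab cd by (auto intro: span_base)
      moreover have "br a d \<in> J" using J L cd by (auto simp: lie_ideal_def)
      moreover have "br b v \<in> J" using lie_ideal_right[OF J(1)] ab vL by blast
      ultimately show ?thesis using sJ(1) subspace_add by blast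
    qed
    then have "span {br x y | x y. x \<in> derived_series br ?S k \<and> y \<in> derived_series br ?S k} \<subseteq> ?T"
      by (intro span_minimal[OF _ sT]) blast
    then show ?case by simp
  qed auto
  have "derived_series br ?S n \<subseteq> J" using step[of n] n by auto
  then have "derived_series br ?S (n + m) \<subseteq> {0}"
    unfolding derived_series_add using derived_series_mono m by blast
  moreover have "0 \<in> derived_series br ?S (n + m)"
    by (rule subspace_0[OF subspace_derived_series[OF sS]])
  ultimately show "lie_solvable br ?S" unfolding lie_solvable_def by blast
qed

theorem ex1_maximal_solvable_ideal: "\<exists>!R. maximal_solvable_ideal L br R"
proof -
  let ?P = "\<lambda>I. lie_ideal L br I \<and> lie_solvable br I"
  obtain B where B: "finite B" "L = span B" using finite_dim by blast
  let ?Q = "\<lambda>n. \<exists>I S. ?P I \<and> S \<subseteq> I \<and> independent S \<and> finite S \<and> card S = n"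
  have L0: "0 \<in> L" using subspace_carrier by (rule subspace_0)
  have "br x 0 = 0" if "x \<in> L" for x using scale_right[OF that L0, of 0] by simp
  then have zero: "lie_ideal L br {0}"
    using L0 by (simp add: lie_ideal_def subspace_single_0)
  moreover have "lie_solvable br {0::'a}"
    unfolding lie_solvable_def by (rule exI[of _ 0]) simp
  ultimately have Q0: "?Q 0"
    by (intro exI[of _ "{0}"] exI[of _ "{}"]) (auto simp: independent_empty)
  have bound: "\<And>n. ?Q n \<Longrightarrow> n \<le> card B"
    using independent_span_bound[OF B(1)] B(2) by (auto simp: lie_ideal_def)
  obtain k where k: "?Q k" "\<And>n. ?Q n \<Longrightarrow> n \<le> k"
    using GreatestI_nat[of ?Q, OF Q0 bound] Greatest_le_nat[of ?Q, OF _ bound] by blast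
  then obtain I S where IS: "?P I" "S \<subseteq> I" "independent S" "finite S" "card S = k" by blast
  have max: "J = I" if J: "?P J" "I \<subseteq> J" for J
  proof (rule ccontr)
    assume "J \<noteq> I"
    then obtain x where x: "x \<in> J" "x \<notin> I" using J by blast
    have "span S \<subseteq> I" using IS by (intro span_minimal) (auto simp: lie_ideal_def)
    then have "x \<notin> span S" using x by blast
    then have "independent (insert x S)" using IS by (simp add: independent_insert)
    moreover have "x \<notin> S" using x IS by blast
    ultimately have "?Q (Suc k)"
      using J x IS by (intro exI[of _ J] exI[of _ "insert x S"]) auto
    then show False using k(2) by fastforce
  qed
  have "maximal_solvable_ideal L br I"
    using IS max by (auto simp: maximal_solvable_ideal_def)
  moreover have "R = R'" if R: "maximal_solvable_ideal L br R" "maximal_solvable_ideal L br R'" for R R'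
  proof -
    let ?S = "{x + y | x y. x \<in> R \<and> y \<in> R'}"
    have P: "?P R" "?P R'" using R by (auto simp: maximal_solvable_ideal_def)
    then have S: "?P ?S" using solvable_ideal_sum[of R R'] by blast
    have "0 \<in> R" "0 \<in> R'" using P by (auto simp: lie_ideal_def subspace_0)
    then have "R \<subseteq> ?S" "R' \<subseteq> ?S" by force+
    then have "?S = R" "?S = R'"
      using R S unfolding maximal_solvable_ideal_def by (simp_all only: simp_thms)
    then show ?thesis by (rule subst)
  qed
  ultimately show ?thesis by blast
qed

end

end

theory Submission
  imports Defs "HOL-Computational_Algebra.Fundamental_Theorem_Algebra"
begin

text \<open>The automorphisms multiplying \<open>G m\<close> by \<open>2 powi (m $ i)\<close> preserve the radical and separate degrees,
  so the radical is homogeneous.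

  For the Levi subalgebra fix a homogeneous complement \<open>S\<close> of the radical \<open>r\<close>; with the projected
  bracket it is semisimple.  Starting from the inclusion, one corrects degree-preserving sections
  from \<open>S\<close> that are homomorphisms modulo the k-th derived algebra of \<open>r\<close>: the defect modulo the next
  derived algebra is a 2-cocycle with values in an \<open>S\<close>-module, hence a coboundary by Whitehead's
  second lemma, and the degree-zero part of the bounding cochain still bounds it because the cocycle
  has degree zero.  Whitehead's lemma rests on Casimir operators and on Cartan's criterion, whose
  proof over the reals uses the complex structure on the square of the module.\<close>

section \<open>Finite-dimensional subspaces and traces\<close>

text \<open>Quotients are replaced by complements: \<open>S\<close> stands for g/r, \<open>V\<close>
  in \<open>section_mod_Suc\<close> for the quotient of two consecutive derived algebras of
  \<open>r\<close>. A complement is closed only under a projected bracket, so identities hold modulo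
  an ideal and are moved along degree-preserving projections. The derived series of \<open>r\<close>
  is what makes the correction linear. A section that is multiplicative modulo \<open>R k\<close>
  gives a genuine action on R k / R (k+1), because \<open>R k\<close> acts there as zero; and the
  quadratic term of the correction falls into R (k+1). The cochain may be replaced by its
  degree-zero part because a degree-preserving section lets x in \<open>G m\<close> act by shifting
  degrees by m, so this replacement commutes with the coboundary. Over the reals, Cartan's criterion
  meets the obstacle that the trace of T composed with T is a sum of squares of complex eigenvalues,
  which can cancel. Pairing T with an operator that has the conjugate eigenvalues gives a sum of
  nonnegative terms. Of the grading group only one thing enters: its nowhere zero real characters
  separate points.\<close>

definition findim :: "'a::real_vector set \<Rightarrow> bool" where
  "findim V \<longleftrightarrow> (\<exists>B. finite B \<and> V = span B)"

lemma findim_subspace: "findim V \<Longrightarrow> subspace V"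
  by (auto simp: findim_def)

lemma findim_basis:
  assumes "findim V"
  obtains B where "finite B" "independent B" "span B = V" "card B = dim V"
proof -
  obtain A where A: "finite A" "V = span A" using assms by (auto simp: findim_def)
  obtain B where B: "B \<subseteq> V" "independent B" "V \<subseteq> span B" "card B = dim V"
    using basis_exists[of V] by blast
  have "finite B" using independent_span_bound[OF A(1) B(2)] A(2) B(1) by simp
  moreover have "span B = V" using B A(2) by (metis span_subspace subspace_span)
  ultimately show ?thesis using B that by blast
qed

lemma findim_independent:
  assumes "findim V" "independent B" "B \<subseteq> V"
  shows "finite B" "card B \<le> dim V"
proof -
  obtain A where A: "finite A" "independent A" "span A = V" "card A = dim V"
    using findim_basis[OF assms(1)] .
  show "finite B" "card B \<le> dim V"
    using independent_span_bound[OF A(1) assms(2)] A assms(3) by auto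
qed

lemma findim_sub:
  assumes "findim V" "subspace U" "U \<subseteq> V"
  shows "findim U"
proof -
  obtain B where B: "B \<subseteq> U" "independent B" "U \<subseteq> span B" "card B = dim U"
    using basis_exists[of U] by blast
  have "finite B" using findim_independent(1)[OF assms(1) B(2) order_trans[OF B(1) assms(3)]] .
  moreover have "U = span B" using span_subspace[OF B(1,3) assms(2)] by simp
  ultimately show ?thesis by (auto simp: findim_def)
qed

lemma findim_dim_mono:
  assumes "findim V" "subspace U" "U \<subseteq> V"
  shows "dim U \<le> dim V"
proof -
  obtain B where B: "finite B" "independent B" "span B = U" "card B = dim U"
    using findim_basis[OF findim_sub[OF assms]] .
  then show ?thesis
    using findim_independent(2)[OF assms(1) B(2)] span_superset[of B] assms(3) by simp
qed

lemma findim_dim_less: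
  assumes "findim V" "subspace U" "U \<subseteq> V" "U \<noteq> V"
  shows "dim U < dim V"
proof -
  obtain B where B: "finite B" "independent B" "span B = U" "card B = dim U"
    using findim_basis[OF findim_sub[OF assms(1-3)]] .
  obtain x where x: "x \<in> V" "x \<notin> U" using assms(3,4) by blast
  have "independent (insert x B)" using x B by (intro real_vector.independent_insertI) auto
  moreover have "insert x B \<subseteq> V" using x B assms(3) span_superset by blast
  ultimately have "card (insert x B) \<le> dim V" using findim_independent(2)[OF assms(1)] by blast
  moreover have "x \<notin> B" using x B span_base by blast
  ultimately show ?thesis using B by simp
qed

lemma findim_dim_eq:
  assumes "findim V" "subspace U" "U \<subseteq> V" "dim V \<le> dim U"
  shows "U = V"
  using findim_dim_less[OF assms(1-3)] assms(4) by linarith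

text \<open>\<open>findim V\<close> carries weight here: \<open>dim\<close> is a cardinality, so it
  is also 0 for a space with an infinite basis.\<close>

lemma findim_dim_0:
  assumes "findim V" "dim V = 0"
  shows "V = {0}"
  using findim_basis[OF assms(1)] assms(2) by (metis card_0_eq span_empty)

lemma findim_zero: "findim {0}"
  unfolding findim_def by (rule exI[of _ "{}"]) simp

lemma findim_image: "linear f \<Longrightarrow> findim V \<Longrightarrow> findim (f ` V)"
  unfolding findim_def by (metis finite_imageI linear_span_image)

lemma findim_plus:
  assumes "findim U" "findim V"
  shows "findim {u + v | u v. u \<in> U \<and> v \<in> V}"
proof -
  obtain A B where "finite A" "U = span A" "finite B" "V = span B"
    using assms by (auto simp: findim_def)
  then show ?thesis unfolding findim_def
    by (intro exI[of _ "A \<union> B"] conjI) (simp_all add: span_Un)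
qed

lemma findim_Times:
  fixes U :: "'a::real_vector set" and V :: "'b::real_vector set"
  assumes "findim U" "findim V"
  shows "findim (U \<times> V)"
proof -
  have l: "linear (\<lambda>u::'a. (u, 0::'b))" "linear (\<lambda>v::'b. (0::'a, v))"
    by (auto intro!: linearI)
  have "U \<times> V = {x + y | x y. x \<in> (\<lambda>u. (u, 0)) ` U \<and> y \<in> (\<lambda>v. (0, v)) ` V}"
    by force
  then show ?thesis
    using findim_plus[OF findim_image[OF l(1) assms(1)] findim_image[OF l(2) assms(2)]] by simp
qed

lemma (in lie_algebra) findim_carrier: "findim L"
  using finite_dim by (simp add: findim_def)

text \<open>With a projection \<open>q\<close> onto \<open>W\<close>, the map x - q x kills
  \<open>W\<close> and is injective on \<open>U\<close>, because \<open>U\<close> meets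
  \<open>W\<close> trivially. Following it by a left inverse on \<open>U\<close> gives the
  projection. It is linear on the whole type, so it also serves to extend maps that are known only
  on a carrier.\<close>

lemma projection_exists:
  fixes U W :: "'a::real_vector set"
  assumes "subspace U" "subspace W" "U \<inter> W \<subseteq> {0}"
  obtains p where "linear p" "\<And>x. p x \<in> U" "\<And>x. x \<in> U \<Longrightarrow> p x = x" "\<And>x. x \<in> W \<Longrightarrow> p x = 0"
proof -
  have ex: "\<exists>p. linear p \<and> (\<forall>x. p x \<in> V) \<and> (\<forall>x\<in>V. p x = x)" if V: "subspace V" for V :: "'a set"
  proof -
    have "linear (\<lambda>x::'a. x)" "inj_on (\<lambda>x::'a. x) (span V)" by (auto intro!: linearI)
    then show ?thesis
      using linear_exists_left_inverse_on[of "\<lambda>x::'a. x" V] V by (metis inj_on_id2 rangeI subsetD)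
  qed
  obtain q where q: "linear q" "\<And>x. q x \<in> W" "\<And>x. x \<in> W \<Longrightarrow> q x = x"
    using ex[OF assms(2)] by blast
  have l: "linear (\<lambda>x. x - q x)"
    using q(1) by (simp add: linear_compose_sub linear_id[unfolded id_def])
  have inj: "inj_on (\<lambda>x. x - q x) U"
  proof (rule inj_onI)
    fix x y assume "x \<in> U" "y \<in> U" "x - q x = y - q y"
    then have "x - y = q (x - y)" using q(1) by (simp add: linear_diff algebra_simps)
    moreover have "x - y \<in> U" using \<open>x \<in> U\<close> \<open>y \<in> U\<close> assms(1) by (simp add: subspace_diff)
    ultimately have "x - y \<in> U \<inter> W" using q(2) by (metis IntI)
    then show "x = y" using assms(3) by auto
  qed
  obtain g where g: "range g \<subseteq> U" "linear g" "\<forall>x\<in>U. g (x - q x) = x"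
    using linear_exists_left_inverse_on[OF l, of U] inj assms(1)
    by (metis span_eq_iff)
  show ?thesis
  proof (rule that[of "\<lambda>x. g (x - q x)"])
    show "linear (\<lambda>x. g (x - q x))" using linear_compose[OF l g(2)] by (simp add: o_def)
    show "\<And>x. g (x - q x) \<in> U" using g(1) by blast
    show "\<And>x. x \<in> U \<Longrightarrow> g (x - q x) = x" using g(3) by blast
    show "\<And>x. x \<in> W \<Longrightarrow> g (x - q x) = 0" using q(3) g(2) by (simp add: linear_0)
  qed
qed

section \<open>Fitting decomposition of an operator\<close>

lemma linear_funpow:
  fixes T :: "'a::real_vector \<Rightarrow> 'a"
  shows "linear T \<Longrightarrow> linear (T ^^ n)"
proof (induction n)
  case 0
  show ?case by (auto intro!: linearI)
next
  case (Suc n)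
  then show ?case using linear_compose[of "T ^^ n" T] by (simp add: o_def)
qed

lemma funpow_closed: "(\<And>v. v \<in> V \<Longrightarrow> T v \<in> V) \<Longrightarrow> v \<in> V \<Longrightarrow> (T ^^ n) v \<in> V"
  by (induction n) auto

lemma funpow_image_mono:
  assumes "\<And>v. v \<in> V \<Longrightarrow> T v \<in> V"
  shows "(T ^^ (n + k)) ` V \<subseteq> (T ^^ n) ` V"
  using assms by (auto simp: funpow_add intro!: imageI funpow_closed)

lemma funpow_zero_mono:
  fixes T :: "'a::real_vector \<Rightarrow> 'a"
  assumes "linear T" "(T ^^ n) v = 0" "n \<le> m"
  shows "(T ^^ m) v = 0"
proof -
  have "(T ^^ m) v = (T ^^ (m - n)) ((T ^^ n) v)"
    using assms(3) by (metis comp_apply funpow_add le_add_diff_inverse2)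
  then show ?thesis using assms linear_funpow by (metis linear_0)
qed

lemma fitting_index:
  assumes T: "linear T" and V: "findim V" and inv: "\<And>v. v \<in> V \<Longrightarrow> T v \<in> V"
  obtains n where "\<And>v. v \<in> V \<Longrightarrow> \<exists>u\<in>V. (T ^^ n) v = (T ^^ (n + n)) u"
    and "\<And>v m. v \<in> V \<Longrightarrow> (T ^^ m) v = 0 \<Longrightarrow> (T ^^ n) v = 0"
proof -
  define K where "K m = V \<inter> {v. (T ^^ m) v = 0}" for m
  define I where "I m = (T ^^ m) ` V" for m
  have sV: "subspace V" using V by (rule findim_subspace)
  have K: "subspace (K m)" "K m \<subseteq> V" for m
    unfolding K_def using sV linear_subspace_kernel[OF linear_funpow[OF T]] by (auto intro: subspace_inter)
  have Im: "findim (I m)" "subspace (I m)" for m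
    unfolding I_def using findim_image[OF linear_funpow[OF T] V] findim_subspace by auto
  have Kmono: "K m \<subseteq> K (m + k)" for m k
    using funpow_zero_mono[OF T, of m _ "m + k"] by (auto simp: K_def)
  have Imono: "I (m + k) \<subseteq> I m" for m k
    unfolding I_def using inv by (rule funpow_image_mono)
  have bK: "dim (K m) \<le> dim V" for m using findim_dim_mono[OF V K] .
  \<comment> \<open>Both summands can only decrease as m grows (the subtraction is exact by
    \<open>bK\<close>), so an exponent that minimizes the sum freezes image and kernel
    together.\<close>
  define d where "d m = dim (I m) + (dim V - dim (K m))" for m
  obtain n where n: "\<And>m. d n \<le> d m" using ex_has_least_nat[of "\<lambda>_. True" 0 d] by auto
  have dims: "dim (I (n + k)) \<le> dim (I n)" "dim (K n) \<le> dim (K (n + k))" for k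
    using findim_dim_mono[OF Im(1) Im(2) Imono] findim_dim_mono[OF findim_sub[OF V K] K(1) Kmono] by auto
  have "dim (I (n + k)) = dim (I n) \<and> dim (K (n + k)) = dim (K n)" for k
    using dims[of k] n[of "n + k"] bK[of n] bK[of "n + k"] unfolding d_def by linarith
  then have eqs: "I (n + k) = I n" "K n = K (n + k)" for k
    using findim_dim_eq[OF Im(1) Im(2) Imono, of n k]
      findim_dim_eq[OF findim_sub[OF V K] K(1) Kmono, of n k] by auto
  show ?thesis
  proof (rule that[of n])
    fix v assume "v \<in> V"
    then show "\<exists>u\<in>V. (T ^^ n) v = (T ^^ (n + n)) u" using eqs(1)[of n] by (auto simp: I_def)
  next
    fix v m assume "v \<in> V" "(T ^^ m) v = 0"
    then have "(T ^^ (n + m)) v = 0" using funpow_zero_mono[OF T, of m v "n + m"] by simp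
    then have "v \<in> K (n + m)" using \<open>v \<in> V\<close> by (simp add: K_def)
    then show "(T ^^ n) v = 0" using eqs(2)[of m] by (auto simp: K_def)
  qed
qed

text \<open>\<open>V0\<close> is the generalized kernel and \<open>V1\<close> the stable image. They
  span \<open>V\<close>: if T^n v = T^(2n) u, then v - T^n u lies in \<open>V0\<close>. A vector of
  \<open>V1\<close> killed by some power of \<open>T\<close> is zero, since the kernels have stopped
  growing at n.\<close>

lemma fitting_decomposition:
  assumes T: "linear T" and V: "findim V" and inv: "\<And>v. v \<in> V \<Longrightarrow> T v \<in> V"
  obtains n V0 V1 p where "V0 = {v \<in> V. (T ^^ n) v = 0}" "V1 = (T ^^ n) ` V"
    "subspace V0" "V0 \<subseteq> V" "subspace V1" "V1 \<subseteq> V"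
    "\<And>v. v \<in> V0 \<Longrightarrow> T v \<in> V0" "\<And>v. v \<in> V1 \<Longrightarrow> T v \<in> V1" "V0 \<inter> V1 = {0}"
    "\<And>v. v \<in> V1 \<Longrightarrow> T v = 0 \<Longrightarrow> v = 0"
    "linear p" "\<And>v. p v \<in> V0" "\<And>v. v \<in> V0 \<Longrightarrow> p v = v" "\<And>v. v \<in> V1 \<Longrightarrow> p v = 0"
    "\<And>v. v \<in> V \<Longrightarrow> v - p v \<in> V1"
proof -
  obtain n where n: "\<And>v. v \<in> V \<Longrightarrow> \<exists>u\<in>V. (T ^^ n) v = (T ^^ (n + n)) u"
    "\<And>v m. v \<in> V \<Longrightarrow> (T ^^ m) v = 0 \<Longrightarrow> (T ^^ n) v = 0"
    using fitting_index[OF assms] by blast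
  define V0 where "V0 = {v \<in> V. (T ^^ n) v = 0}"
  define V1 where "V1 = (T ^^ n) ` V"
  have ln: "linear (T ^^ n)" using T by (rule linear_funpow)
  have sV: "subspace V" using V by (rule findim_subspace)
  have s0: "subspace V0"
    using subspace_inter[OF sV linear_subspace_kernel[OF ln]] by (simp add: V0_def Int_def)
  have s1: "subspace V1" unfolding V1_def using ln sV by (rule linear_subspace_image)
  have z: "v = 0" if "v \<in> V1" "(T ^^ m) v = 0" for v m
  proof -
    obtain u where u: "u \<in> V" "v = (T ^^ n) u" using \<open>v \<in> V1\<close> by (auto simp: V1_def)
    then have "(T ^^ (m + n)) u = 0" using that(2) by (simp add: funpow_add)
    then show ?thesis using u n(2) by blast
  qed
  have i01: "V0 \<inter> V1 \<subseteq> {0}" using z by (auto simp: V0_def)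
  have c: "T ((T ^^ n) v) = (T ^^ n) (T v)" for v by (rule funpow_swap1)
  obtain p where p: "linear p" "\<And>x. p x \<in> V0" "\<And>x. x \<in> V0 \<Longrightarrow> p x = x" "\<And>x. x \<in> V1 \<Longrightarrow> p x = 0"
    using projection_exists[OF s0 s1 i01] by metis
  have V1V: "V1 \<subseteq> V" using funpow_closed[of V T, OF inv] by (auto simp: V1_def)
  have V0V: "V0 \<subseteq> V" by (auto simp: V0_def)
  have T0: "T v \<in> V0" if "v \<in> V0" for v using inv linear_0[OF T] that c[of v] by (simp add: V0_def)
  have T1: "T v \<in> V1" if "v \<in> V1" for v using inv that c by (auto simp: V1_def)
  have i0: "V0 \<inter> V1 = {0}" using i01 s0 s1 subspace_0 by blast
  have z1: "v = 0" if "v \<in> V1" "T v = 0" for v using z[of v 1] that by simp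
  have d: "v - p v \<in> V1" if v: "v \<in> V" for v
  proof -
    obtain u where u: "u \<in> V" "(T ^^ n) v = (T ^^ (n + n)) u" using n(1)[OF v] by blast
    have "(T ^^ n) u \<in> V" using inv u(1) by (rule funpow_closed)
    then have a: "v - (T ^^ n) u \<in> V0"
      using v u sV by (simp add: V0_def linear_diff[OF ln] funpow_add subspace_diff)
    have b: "(T ^^ n) u \<in> V1" using u by (auto simp: V1_def)
    have "p v = p (v - (T ^^ n) u) + p ((T ^^ n) u)" by (simp add: p(1) flip: linear_add)
    then have "p v = v - (T ^^ n) u" using p(3)[OF a] p(4)[OF b] by simp
    then show "v - p v \<in> V1" using b by simp
  qed
  show ?thesis
    by (rule that[of V0 n V1 p]) (fact V0_def V1_def s0 V0V s1 V1V T0 T1 i0 z1 p d)+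
qed

section \<open>Traces of operators on a subspace\<close>

definition tr :: "'a::real_vector set \<Rightarrow> ('a \<Rightarrow> 'a) \<Rightarrow> real" where
  "tr V T = (let B = SOME B. finite B \<and> independent B \<and> span B = V
     in \<Sum>b\<in>B. representation B (T b) b)"

lemma tr_some_basis:
  assumes "findim V"
  obtains B where "finite B" "independent B" "span B = V" "\<And>T. tr V T = (\<Sum>b\<in>B. representation B (T b) b)"
proof -
  define B where "B = (SOME B. finite B \<and> independent B \<and> span B = V)"
  have "\<exists>B. finite B \<and> independent B \<and> span B = V" using findim_basis[OF assms] by metis
  then have "finite B \<and> independent B \<and> span B = V" unfolding B_def by (rule someI_ex)
  moreover have "tr V T = (\<Sum>b\<in>B. representation B (T b) b)" for T
    by (simp add: tr_def Let_def B_def)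
  ultimately show ?thesis using that[of B] by simp
qed

text \<open>\<open>tr\<close> uses one fixed basis per space, and this lemma is the only bridge
  between bases. Allowing two spaces, even of different types, is essential: an inclusion in place
  of one map gives \<open>tr_restrict\<close>, coordinate injections give
  \<open>tr_Times\<close>.\<close>

lemma tr_comm:
  assumes V: "findim V" and W: "findim W" and S: "linear S" and T: "linear T"
    and TV: "\<And>v. v \<in> V \<Longrightarrow> T v \<in> W" and SW: "\<And>w. w \<in> W \<Longrightarrow> S w \<in> V"
  shows "tr V (\<lambda>v. S (T v)) = tr W (\<lambda>w. T (S w))"
proof -
  \<comment> \<open>Stated for arbitrary bases and types so that it can be used for both orders of
    composition; the two double sums then differ by a swap.\<close>
  have half: "(\<Sum>b\<in>B. representation B (S (T b)) b)
      = (\<Sum>b\<in>B. \<Sum>c\<in>C. representation C (T b) c * representation B (S c) b)"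
    if B: "finite B" "independent B" and C: "finite C" "independent C"
      and S: "linear S" and TB: "\<And>b. b \<in> B \<Longrightarrow> T b \<in> span C" and SC: "\<And>c. c \<in> C \<Longrightarrow> S c \<in> span B"
    for B :: "'c::real_vector set" and C :: "'d::real_vector set" and S T
  proof (rule sum.cong[OF refl])
    fix b assume b: "b \<in> B"
    have "T b = (\<Sum>c\<in>C. representation C (T b) c *\<^sub>R c)"
      using real_vector.sum_representation_eq[OF C(2) TB[OF b] C(1) order_refl] by simp
    then have "S (T b) = (\<Sum>c\<in>C. representation C (T b) c *\<^sub>R S c)"
      using S by (metis (no_types, lifting) linear_scale linear_sum sum.cong)
    then have "representation B (S (T b)) b
        = representation B (\<Sum>c\<in>C. representation C (T b) c *\<^sub>R S c) b" by simp
    also have "\<dots> = (\<Sum>c\<in>C. representation B (representation C (T b) c *\<^sub>R S c) b)"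
      using SC by (subst real_vector.representation_sum[OF B(2)]) (auto intro: span_scale)
    also have "\<dots> = (\<Sum>c\<in>C. representation C (T b) c * representation B (S c) b)"
      using SC by (intro sum.cong refl) (simp add: real_vector.representation_scale[OF B(2)])
    finally show "representation B (S (T b)) b
        = (\<Sum>c\<in>C. representation C (T b) c * representation B (S c) b)" .
  qed
  obtain B where B: "finite B" "independent B" "span B = V"
    "\<And>T. tr V T = (\<Sum>b\<in>B. representation B (T b) b)" using tr_some_basis[OF V] by metis
  obtain C where C: "finite C" "independent C" "span C = W"
    "\<And>T. tr W T = (\<Sum>b\<in>C. representation C (T b) b)" using tr_some_basis[OF W] by metis
  have TB: "\<And>b. b \<in> B \<Longrightarrow> T b \<in> span C" and SC: "\<And>c. c \<in> C \<Longrightarrow> S c \<in> span B"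
    using TV SW B(3) C(3) span_base by blast+
  have "tr V (\<lambda>v. S (T v)) = (\<Sum>b\<in>B. \<Sum>c\<in>C. representation C (T b) c * representation B (S c) b)"
    unfolding B(4) using half[OF B(1,2) C(1,2) S TB SC] by simp
  also have "\<dots> = (\<Sum>c\<in>C. \<Sum>b\<in>B. representation B (S c) b * representation C (T b) c)"
    by (subst sum.swap) (simp add: mult.commute)
  also have "\<dots> = tr W (\<lambda>w. T (S w))"
    unfolding C(4) using half[OF C(1,2) B(1,2) T SC TB] by simp
  finally show ?thesis .
qed

lemma tr_cong:
  assumes "findim V" "\<And>v. v \<in> V \<Longrightarrow> S v = T v"
  shows "tr V S = tr V T"
proof -
  obtain B where B: "span B = V" "\<And>T. tr V T = (\<Sum>b\<in>B. representation B (T b) b)"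
    using tr_some_basis[OF assms(1)] by metis
  have "\<And>b. b \<in> B \<Longrightarrow> S b = T b" using assms(2) B(1) span_base by blast
  then show ?thesis unfolding B(2) by simp
qed

lemma tr_add:
  assumes "findim V" "\<And>v. v \<in> V \<Longrightarrow> S v \<in> V" "\<And>v. v \<in> V \<Longrightarrow> T v \<in> V"
  shows "tr V (\<lambda>v. S v + T v) = tr V S + tr V T"
proof -
  obtain B where B: "independent B" "span B = V" "\<And>T. tr V T = (\<Sum>b\<in>B. representation B (T b) b)"
    using tr_some_basis[OF assms(1)] by metis
  have "\<And>b. b \<in> B \<Longrightarrow> S b \<in> span B \<and> T b \<in> span B" using assms(2,3) B(2) span_base by blast
  then have "\<And>b. b \<in> B \<Longrightarrow> representation B (S b + T b) b = representation B (S b) b + representation B (T b) b"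
    by (simp add: real_vector.representation_add[OF B(1)])
  then show ?thesis unfolding B(3) by (simp add: sum.distrib)
qed

lemma tr_scale:
  assumes "findim V" "\<And>v. v \<in> V \<Longrightarrow> T v \<in> V"
  shows "tr V (\<lambda>v. c *\<^sub>R T v) = c * tr V T"
proof -
  obtain B where B: "independent B" "span B = V" "\<And>T. tr V T = (\<Sum>b\<in>B. representation B (T b) b)"
    using tr_some_basis[OF assms(1)] by metis
  have "\<And>b. b \<in> B \<Longrightarrow> T b \<in> span B" using assms(2) B(2) span_base by blast
  then have "\<And>b. b \<in> B \<Longrightarrow> representation B (c *\<^sub>R T b) b = c * representation B (T b) b"
    by (simp add: real_vector.representation_scale[OF B(1)])
  then show ?thesis unfolding B(3) by (simp add: sum_distrib_left)
qed

lemma tr_diff: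
  assumes "findim V" "\<And>v. v \<in> V \<Longrightarrow> S v \<in> V" "\<And>v. v \<in> V \<Longrightarrow> T v \<in> V"
  shows "tr V (\<lambda>v. S v - T v) = tr V S - tr V T"
  using tr_add[OF assms(1), of S "\<lambda>v. (-1) *\<^sub>R T v"] tr_scale[OF assms(1), of T "-1"] assms(2,3)
    subspace_neg[OF findim_subspace[OF assms(1)]] by simp

lemma tr_ident:
  assumes "findim V"
  shows "tr V (\<lambda>v. v) = dim V"
proof -
  obtain B where B: "finite B" "independent B" "span B = V" "\<And>T. tr V T = (\<Sum>b\<in>B. representation B (T b) b)"
    using tr_some_basis[OF assms(1)] by metis
  have "tr V (\<lambda>v. v) = (\<Sum>b\<in>B. 1)"
    unfolding B(4) using B(2) by (intro sum.cong) (auto simp: real_vector.representation_basis)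
  also have "\<dots> = dim V" using B dim_span_eq_card_independent[OF B(2)] by simp
  finally show ?thesis .
qed

lemma tr_sum:
  assumes "findim V" "\<And>i v. i \<in> I \<Longrightarrow> v \<in> V \<Longrightarrow> T i v \<in> V"
  shows "tr V (\<lambda>v. \<Sum>i\<in>I. T i v) = (\<Sum>i\<in>I. tr V (T i))"
  using assms(2)
proof (induction I rule: infinite_finite_induct)
  case (insert i I)
  have "tr V (\<lambda>v. T i v + (\<Sum>i\<in>I. T i v)) = tr V (T i) + tr V (\<lambda>v. \<Sum>i\<in>I. T i v)"
    using insert.prems assms(1) by (intro tr_add) (auto intro: subspace_sum findim_subspace)
  then show ?case using insert by simp
next
  have "tr V (\<lambda>v. 0 *\<^sub>R v) = 0 * tr V (\<lambda>v. v)" using assms(1) by (rule tr_scale)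
  then have z: "tr V (\<lambda>v. 0) = 0" by simp
  { case empty show ?case using z by simp }
  { case (infinite A) then show ?case using z by simp }
qed

text \<open>\<open>T\<close> factors through the inclusion of \<open>W\<close>, so
  \<open>tr_comm\<close> moves the trace to \<open>W\<close>.\<close>

lemma tr_restrict:
  fixes V W :: "'a::real_vector set"
  assumes V: "findim V" and W: "subspace W" "W \<subseteq> V" and T: "linear T" "\<And>v. v \<in> V \<Longrightarrow> T v \<in> W"
  shows "tr V T = tr W T"
proof -
  have "linear (\<lambda>x::'a. x)" by (auto intro!: linearI)
  from tr_comm[OF V findim_sub[OF V W] this T] show ?thesis using W(2) by (simp add: subset_iff)
qed

text \<open>As \<open>T\<close> maps the image of T^k into that of T^(k+1),
  \<open>tr_restrict\<close> walks down the chain of images until it reaches {0}.\<close>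

lemma tr_nilpotent:
  fixes V :: "'a::real_vector set"
  assumes V: "findim V" and T: "linear T" and inv: "\<And>v. v \<in> V \<Longrightarrow> T v \<in> V"
    and nil: "\<And>v. v \<in> V \<Longrightarrow> (T ^^ n) v = 0"
  shows "tr V T = 0"
proof -
  have s: "findim ((T ^^ k) ` V)" for k using findim_image[OF linear_funpow[OF T] V] .
  have eq: "tr V T = tr ((T ^^ k) ` V) T" for k
  proof (induction k)
    case (Suc k)
    have "(T ^^ Suc k) ` V \<subseteq> (T ^^ k) ` V" using funpow_image_mono[of V T, OF inv, of k 1] by simp
    moreover have "T v \<in> (T ^^ Suc k) ` V" if "v \<in> (T ^^ k) ` V" for v using that by auto
    ultimately have "tr ((T ^^ k) ` V) T = tr ((T ^^ Suc k) ` V) T"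
      by (rule tr_restrict[OF s findim_subspace[OF s] _ T])
    then show ?case using Suc by simp
  qed simp
  have "(T ^^ n) ` V = {0}" using nil subspace_0[OF findim_subspace[OF V]] by (auto simp: image_iff)
  then have "tr V T = tr {0} T" using eq[of n] by simp
  also have "\<dots> = tr {0} (\<lambda>v::'a. 0 *\<^sub>R v)"
    using T by (intro tr_cong findim_zero) (simp add: linear_0)
  also have "\<dots> = 0" using tr_scale[OF findim_zero, of "\<lambda>v::'a. v" 0] by simp
  finally show ?thesis .
qed

lemma tr_direct_sum:
  assumes V: "findim V" and U: "subspace U" "U \<subseteq> V" and W: "subspace W" "W \<subseteq> V"
    and p: "linear p" "\<And>v. p v \<in> U" "\<And>v. v \<in> U \<Longrightarrow> p v = v" "\<And>v. v \<in> W \<Longrightarrow> p v = 0"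
      "\<And>v. v \<in> V \<Longrightarrow> v - p v \<in> W"
    and T: "linear T" "\<And>v. v \<in> U \<Longrightarrow> T v \<in> U" "\<And>v. v \<in> W \<Longrightarrow> T v \<in> W"
  shows "tr V T = tr U T + tr W T"
proof -
  let ?A = "\<lambda>v. T (p v)" and ?B = "\<lambda>v. T (v - p v)"
  have l: "linear (\<lambda>v. v - p v)" using p(1) by (simp add: linear_compose_sub linear_id[unfolded id_def])
  have lA: "linear ?A" "linear ?B"
    using linear_compose[OF p(1) T(1)] linear_compose[OF l T(1)] by (simp_all add: o_def)
  have "tr V T = tr V (\<lambda>v. ?A v + ?B v)"
    using T(1) by (intro tr_cong V) (simp flip: linear_add)
  also have "\<dots> = tr V ?A + tr V ?B" using T p U W by (intro tr_add V) auto
  also have "tr V ?A = tr U ?A" using T p by (intro tr_restrict[OF V U lA(1)]) auto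
  also have "\<dots> = tr U T" using p by (intro tr_cong findim_sub[OF V U]) auto
  also have "tr V ?B = tr W ?B" using T p by (intro tr_restrict[OF V W lA(2)]) auto
  also have "\<dots> = tr W T" using p by (intro tr_cong findim_sub[OF V W]) auto
  finally show ?thesis .
qed

lemma tr_Times:
  fixes V :: "'a::real_vector set" and W :: "'b::real_vector set"
  assumes V: "findim V" and W: "findim W" and M: "linear M" "\<And>z. z \<in> V \<times> W \<Longrightarrow> M z \<in> V \<times> W"
  shows "tr (V \<times> W) M = tr V (\<lambda>v. fst (M (v, 0))) + tr W (\<lambda>w. snd (M (0, w)))"
proof -
  have VW: "findim (V \<times> W)" using V W by (rule findim_Times)
  have z: "0 \<in> V" "0 \<in> W" using V W findim_subspace subspace_0 by blast+
  have l: "linear (\<lambda>v::'a. M (v, 0))" "linear (\<lambda>w::'b. M (0, w))"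
    by (auto intro!: linearI simp: M(1) simp flip: linear_add linear_scale)
  have "tr (V \<times> W) M = tr (V \<times> W) (\<lambda>z. M (fst z, 0) + M (0, snd z))"
    using M(1) by (intro tr_cong VW) (simp flip: linear_add)
  also have "\<dots> = tr (V \<times> W) (\<lambda>z. M (fst z, 0)) + tr (V \<times> W) (\<lambda>z. M (0, snd z))"
    using M(2) z by (intro tr_add VW) auto
  also have "tr (V \<times> W) (\<lambda>z. M (fst z, 0)) = tr V (\<lambda>v. fst (M (v, 0)))"
    using M(2) z by (intro tr_comm[OF VW V l(1) linear_fst]) (auto simp: mem_Times_iff)
  also have "tr (V \<times> W) (\<lambda>z. M (0, snd z)) = tr W (\<lambda>w. snd (M (0, w)))"
    using M(2) z by (intro tr_comm[OF VW W l(2) linear_snd]) (auto simp: mem_Times_iff)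
  finally show ?thesis .
qed

section \<open>Operators on spaces with a complex structure\<close>

text \<open>Complex vector spaces are kept as real ones with an operator of square -1. Complex
  scalars act through \<open>cs\<close>, while subspaces, dimensions and traces remain real, so all
  lemmas above apply to them.\<close>

locale complex_structure =
  fixes J :: "'a::real_vector \<Rightarrow> 'a"
  assumes linear_J: "linear J" and J_J: "\<And>v. J (J v) = - v"
begin

definition cs :: "complex \<Rightarrow> 'a \<Rightarrow> 'a" where
  "cs c v = Re c *\<^sub>R v + Im c *\<^sub>R J v"

lemma cs_add_right: "cs c (v + w) = cs c v + cs c w"
  by (simp add: cs_def linear_add[OF linear_J] algebra_simps)

lemma cs_add_left: "cs (a + b) v = cs a v + cs b v"
  by (simp add: cs_def algebra_simps)

lemma cs_mult: "cs (a * b) v = cs a (cs b v)"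
  by (simp add: cs_def linear_add[OF linear_J] linear_scale[OF linear_J] J_J algebra_simps)

lemma cs_simps [simp]: "cs 0 v = 0" "cs 1 v = v" "cs c 0 = 0"
  by (simp_all add: cs_def linear_0[OF linear_J])

lemma cs_of_real: "cs (of_real r) v = r *\<^sub>R v"
  by (simp add: cs_def)

lemma linear_cs: "linear (cs c)"
  by (rule linearI) (simp_all add: cs_def linear_add[OF linear_J] linear_scale[OF linear_J] algebra_simps)

lemma cs_minus_left: "cs (- c) v = - cs c v"
  by (simp add: cs_def)

lemma cs_diff_left: "cs (a - b) v = cs a v - cs b v"
  by (simp add: cs_def algebra_simps)

lemma cs_diff_right: "cs c (v - w) = cs c v - cs c w"
  by (rule linear_diff[OF linear_cs])

lemma cs_eq_0: "cs c v = 0 \<Longrightarrow> c = 0 \<or> v = 0"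
  using cs_mult[of "inverse c" c v] by (cases "c = 0") auto

lemma cs_closed: "subspace V \<Longrightarrow> J v \<in> V \<Longrightarrow> v \<in> V \<Longrightarrow> cs c v \<in> V"
  by (simp add: cs_def subspace_add subspace_scale)

end

locale complex_linear_operator = complex_structure +
  fixes T :: "'a \<Rightarrow> 'a"
  assumes linear_T: "linear T" and T_J: "\<And>v. T (J v) = J (T v)"
begin

lemma T_cs: "T (cs c v) = cs c (T v)"
  by (simp add: cs_def linear_add[OF linear_T] linear_scale[OF linear_T] T_J)

text \<open>The vector p(T) v, computed by Horner's rule.\<close>

definition peval :: "'a \<Rightarrow> complex poly \<Rightarrow> 'a" where
  "peval v p = fold_coeffs (\<lambda>a w. cs a v + T w) p 0"

lemma peval_0 [simp]: "peval v 0 = 0"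
  by (simp add: peval_def)

lemma peval_pCons [simp]: "peval v (pCons a p) = cs a v + T (peval v p)"
  by (cases "a = 0 \<and> p = 0") (auto simp: peval_def linear_0[OF linear_T])

lemma peval_add: "peval v (p + q) = peval v p + peval v q"
  by (induction p q rule: poly_induct2)
    (simp_all add: linear_0[OF linear_T] linear_add[OF linear_T] cs_add_left algebra_simps)

lemma peval_smult: "peval v (smult c p) = cs c (peval v p)"
  by (induction p) (simp_all add: cs_add_right cs_mult T_cs)

lemma peval_diff: "peval v (p - q) = peval v p - peval v q"
  using peval_add[of v "p - q" q] by simp

lemma peval_monom: "peval v (monom c n) = cs c ((T ^^ n) v)"
  by (induction n) (simp_all add: monom_0 monom_Suc T_cs linear_0[OF linear_T])

lemma peval_sum: "peval v (\<Sum>i\<in>I. p i) = (\<Sum>i\<in>I. peval v (p i))"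
  by (induction I rule: infinite_finite_induct) (simp_all add: peval_add)

lemma peval_linear_mult: "peval v ([:- c, 1:] * p) = T (peval v p) - cs c (peval v p)"
  by (simp add: peval_add peval_diff peval_smult cs_minus_left)

lemma peval_closed:
  assumes "subspace V" "\<And>v. v \<in> V \<Longrightarrow> J v \<in> V" "\<And>v. v \<in> V \<Longrightarrow> T v \<in> V" "v \<in> V"
  shows "peval v p \<in> V"
  by (induction p) (use assms in \<open>auto intro: subspace_add cs_closed subspace_0\<close>)

text \<open>Split off a linear factor with root c, leaving q. Either q already annihilates
  \<open>v\<close> and has smaller degree, or the value of q at \<open>v\<close> is an eigenvector
  for c.\<close>

lemma eigenvector_of_annihilator:
  assumes V: "subspace V" "\<And>v. v \<in> V \<Longrightarrow> J v \<in> V" "\<And>v. v \<in> V \<Longrightarrow> T v \<in> V"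
    and v: "v \<in> V" "v \<noteq> 0"
  shows "p \<noteq> 0 \<Longrightarrow> peval v p = 0 \<Longrightarrow> \<exists>c w. w \<in> V \<and> w \<noteq> 0 \<and> T w = cs c w"
proof (induction "degree p" arbitrary: p)
  case 0
  then obtain a where a: "p = [:a:]" by (metis degree_eq_zeroE)
  then have "a \<noteq> 0" "cs a v = 0" using 0 by (auto simp: linear_0[OF linear_T])
  then show ?case using cs_eq_0 v by blast
next
  case (Suc n)
  then have "\<not> constant (poly p)" using constant_degree[of p] by simp
  then obtain c where "poly p c = 0" using fundamental_theorem_of_algebra by blast
  then obtain q where q: "p = [:- c, 1:] * q" using poly_eq_0_iff_dvd by (metis dvdE)
  show ?case
  proof (cases "peval v q = 0")
    case True
    have q0: "q \<noteq> 0" using q Suc.prems by auto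
    then have "degree p = Suc (degree q)" unfolding q by (subst degree_mult_eq) auto
    then show ?thesis using Suc.hyps True q0 by simp
  next
    case False
    have "peval v q \<in> V" using V v(1) by (rule peval_closed)
    moreover have "T (peval v q) = cs c (peval v q)"
      using Suc.prems peval_linear_mult[of v c q] q by simp
    ultimately show ?thesis using False by blast
  qed
qed

end

section \<open>Eigenvectors from a linear dependence among iterates\<close>

lemma span_image_lessThan:
  fixes g :: "nat \<Rightarrow> 'a::real_vector"
  assumes "x \<in> span (g ` {..<k})"
  obtains c where "x = (\<Sum>i<k. c i *\<^sub>R g i)"
proof -
  let ?S = "range (\<lambda>c. \<Sum>i<k. c i *\<^sub>R g i)"
  have "subspace ?S"
  proof (rule subspaceI)
    show "0 \<in> ?S" by (rule image_eqI[of _ _ "\<lambda>_. 0"]) auto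
    show "x + y \<in> ?S" if xy: "x \<in> ?S" "y \<in> ?S" for x y
    proof -
      obtain c d where "x = (\<Sum>i<k. c i *\<^sub>R g i)" "y = (\<Sum>i<k. d i *\<^sub>R g i)"
        using xy by (auto simp: image_iff)
      then show ?thesis
        by (intro image_eqI[of _ _ "\<lambda>i. c i + d i"]) (auto simp: scaleR_add_left sum.distrib)
    qed
    show "r *\<^sub>R x \<in> ?S" if x: "x \<in> ?S" for r x
    proof -
      obtain c where "x = (\<Sum>i<k. c i *\<^sub>R g i)" using x by (auto simp: image_iff)
      then show ?thesis
        by (intro image_eqI[of _ _ "\<lambda>i. r * c i"]) (auto simp: scaleR_sum_right)
    qed
  qed
  moreover have "g ` {..<k} \<subseteq> ?S"
  proof clarify
    fix j assume "j < k"
    then show "g j \<in> ?S"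
      by (intro image_eqI[of _ _ "\<lambda>i. if i = j then 1 else 0"])
        (auto simp: if_distrib[of "\<lambda>c. c *\<^sub>R _"] cong: if_cong)
  qed
  ultimately have "span (g ` {..<k}) \<subseteq> ?S" by (rule span_minimal[rotated])
  then show ?thesis using assms that by blast
qed

text \<open>If no iterate depended on the earlier ones, the first dim V + 1 of them would be
  independent in \<open>V\<close>.\<close>

lemma krylov_dependence:
  assumes "findim V" "\<And>v. v \<in> V \<Longrightarrow> T v \<in> V" "v \<in> V"
  obtains k where "(T ^^ k) v \<in> span ((\<lambda>i. (T ^^ i) v) ` {..<k})"
proof (rule ccontr)
  assume "\<not> thesis"
  then have n: "(T ^^ k) v \<notin> span ((\<lambda>i. (T ^^ i) v) ` {..<k})" for k using that by blast
  have ind: "independent ((\<lambda>i. (T ^^ i) v) ` {..<k}) \<and> card ((\<lambda>i. (T ^^ i) v) ` {..<k}) = k" for k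
  proof (induction k)
    case (Suc k)
    let ?S = "(\<lambda>i. (T ^^ i) v) ` {..<k}"
    have "(\<lambda>i. (T ^^ i) v) ` {..<Suc k} = insert ((T ^^ k) v) ?S" by (simp add: lessThan_Suc)
    moreover have "(T ^^ k) v \<notin> ?S" using n[of k] span_base[of "(T ^^ k) v" ?S] by metis
    ultimately show ?case using Suc n[of k] by (simp add: independent_insert)
  qed (simp add: independent_empty)
  have "(\<lambda>i. (T ^^ i) v) ` {..<Suc (dim V)} \<subseteq> V"
    using funpow_closed[of V T v] assms(2,3) by auto
  then show False
    using findim_independent(2)[OF assms(1), of "(\<lambda>i. (T ^^ i) v) ` {..<Suc (dim V)}"]
      ind[of "Suc (dim V)"] by simp
qed

context complex_linear_operator
begin

lemma eigenvector_exists: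
  assumes V: "findim V" "\<And>v. v \<in> V \<Longrightarrow> J v \<in> V" "\<And>v. v \<in> V \<Longrightarrow> T v \<in> V"
    and "V \<noteq> {0}"
  obtains c w where "w \<in> V" "w \<noteq> 0" "T w = cs c w"
proof -
  have sV: "subspace V" using V(1) by (rule findim_subspace)
  then obtain v where v: "v \<in> V" "v \<noteq> 0" using \<open>V \<noteq> {0}\<close> subspace_0 by blast
  obtain k where "(T ^^ k) v \<in> span ((\<lambda>i. (T ^^ i) v) ` {..<k})"
    using krylov_dependence[of V T v] V(1,3) v(1) by blast
  then obtain c where c: "(T ^^ k) v = (\<Sum>i<k. c i *\<^sub>R (T ^^ i) v)"
    using span_image_lessThan by blast
  \<comment> \<open>The dependence relation read as a monic polynomial: the sum has only degrees
    below k, so \<open>?p\<close> is nonzero.\<close>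
  let ?p = "monom 1 k - (\<Sum>i<k. monom (complex_of_real (c i)) i)"
  have "coeff (\<Sum>i<k. monom (complex_of_real (c i)) i) k = 0"
    by (simp add: coeff_sum)
  then have "coeff ?p k = 1" by simp
  then have "?p \<noteq> 0" by (metis coeff_0 zero_neq_one)
  moreover have "peval v ?p = 0"
    using c by (simp add: peval_diff peval_sum peval_monom cs_of_real)
  ultimately show ?thesis
    using eigenvector_of_annihilator[of V v ?p] sV V(2,3) v that by blast
qed

definition N :: "complex \<Rightarrow> 'a \<Rightarrow> 'a" where
  "N c v = T v - cs c v"

lemma linear_N: "linear (N c)"
  unfolding N_def by (intro linear_compose_sub linear_T linear_cs)

lemma N_cs: "N c (cs d v) = cs d (N c v)"
  by (simp add: N_def T_cs cs_diff_right mult.commute flip: cs_mult)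

lemma N_pow_cs: "(N c ^^ n) (cs d v) = cs d ((N c ^^ n) v)"
  by (induction n) (simp_all add: N_cs)

lemma J_cs: "J v = cs \<i> v"
  by (simp add: cs_def)

lemma N_0: "N 0 = T"
  by (simp add: N_def fun_eq_iff)

text \<open>Induction on m reduces to a vector killed by \<open>N d\<close> itself, on which
  \<open>N c\<close> is the nonzero scalar d - c and thus cannot be nilpotent.\<close>

lemma N_inj_on_generalized_eigenspace:
  assumes "c \<noteq> d" "(N c ^^ n) v = 0" "(N d ^^ m) v = 0"
  shows "v = 0"
  using assms(2,3)
proof (induction m arbitrary: v)
  case (Suc m)
  have comm: "N d (N c u) = N c (N d u)" for u
    by (simp add: N_def T_cs cs_diff_right linear_diff[OF linear_T] mult.commute flip: cs_mult)
  have comm': "(N c ^^ k) (N d u) = N d ((N c ^^ k) u)" for k u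
    by (induction k) (simp_all add: comm)
  have "(N c ^^ n) (N d v) = 0" using Suc.prems comm' by (simp add: linear_0[OF linear_N])
  moreover have "(N d ^^ m) (N d v) = 0" using Suc.prems by (simp add: funpow_swap1)
  ultimately have "N d v = 0" by (rule Suc.IH)
  then have "N c v = cs (d - c) v" by (simp add: N_def cs_diff_left)
  then have "(N c ^^ k) v = cs ((d - c) ^ k) v" for k
    by (induction k) (simp_all add: N_cs cs_mult[symmetric] mult.commute)
  then have "cs ((d - c) ^ n) v = 0" using Suc.prems(1) by simp
  then show ?case using cs_eq_0 assms(1) by fastforce
qed simp

text \<open>The operator \<open>y\<close> is the complex conjugate of the semisimple part of \<open>T\<close>, so the real trace of
  \<open>T \<circ> y\<close> is the sum of the squared moduli of the eigenvalues.\<close>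

lemma conjugate_operator:
  assumes "findim V" "\<And>v. v \<in> V \<Longrightarrow> J v \<in> V" "\<And>v. v \<in> V \<Longrightarrow> T v \<in> V"
  shows "\<exists>y. linear y \<and> (\<forall>v\<in>V. y v \<in> V)
    \<and> (\<forall>c n. \<forall>v\<in>V. (N c ^^ n) v = 0 \<longrightarrow> y v = cs (cnj c) v)
    \<and> V \<subseteq> span {v \<in> V. \<exists>c n. (N c ^^ n) v = 0}
    \<and> 0 \<le> tr V (\<lambda>v. T (y v))
    \<and> (tr V (\<lambda>v. T (y v)) = 0 \<longrightarrow> (\<exists>n. \<forall>v\<in>V. (T ^^ n) v = 0))"
  using assms
proof (induction "dim V" arbitrary: V rule: less_induct)
  case (less V)
  have V: "findim V" and JV: "\<And>v. v \<in> V \<Longrightarrow> J v \<in> V" and TV: "\<And>v. v \<in> V \<Longrightarrow> T v \<in> V"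
    using less.prems by auto
  have sV: "subspace V" using V by (rule findim_subspace)
  show ?case
  proof (cases "V = {0}")
    case True
    have l0: "linear (\<lambda>_. 0::'a)" by (auto intro!: linearI)
    have tr0: "tr V (\<lambda>v. T 0) = 0"
      using tr_nilpotent[OF V, of "\<lambda>v. 0" 1] l0 sV by (simp add: linear_0[OF linear_T] subspace_0)
    show ?thesis
    proof (intro exI[of _ "\<lambda>_. 0"] conjI impI)
      show "\<forall>v\<in>V. (0::'a) \<in> V" using sV by (simp add: subspace_0)
      show "\<forall>c n. \<forall>v\<in>V. (N c ^^ n) v = 0 \<longrightarrow> 0 = cs (cnj c) v" using True by simp
      show "V \<subseteq> span {v \<in> V. \<exists>c n. (N c ^^ n) v = 0}" unfolding True using span_zero by blast
      have "\<forall>v\<in>V. (T ^^ 0) v = 0" using True by simp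
      then show "\<exists>n. \<forall>v\<in>V. (T ^^ n) v = 0" by blast
    qed (use l0 tr0 in simp_all)
  next
    case False
    obtain c w where w: "w \<in> V" "w \<noteq> 0" "T w = cs c w"
      by (rule eigenvector_exists[OF V JV TV False])
    have csV: "cs d v \<in> V" if "v \<in> V" for d v using cs_closed[OF sV JV that] that .
    have NV: "N d v \<in> V" if "v \<in> V" for d v unfolding N_def using that TV csV sV by (simp add: subspace_diff)
    \<comment> \<open>\<open>V0\<close> is the generalized eigenspace of c and \<open>V1\<close> its
      invariant complement. The eigenvector \<open>w\<close> lies outside \<open>V1\<close>, so the
      induction hypothesis covers \<open>V1\<close>.\<close>
    obtain n V0 V1 p where V0: "V0 = {v \<in> V. (N c ^^ n) v = 0}" and V1: "V1 = (N c ^^ n) ` V"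
      and s0: "subspace V0" "V0 \<subseteq> V" and s1: "subspace V1" "V1 \<subseteq> V"
      and N0: "\<And>v. v \<in> V0 \<Longrightarrow> N c v \<in> V0" and N1: "\<And>v. v \<in> V1 \<Longrightarrow> N c v \<in> V1" and V01: "V0 \<inter> V1 = {0}"
      and inj: "\<And>v. v \<in> V1 \<Longrightarrow> N c v = 0 \<Longrightarrow> v = 0"
      and p: "linear p" "\<And>v. p v \<in> V0" "\<And>v. v \<in> V0 \<Longrightarrow> p v = v" "\<And>v. v \<in> V1 \<Longrightarrow> p v = 0"
      "\<And>v. v \<in> V \<Longrightarrow> v - p v \<in> V1"
      by (rule fitting_decomposition[OF linear_N[of c] V NV]) (assumption | rule that; assumption)+
    have f0: "findim V0" and f1: "findim V1" using findim_sub[OF V] s0 s1 by blast+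
    have "N c w = 0" using w(3) by (simp add: N_def)
    then have "w \<notin> V1" using inj w(2) by blast
    then have "V1 \<noteq> V" using w(1) by blast
    then have dim1: "dim V1 < dim V" using findim_dim_less[OF V s1] by blast
    have "V0 \<noteq> {0}"
    proof
      assume "V0 = {0}"
      then have "V \<subseteq> V1" using p(2,5) by fastforce
      then show False using \<open>V1 \<noteq> V\<close> s1 by blast
    qed
    then have dim0: "dim V0 \<noteq> 0" using findim_dim_0[OF f0] by blast
    have cs0: "cs d v \<in> V0" if "v \<in> V0" for d v
      using that csV by (simp add: V0 N_pow_cs)
    have cs1: "cs d v \<in> V1" if "v \<in> V1" for d v
      using that csV by (auto simp: V1 simp flip: N_pow_cs)
    have TN: "T v = N c v + cs c v" for v by (simp add: N_def)
    have T0: "T v \<in> V0" if "v \<in> V0" for v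
      using subspace_add[OF s0(1) N0[OF that] cs0[OF that]] by (simp add: TN[of v])
    have T1: "T v \<in> V1" if "v \<in> V1" for v
      using subspace_add[OF s1(1) N1[OF that] cs1[OF that]] by (simp add: TN[of v])
    have Nd0: "N d v \<in> V0" if "v \<in> V0" for d v
      using subspace_diff[OF s0(1) T0[OF that] cs0[OF that]] by (simp add: N_def)
    have Nd1: "N d v \<in> V1" if "v \<in> V1" for d v
      using subspace_diff[OF s1(1) T1[OF that] cs1[OF that]] by (simp add: N_def)
    have J1: "J v \<in> V1" if "v \<in> V1" for v using cs1[OF that] by (simp add: J_cs)
    obtain z where z: "linear z" "\<forall>v\<in>V1. z v \<in> V1"
      "\<forall>d n. \<forall>v\<in>V1. (N d ^^ n) v = 0 \<longrightarrow> z v = cs (cnj d) v"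
      "V1 \<subseteq> span {v \<in> V1. \<exists>d n. (N d ^^ n) v = 0}"
      "0 \<le> tr V1 (\<lambda>v. T (z v))"
      "tr V1 (\<lambda>v. T (z v)) = 0 \<longrightarrow> (\<exists>n. \<forall>v\<in>V1. (T ^^ n) v = 0)"
      by (rule exE[OF less.hyps[OF dim1 f1 J1 T1]], assumption, assumption, elim conjE, rule that)
    \<comment> \<open>Conjugate scalar on \<open>V0\<close>, inductive operator on
      \<open>V1\<close>.\<close>
    define y where "y v = cs (cnj c) (p v) + z (v - p v)" for v
    have lq: "linear (\<lambda>v. v - p v)" using p(1) by (simp add: linear_compose_sub linear_id[unfolded id_def])
    have ly: "linear y"
      unfolding y_def using linear_compose[OF p(1) linear_cs] linear_compose[OF lq z(1)]
      by (intro linear_compose_add) (simp_all add: o_def)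
    have y0: "y v = cs (cnj c) v" if "v \<in> V0" for v
      using that p(3) by (simp add: y_def linear_0[OF z(1)])
    have y1: "y v = z v" if "v \<in> V1" for v
      using that p(4) by (simp add: y_def)
    have yV0: "y v \<in> V0" if "v \<in> V0" for v using y0[OF that] cs0[OF that] by simp
    have yV1: "y v \<in> V1" if "v \<in> V1" for v using y1[OF that] z(2) that by simp
    have yV: "y v \<in> V" if "v \<in> V" for v
    proof -
      have "z (v - p v) \<in> V" using p(5)[OF that] z(2) s1(2) by blast
      moreover have "cs (cnj c) (p v) \<in> V" using cs0[OF p(2)] s0(2) by blast
      ultimately show ?thesis unfolding y_def using sV by (simp add: subspace_add)
    qed
    have split: "u0 = 0 \<and> u1 = 0" if "u0 \<in> V0" "u1 \<in> V1" "u0 + u1 = 0" for u0 u1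
    proof -
      have "u0 = - u1" using that(3) by (simp add: eq_neg_iff_add_eq_0)
      then have "u0 \<in> V0 \<inter> V1" using that s1 by (simp add: subspace_neg)
      then show ?thesis using V01 that(3) by auto
    qed
    \<comment> \<open>A generalized eigenvector for d splits into one in each summand; its part in
      \<open>V0\<close> is zero unless d = c, so the two recipes for \<open>y\<close> agree.\<close>
    have gen: "y v = cs (cnj d) v" if v: "v \<in> V" "(N d ^^ m) v = 0" for d m v
    proof -
      let ?u = "p v" and ?w = "v - p v"
      have u: "?u \<in> V0" "?w \<in> V1" using p(2) p(5)[OF v(1)] by auto
      have "(N d ^^ m) ?u + (N d ^^ m) ?w = 0"
        using v(2) by (simp flip: linear_add[OF linear_funpow[OF linear_N]])
      moreover have "(N d ^^ m) ?u \<in> V0" using funpow_closed[of V0 "N d" ?u, OF Nd0 u(1)] .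
      moreover have "(N d ^^ m) ?w \<in> V1" using funpow_closed[of V1 "N d" ?w, OF Nd1 u(2)] .
      ultimately have z0: "(N d ^^ m) ?u = 0" "(N d ^^ m) ?w = 0" using split[of "(N d ^^ m) ?u" "(N d ^^ m) ?w"] by auto
      have "cs (cnj c) ?u = cs (cnj d) ?u"
      proof (cases "c = d")
        case False
        moreover have "(N c ^^ n) ?u = 0" using u(1) V0 by blast
        ultimately have "?u = 0" using N_inj_on_generalized_eigenspace[of c d n ?u m] z0(1) by simp
        then show ?thesis by simp
      qed simp
      then have "y v = cs (cnj d) ?u + cs (cnj d) ?w" using z(3) u(2) z0(2) by (simp add: y_def)
      then show ?thesis by (simp flip: cs_add_right)
    qed
    let ?G = "{v \<in> V. \<exists>c n. (N c ^^ n) v = 0}"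
    have span: "V \<subseteq> span ?G"
    proof
      fix v assume v: "v \<in> V"
      have "p v \<in> ?G" using p(2)[of v] V0 by blast
      moreover have "v - p v \<in> span ?G"
        using p(5)[OF v] z(4) span_mono[of "{v \<in> V1. \<exists>d n. (N d ^^ n) v = 0}" ?G] s1 by blast
      ultimately have "p v + (v - p v) \<in> span ?G" by (intro span_add) (auto intro: span_base)
      then show "v \<in> span ?G" by simp
    qed
    have lTy: "linear (\<lambda>v. T (y v))" using linear_compose[OF ly linear_T] by (simp add: o_def)
    have "tr V (\<lambda>v. T (y v)) = tr V0 (\<lambda>v. T (y v)) + tr V1 (\<lambda>v. T (y v))"
      by (rule tr_direct_sum[OF V s0 s1 p lTy T0[OF yV0] T1[OF yV1]])
    moreover have "tr V1 (\<lambda>v. T (y v)) = tr V1 (\<lambda>v. T (z v))"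
      using y1 by (intro tr_cong f1) simp
    moreover have "tr V0 (\<lambda>v. T (y v)) = (cmod c)\<^sup>2 * dim V0"
    proof -
      \<comment> \<open>On \<open>V0\<close>, T is c plus the nilpotent \<open>N c\<close>, so T y
        is the squared modulus of c plus \<open>?M\<close>. As \<open>?M\<close> is nilpotent, the
        trace is the squared modulus times the real dimension of \<open>V0\<close>.\<close>
      let ?M = "\<lambda>v. cs (cnj c) (N c v)"
      have lM: "linear ?M" using linear_compose[OF linear_N linear_cs] by (simp add: o_def)
      have M_pow: "(?M ^^ k) v = cs (cnj c ^ k) ((N c ^^ k) v)" for k v
        by (induction k) (simp_all add: N_cs cs_mult)
      have "tr V0 (\<lambda>v. T (y v)) = tr V0 (\<lambda>v. (cmod c)\<^sup>2 *\<^sub>R v + ?M v)"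
      proof (rule tr_cong[OF f0])
        fix v assume "v \<in> V0"
        then have "T (y v) = cs (cnj c) (N c v) + cs (cnj c * c) v"
          by (simp add: y0 T_cs TN[of v] cs_add_right cs_mult)
        also have "cnj c * c = of_real ((cmod c)\<^sup>2)"
          by (simp only: complex_norm_square mult.commute)
        finally show "T (y v) = (cmod c)\<^sup>2 *\<^sub>R v + ?M v" by (simp only: cs_of_real add.commute)
      qed
      also have "\<dots> = tr V0 (\<lambda>v. (cmod c)\<^sup>2 *\<^sub>R v) + tr V0 ?M"
        using subspace_scale[OF s0(1)] cs0[OF Nd0] by (rule tr_add[OF f0])
      also have "tr V0 ?M = 0"
      proof (rule tr_nilpotent[OF f0 lM])
        show "?M v \<in> V0" if "v \<in> V0" for v using cs0[OF Nd0[OF that]] .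
        show "(?M ^^ n) v = 0" if "v \<in> V0" for v using that by (simp add: M_pow V0)
      qed
      also have "tr V0 (\<lambda>v. (cmod c)\<^sup>2 *\<^sub>R v) = (cmod c)\<^sup>2 * dim V0"
        using tr_scale[OF f0, of "\<lambda>v. v"] tr_ident[OF f0] by simp
      finally show ?thesis by simp
    qed
    ultimately have trT: "tr V (\<lambda>v. T (y v)) = (cmod c)\<^sup>2 * dim V0 + tr V1 (\<lambda>v. T (z v))" by simp
    have nonneg: "0 \<le> (cmod c)\<^sup>2 * dim V0" by simp
    \<comment> \<open>Both contributions are nonnegative, so both vanish; \<open>dim V0\<close> is
      positive, hence c = 0 and \<open>T\<close> is nilpotent on each summand.\<close>
    have nil: "\<exists>n. \<forall>v\<in>V. (T ^^ n) v = 0" if "tr V (\<lambda>v. T (y v)) = 0"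
    proof -
      have "(cmod c)\<^sup>2 * dim V0 = 0" "tr V1 (\<lambda>v. T (z v)) = 0"
        using that trT nonneg z(5) by linarith+
      then have "c = 0" using dim0 by simp
      then have t0: "(T ^^ n) v = 0" if "v \<in> V0" for v using that V0 N_0 by simp
      obtain m where m: "\<forall>v\<in>V1. (T ^^ m) v = 0" using z(6) \<open>tr V1 _ = 0\<close> by blast
      have "(T ^^ (n + m)) v = 0" if v: "v \<in> V" for v
      proof -
        have "(T ^^ (n + m)) (p v) = 0" "(T ^^ (n + m)) (v - p v) = 0"
          using funpow_zero_mono[OF linear_T t0[OF p(2)]] p(5)[OF v] m
            funpow_zero_mono[OF linear_T, of m "v - p v" "n + m"] by auto
        then show ?thesis by (simp add: linear_diff[OF linear_funpow[OF linear_T]])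
      qed
      then show ?thesis by blast
    qed
    show ?thesis
    proof (intro exI[of _ y] conjI allI ballI impI)
      show "linear y" by (rule ly)
      show "y v \<in> V" if "v \<in> V" for v using that by (rule yV)
      show "y v = cs (cnj d) v" if "v \<in> V" "(N d ^^ m) v = 0" for d m v using that by (rule gen)
      show "V \<subseteq> span ?G" by (rule span)
      show "0 \<le> tr V (\<lambda>v. T (y v))" using trT nonneg z(5) by simp
    qed (rule nil)
  qed
qed

end

section \<open>Lie modules and Engel's theorem\<close>

lemmas bilinear_simps = bilinear_ladd bilinear_radd bilinear_lmul bilinear_rmul bilinear_lneg
  bilinear_rneg bilinear_lzero bilinear_rzero bilinear_lsub bilinear_rsub

lemma bilinear_linear_right: "bilinear f \<Longrightarrow> linear (f x)"
  by (simp add: bilinear_def)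

lemma bilinear_linear_left: "bilinear f \<Longrightarrow> linear (\<lambda>x. f x y)"
  by (simp add: bilinear_def)

lemma bilinearI:
  assumes "\<And>x y z. f (x + y) z = f x z + f y z" "\<And>x y z. f x (y + z) = f x y + f x z"
    "\<And>c x y. f (c *\<^sub>R x) y = c *\<^sub>R f x y" "\<And>c x y. f x (c *\<^sub>R y) = c *\<^sub>R f x y"
  shows "bilinear f"
  using assms by (auto simp: bilinear_def intro!: linearI)

text \<open>\<open>br\<close> and \<open>act\<close> are bilinear on the whole type, which frees
  linear algebra from carrier conditions; the remaining laws are asked only on the carriers. The
  Jacobi identity has the shape of \<open>act_br\<close>, so the adjoint module is an
  instance.\<close>

locale lie_module =
  fixes L :: "'a::real_vector set"
    and br :: "'a \<Rightarrow> 'a \<Rightarrow> 'a"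
    and V :: "'b::real_vector set"
    and act :: "'a \<Rightarrow> 'b \<Rightarrow> 'b"
  assumes findim_L: "findim L"
    and findim_V: "findim V"
    and bil_br: "bilinear br"
    and bil_act: "bilinear act"
    and br_closed: "\<And>x y. x \<in> L \<Longrightarrow> y \<in> L \<Longrightarrow> br x y \<in> L"
    and act_closed: "\<And>x v. x \<in> L \<Longrightarrow> v \<in> V \<Longrightarrow> act x v \<in> V"
    and br_alt: "\<And>x. x \<in> L \<Longrightarrow> br x x = 0"
    and br_jacobi: "\<And>x y z. x \<in> L \<Longrightarrow> y \<in> L \<Longrightarrow> z \<in> L \<Longrightarrow>
      br (br x y) z = br x (br y z) - br y (br x z)"
    and act_br: "\<And>x y v. x \<in> L \<Longrightarrow> y \<in> L \<Longrightarrow> v \<in> V \<Longrightarrow>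
      act (br x y) v = act x (act y v) - act y (act x v)"
begin

lemma subspace_L: "subspace L" and subspace_V: "subspace V"
  using findim_L findim_V findim_subspace by blast+

lemmas br_simps = bilinear_simps[OF bil_br] and act_simps = bilinear_simps[OF bil_act]

lemma linear_br: "linear (br x)" and linear_act: "linear (act x)"
  using bil_br bil_act by (simp_all add: bilinear_linear_right)

lemma br_skew:
  assumes "x \<in> L" "y \<in> L"
  shows "br y x = - br x y"
proof -
  have "br (x + y) (x + y) = 0" using assms subspace_L by (simp add: br_alt subspace_add)
  then have "br y x + br x y = 0" using assms by (simp add: br_simps br_alt algebra_simps)
  then show ?thesis by (simp add: eq_neg_iff_add_eq_0)
qed

lemma adjoint: "lie_module L br L br"
  by unfold_locales (auto simp: findim_L bil_br br_closed br_alt br_jacobi)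

lemma restrict_algebra:
  assumes "subspace K" "K \<subseteq> L" "\<And>x y. x \<in> K \<Longrightarrow> y \<in> K \<Longrightarrow> br x y \<in> K"
  shows "lie_module K br V act"
proof unfold_locales
  show "findim K" using findim_sub[OF findim_L assms(1,2)] .
qed (use assms in \<open>auto simp: findim_V bil_br bil_act br_alt br_jacobi act_br subset_iff intro!: act_closed\<close>)

lemma restrict_module:
  assumes "subspace W" "W \<subseteq> V" "\<And>x w. x \<in> L \<Longrightarrow> w \<in> W \<Longrightarrow> act x w \<in> W"
  shows "lie_module L br W act"
proof unfold_locales
  show "findim W" using findim_sub[OF findim_V assms(1,2)] .
qed (use assms in \<open>auto simp: findim_L bil_br bil_act br_alt br_jacobi act_br br_closed subset_iff\<close>)

lemma derived_subset: "derived_series br L n \<subseteq> L"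
proof (induction n)
  case (Suc n)
  then have "{br x y | x y. x \<in> derived_series br L n \<and> y \<in> derived_series br L n} \<subseteq> L"
    using br_closed by (auto simp: subset_iff)
  then show ?case using subspace_L by (simp add: span_minimal)
qed simp

lemma derived_closed:
  assumes "x \<in> derived_series br L n" "y \<in> derived_series br L n"
  shows "br x y \<in> derived_series br L n"
proof (cases n)
  case 0
  then show ?thesis using assms br_closed by simp
next
  case (Suc m)
  have "derived_series br L (Suc m) \<subseteq> derived_series br L m" for m
  proof (induction m)
    case 0
    show ?case using derived_subset[of 1] by simp
  next
    case (Suc m)
    then show ?case by (simp only: derived_series.simps) (intro span_mono, blast)
  qed
  then have "x \<in> derived_series br L m" "y \<in> derived_series br L m" using assms Suc by blast+
  then show ?thesis unfolding Suc derived_series.simps by (intro span_base) blast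
qed

end

text \<open>Take an invariant \<open>U\<close> strictly above \<open>W\<close> of least dimension.
  By \<open>step\<close>, \<open>W\<close> together with K U spans a proper invariant subspace of
  \<open>U\<close>, which by minimality is \<open>W\<close>; any z in \<open>U\<close> outside
  \<open>W\<close> then works. This turns the spanning form of Engel's theorem into a common null
  vector modulo \<open>W\<close>.\<close>

lemma engel_vector:
  assumes "lie_module K br V act"
    and W: "subspace W" "W \<subseteq> V" "W \<noteq> V" "\<And>x w. x \<in> K \<Longrightarrow> w \<in> W \<Longrightarrow> act x w \<in> W"
    and step: "\<And>U. lie_module K br U act \<Longrightarrow> W \<subseteq> U \<Longrightarrow> U \<subseteq> V \<Longrightarrow> W \<noteq> U \<Longrightarrow>
      span (W \<union> {act x v | x v. x \<in> K \<and> v \<in> U}) \<noteq> U"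
  obtains z where "z \<in> V" "z \<notin> W" "\<And>x. x \<in> K \<Longrightarrow> act x z \<in> W"
proof -
  interpret lie_module K br V act by fact
  define P where "P U \<longleftrightarrow> subspace U \<and> W \<subseteq> U \<and> U \<subseteq> V \<and> W \<noteq> U \<and> (\<forall>x\<in>K. \<forall>u\<in>U. act x u \<in> U)" for U
  have "P V" unfolding P_def using W subspace_V act_closed by simp
  then obtain U where U: "P U" and min: "\<And>U'. P U' \<Longrightarrow> dim U \<le> dim U'"
    using ex_has_least_nat[of P V dim] by blast
  have sU: "subspace U" "W \<subseteq> U" "U \<subseteq> V" "W \<noteq> U" and inv: "\<And>x u. x \<in> K \<Longrightarrow> u \<in> U \<Longrightarrow> act x u \<in> U"
    using U by (auto simp: P_def)
  let ?G = "W \<union> {act x v | x v. x \<in> K \<and> v \<in> U}"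
  have mU: "lie_module K br U act" using sU(1,3) inv by (rule restrict_module)
  have ne: "span ?G \<noteq> U" using step[OF mU sU(2,3,4)] .
  have sub: "span ?G \<subseteq> U" using sU(1,2) inv by (intro span_minimal) auto
  have "dim (span ?G) < dim U"
    by (rule findim_dim_less[OF findim_sub[OF findim_V sU(1,3)] _ sub ne]) simp
  then have "\<not> P (span ?G)" using min[of "span ?G"] by linarith
  moreover have "act x u \<in> span ?G" if "x \<in> K" "u \<in> span ?G" for x u
    using that sub by (intro span_base) blast
  moreover have "W \<subseteq> span ?G" using span_superset[of ?G] by blast
  ultimately have "span ?G = W" using sub sU(3) unfolding P_def by auto
  then have KU: "act x u \<in> W" if "x \<in> K" "u \<in> U" for x u
    using that span_superset[of ?G] by blast
  obtain z where "z \<in> U" "z \<notin> W" using sU(2,4) by blast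
  then show ?thesis using that[of z] KU sU(3) by blast
qed

text \<open>Stated relative to a submodule, so that the induction needs no quotient spaces.\<close>

lemma engel:
  fixes L V W :: "'a::real_vector set"
  assumes "lie_module L br V act"
    and "subspace W" "W \<subseteq> V" "W \<noteq> V" "\<And>x w. x \<in> L \<Longrightarrow> w \<in> W \<Longrightarrow> act x w \<in> W"
    and "\<And>x. x \<in> L \<Longrightarrow> \<exists>n. \<forall>v\<in>V. (act x ^^ n) v \<in> W"
  shows "span (W \<union> {act x v | x v. x \<in> L \<and> v \<in> V}) \<noteq> V"
  using assms
proof (induction "dim L" arbitrary: L br V act W rule: less_induct)
  case less
  interpret lie_module L br V act by fact
  note W = less.prems(2-4) and W_inv = less.prems(5) and nil = less.prems(6)
  let ?Q = "span (W \<union> {act x v | x v. x \<in> L \<and> v \<in> V})"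
  \<comment> \<open>The kernel of the representation on V/W.\<close>
  define ker where "ker = {x \<in> L. \<forall>v\<in>V. act x v \<in> W}"
  have ker: "subspace ker" "ker \<subseteq> L"
    unfolding ker_def using subspace_L W(1)
    by (auto intro!: subspaceI simp: act_simps subspace_0 subspace_add subspace_scale)
  have ker_ideal: "br x y \<in> ker" if "x \<in> L" "y \<in> ker" for x y
  proof -
    have "y \<in> L" "\<And>v. v \<in> V \<Longrightarrow> act y v \<in> W" using that(2) by (auto simp: ker_def)
    then have "act (br x y) v \<in> W" if "v \<in> V" for v
      using \<open>x \<in> L\<close> that W_inv act_closed W(1) by (simp add: act_br subspace_diff)
    then show ?thesis using br_closed \<open>x \<in> L\<close> \<open>y \<in> L\<close> by (simp add: ker_def)
  qed
  show ?case
  proof (cases "ker = L")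
    case True
    have "act x v \<in> W" if "x \<in> L" "v \<in> V" for x v
      using that by (simp add: True[symmetric]) (simp add: ker_def)
    then have "?Q \<subseteq> W" using W(1) by (intro span_minimal) auto
    then show ?thesis using W by blast
  next
    case False
    \<comment> \<open>A maximal proper subalgebra is sought among those containing
      \<open>ker\<close>, because ad x will be shown nilpotent only modulo
      \<open>ker\<close>.\<close>
    define P where "P K \<longleftrightarrow> subspace K \<and> ker \<subseteq> K \<and> K \<subseteq> L \<and> K \<noteq> L \<and> (\<forall>x\<in>K. \<forall>y\<in>K. br x y \<in> K)" for K
    have "P ker" unfolding P_def using ker False ker_ideal by auto
    moreover have "\<forall>K. P K \<longrightarrow> dim K < Suc (dim L)"
      using findim_dim_mono[OF findim_L] by (auto simp: P_def less_Suc_eq_le)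
    ultimately obtain K where K: "P K" and max: "\<And>K'. P K' \<Longrightarrow> dim K' \<le> dim K"
      using ex_has_greatest_nat[of P ker dim "Suc (dim L)"] by blast
    have sK: "subspace K" "ker \<subseteq> K" "K \<subseteq> L" "K \<noteq> L" and Kc: "\<And>x y. x \<in> K \<Longrightarrow> y \<in> K \<Longrightarrow> br x y \<in> K"
      using K by (auto simp: P_def)
    have dimK: "dim K < dim L" using findim_dim_less[OF findim_L sK(1,3,4)] .
    interpret KL: lie_module K br L br
      by (rule lie_module.restrict_algebra[OF adjoint sK(1,3) Kc])
    interpret KV: lie_module K br V act
      by (rule restrict_algebra[OF sK(1,3) Kc])
    have ad_nil: "\<exists>m. \<forall>y\<in>L. (br x ^^ m) y \<in> K" if x: "x \<in> K" for x
    proof -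
      have xL: "x \<in> L" using x sK(3) by blast
      obtain n where n: "\<forall>v\<in>V. (act x ^^ n) v \<in> W" using nil[OF xL] by blast
      have XV: "(act x ^^ i) v \<in> V" if "v \<in> V" for i v
        by (rule funpow_closed[OF act_closed[OF xL] that])
      have XW: "(act x ^^ i) v \<in> W" if "v \<in> W" for i v
        by (rule funpow_closed[OF W_inv[OF xL] that])
      have Xn: "(act x ^^ i) v \<in> W" if "v \<in> V" "n \<le> i" for i v
      proof -
        have "(act x ^^ i) v = (act x ^^ (i - n)) ((act x ^^ n) v)"
          using that(2) by (metis comp_apply funpow_add le_add_diff_inverse2)
        then show ?thesis using n that(1) XW by simp
      qed
      have DL: "(br x ^^ k) y \<in> L" if "y \<in> L" for k y
        by (rule funpow_closed[OF br_closed[OF xL] that])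
      \<comment> \<open>Write X for the action of x. A power of ad x applied to y acts as a
        combination of products X^a y X^b; with total exponent at least 2n one of a, b is at least
        n, which sends the product into \<open>W\<close>. The induction moves one factor X at a
        time.\<close>
      have main: "(act x ^^ i) (act ((br x ^^ k) y) ((act x ^^ j) v)) \<in> W"
        if "y \<in> L" "v \<in> V" "n + n \<le> i + j + k" for i j k y v
        using that(3)
      proof (induction k arbitrary: i j)
        case 0
        then consider "n \<le> i" | "n \<le> j" by linarith
        then show ?case
        proof cases
          case 1
          then show ?thesis using Xn act_closed XV that(1,2) by simp
        next
          case 2
          then show ?thesis using Xn[OF that(2)] W_inv[OF that(1)] XW by simp
        qed
      next
        case (Suc k)
        let ?d = "(br x ^^ k) y"
        have "act (br x ?d) ((act x ^^ j) v)
            = act x (act ?d ((act x ^^ j) v)) - act ?d (act x ((act x ^^ j) v))"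
          using act_br xL DL[OF that(1)] XV[OF that(2)] by blast
        then have "(act x ^^ i) (act ((br x ^^ Suc k) y) ((act x ^^ j) v))
            = (act x ^^ Suc i) (act ?d ((act x ^^ j) v)) - (act x ^^ i) (act ?d ((act x ^^ Suc j) v))"
          by (simp add: linear_diff[OF linear_funpow[OF linear_act]] funpow_swap1)
        then show ?case
          using Suc.IH[of "Suc i" j] Suc.IH[of i "Suc j"] Suc.prems W(1) by (simp add: subspace_diff)
      qed
      have "(br x ^^ (n + n)) y \<in> ker" if "y \<in> L" for y
        using main[OF that, of _ 0 0 "n + n"] DL[OF that, of "n + n"] by (simp add: ker_def)
      then show ?thesis using sK(2) by blast
    qed
    \<comment> \<open>The induction hypothesis is applied to \<open>K\<close> acting on
      \<open>L\<close> relative to \<open>K\<close> itself; the resulting z normalizes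
      \<open>K\<close>, and maximality then forces L = K + R z.\<close>
    obtain z where z: "z \<in> L" "z \<notin> K" "\<And>x. x \<in> K \<Longrightarrow> br x z \<in> K"
    proof (rule engel_vector[OF KL.lie_module_axioms sK(1,3,4) Kc])
      fix U assume U: "lie_module K br U br" "K \<subseteq> U" "U \<subseteq> L" "K \<noteq> U"
      show "span (K \<union> {br x v | x v. x \<in> K \<and> v \<in> U}) \<noteq> U"
      proof (rule less.hyps[OF dimK U(1) sK(1) U(2,4) Kc])
        fix x assume "x \<in> K"
        then show "\<exists>n. \<forall>v\<in>U. (br x ^^ n) v \<in> K" using ad_nil U(3) by blast
      qed
    qed (assumption | rule that; assumption)+
    define K' where "K' = {k + r *\<^sub>R z | k r. k \<in> K}"
    have sK': "subspace K'"
    proof (rule subspaceI)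
      show "0 \<in> K'" unfolding K'_def using sK(1) subspace_0 by (intro CollectI exI[of _ 0]) simp
      fix a assume "a \<in> K'"
      then obtain k r where a: "a = k + r *\<^sub>R z" "k \<in> K" by (auto simp: K'_def)
      { fix b assume "b \<in> K'"
        then obtain k' r' where b: "b = k' + r' *\<^sub>R z" "k' \<in> K" by (auto simp: K'_def)
        have "a + b = (k + k') + (r + r') *\<^sub>R z" using a b by (simp add: algebra_simps)
        then show "a + b \<in> K'" unfolding K'_def using a b sK(1) subspace_add by blast }
      { fix c
        have "c *\<^sub>R a = c *\<^sub>R k + (c * r) *\<^sub>R z" using a by (simp add: algebra_simps)
        then show "c *\<^sub>R a \<in> K'" unfolding K'_def using a sK(1) subspace_scale by blast }
    qed
    have KK': "K \<subseteq> K'"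
    proof
      fix k assume "k \<in> K"
      then show "k \<in> K'" unfolding K'_def by (intro CollectI exI[of _ k] exI[of _ 0]) simp
    qed
    have zK': "z \<in> K'"
      unfolding K'_def using subspace_0[OF sK(1)] by (intro CollectI exI[of _ 0] exI[of _ 1]) simp
    have K'L: "K' \<subseteq> L"
      unfolding K'_def using sK(3) z(1) subspace_L by (auto intro!: subspace_add subspace_scale)
    have zk: "br z x \<in> K" if "x \<in> K" for x
      using br_skew[of x z] that z sK(1,3) by (simp add: subspace_neg subset_iff)
    have K'c: "br a b \<in> K'" if ab: "a \<in> K'" "b \<in> K'" for a b
    proof -
      obtain k r k' r' where "a = k + r *\<^sub>R z" "k \<in> K" "b = k' + r' *\<^sub>R z" "k' \<in> K"
        using ab by (auto simp: K'_def)
      then have "br a b = br k k' + r' *\<^sub>R br k z + r *\<^sub>R br z k'" "k \<in> K" "k' \<in> K"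
        using br_alt[OF z(1)] by (simp_all add: br_simps)
      then have "br a b \<in> K" using Kc z(3) zk sK(1) by (simp add: subspace_add subspace_scale)
      then show ?thesis using KK' by blast
    qed
    have "K' = L"
    proof (rule ccontr)
      assume "K' \<noteq> L"
      then have "P K'" unfolding P_def using sK' KK' K'L K'c sK(2) by auto
      then have "dim K' \<le> dim K" by (rule max)
      then have "K = K'"
        using findim_dim_eq[OF findim_sub[OF findim_L sK' K'L] sK(1) KK'] by blast
      then show False using zK' z(2) by simp
    qed
    let ?G = "W \<union> {act x v | x v. x \<in> K \<and> v \<in> V}"
    \<comment> \<open>The hypothesis for \<open>K\<close> on \<open>V\<close> makes \<open>U\<close>
      proper. It is stable under z, because z x v = [z,x] v + x z v and [z,x] lies in
      \<open>K\<close>.\<close>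
    define U where "U = span ?G"
    have UV: "U \<noteq> V" unfolding U_def
    proof (rule less.hyps[OF dimK KV.lie_module_axioms W])
      show "act x w \<in> W" if "x \<in> K" "w \<in> W" for x w using W_inv that sK(3) by blast
      show "\<exists>n. \<forall>v\<in>V. (act x ^^ n) v \<in> W" if "x \<in> K" for x using nil that sK(3) by blast
    qed
    have sU: "subspace U" by (simp add: U_def)
    have WU: "W \<subseteq> U" and KVU: "\<And>x v. x \<in> K \<Longrightarrow> v \<in> V \<Longrightarrow> act x v \<in> U"
      unfolding U_def using span_superset[of ?G] by blast+
    have subUV: "U \<subseteq> V"
      unfolding U_def using W(2) subspace_V KV.act_closed by (intro span_minimal) auto
    have zU: "act z u \<in> U" if "u \<in> U" for u
    proof -
      have "U \<subseteq> {u. act z u \<in> U}"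
        unfolding U_def
      proof (rule span_minimal)
        show "subspace {u. act z u \<in> span ?G}" 
          by (rule linear_subspace_linear_preimage[OF linear_act]) simp
        have "act z (act x v) \<in> U" if "x \<in> K" "v \<in> V" for x v
        proof -
          have "act z (act x v) = act (br z x) v + act x (act z v)"
            using act_br[of z x v] z(1) that sK(3) by auto
          then show ?thesis using KVU zk that z(1) act_closed sU by (simp add: subspace_add)
        qed
        moreover have "act z w \<in> U" if "w \<in> W" for w using W_inv[OF z(1) that] WU by blast
        ultimately show "?G \<subseteq> {u. act z u \<in> span ?G}" unfolding U_def by blast
      qed
      then show ?thesis using that by blast
    qed
    obtain n where n: "\<forall>v\<in>V. (act z ^^ n) v \<in> W" using nil[OF z(1)] by blast
    show ?thesis
    proof
      assume QV: "?Q = V"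
      let ?R = "{u + v | u v. u \<in> U \<and> v \<in> act z ` V}"
      have sR: "subspace ?R"
        using subspace_sums[OF sU linear_subspace_image[OF linear_act subspace_V]] .
      have UR: "u \<in> ?R" if "u \<in> U" for u
      proof -
        have "0 \<in> act z ` V" using subspace_0[OF linear_subspace_image[OF linear_act subspace_V]] .
        then show ?thesis using that by force
      qed
      have "act x v \<in> ?R" if xv: "x \<in> L" "v \<in> V" for x v
      proof -
        obtain k r where kr: "x = k + r *\<^sub>R z" "k \<in> K" using xv(1) \<open>K' = L\<close> by (auto simp: K'_def)
        then have "act x v = act k v + act z (r *\<^sub>R v)" by (simp add: act_simps)
        moreover have "act k v \<in> U" using KVU kr(2) xv(2) by blast
        moreover have "r *\<^sub>R v \<in> V" using xv(2) subspace_V by (simp add: subspace_scale)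
        ultimately show ?thesis by blast
      qed
      then have "?Q \<subseteq> ?R" using WU UR by (intro span_minimal[OF _ sR]) blast
      then have VR: "\<exists>u\<in>U. \<exists>v'\<in>V. v = u + act z v'" if "v \<in> V" for v
        using that QV by blast
      \<comment> \<open>If L V and \<open>W\<close> spanned \<open>V\<close>, then V = U + z V.
        Iterating gives V = U + z^i V, and a power of z sends \<open>V\<close> into
        \<open>W\<close>, hence into \<open>U\<close>, a contradiction.\<close>
      have "\<exists>u\<in>U. \<exists>v'\<in>V. v = u + (act z ^^ i) v'" if "v \<in> V" for v i
      proof (induction i)
        case 0
        show ?case using that subspace_0[OF sU] by (intro bexI[of _ 0] bexI[of _ v]) auto
      next
        case (Suc i)
        then obtain u v' where u: "u \<in> U" "v' \<in> V" "v = u + (act z ^^ i) v'" by blast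
        obtain u' v'' where u': "u' \<in> U" "v'' \<in> V" "v' = u' + act z v''" using VR[OF u(2)] by blast
        have "v = (u + (act z ^^ i) u') + (act z ^^ Suc i) v''"
          using u(3) u'(3) by (simp add: linear_add[OF linear_funpow[OF linear_act]] funpow_swap1)
        moreover have "u + (act z ^^ i) u' \<in> U"
          using subspace_add[OF sU u(1) funpow_closed[OF zU u'(1)]] .
        ultimately show ?case using u'(2) by blast
      qed
      then have "V \<subseteq> U" using n WU sU subspace_add by (metis subsetD subsetI)
      then show False using subUV UV by blast
    qed
  qed
qed

section \<open>Cartan's criterion\<close>

text \<open>Engel's theorem makes the series V, K V, K K V, ... drop strictly until it is zero, so
  it ends within dim V steps. Elements deep in the derived series move far along this
  series.\<close>

lemma nilpotent_module:
  fixes K V :: "'a::real_vector set"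
  assumes "lie_module K br V act"
    and nil: "\<And>x. x \<in> K \<Longrightarrow> \<exists>n. \<forall>v\<in>V. (act x ^^ n) v = 0"
  obtains n where "\<And>x v. x \<in> derived_series br K n \<Longrightarrow> v \<in> V \<Longrightarrow> act x v = 0"
proof -
  interpret lie_module K br V act by fact
  define C where "C = rec_nat V (\<lambda>_ W. span {act x v | x v. x \<in> K \<and> v \<in> W})"
  have C0: "C 0 = V" and CS: "C (Suc k) = span {act x v | x v. x \<in> K \<and> v \<in> C k}" for k
    by (simp_all add: C_def)
  have sC: "subspace (C k)" for k by (cases k) (simp_all add: C0 CS subspace_V)
  have act_C: "act x v \<in> C (Suc k)" if "x \<in> K" "v \<in> C k" for x v k
    unfolding CS using that by (intro span_base) blast
  have CS_sub: "C (Suc k) \<subseteq> C k" for k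
  proof (induction k)
    case 0
    show ?case unfolding CS C0 using subspace_V act_closed by (intro span_minimal) auto
  next
    case (Suc k)
    then show ?case unfolding CS[of "Suc k"] unfolding CS[of k] by (intro span_mono) (use CS in blast)
  qed
  have anti: "C (k + j) \<subseteq> C k" for k j
    by (induction j) (use CS_sub in auto)
  have CV: "C k \<subseteq> V" for k using anti[of 0 k] C0 by simp
  have mod: "lie_module K br (C k) act" for k
    using sC CV act_C CS_sub by (intro restrict_module) (auto simp: subset_iff)
  have dims: "C k = {0} \<or> dim (C k) + k \<le> dim V" for k
  proof (induction k)
    case 0
    show ?case by (simp add: C0)
  next
    case (Suc k)
    show ?case
    proof (cases "C k = {0}")
      case True
      then have "C (Suc k) = {0}" using CS_sub[of k] subspace_0[OF sC] by blast
      then show ?thesis by simp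
    next
      case False
      have "span ({0} \<union> {act x v | x v. x \<in> K \<and> v \<in> C k}) \<noteq> C k"
      proof (rule engel[OF mod])
        show "{0} \<subseteq> C k" "{0} \<noteq> C k" using subspace_0[OF sC] False by auto
        show "\<exists>n. \<forall>v\<in>C k. (act x ^^ n) v \<in> {0}" if "x \<in> K" for x
          using nil[OF that] CV by blast
      qed (auto simp: act_simps)
      then have "C (Suc k) \<noteq> C k" by (simp add: CS)
      then have "dim (C (Suc k)) < dim (C k)"
        using findim_dim_less[OF findim_sub[OF findim_V sC CV] sC CS_sub] by blast
      then show ?thesis using Suc False by auto
    qed
  qed
  have "C (Suc (dim V)) = {0}" using dims[of "Suc (dim V)"] by auto
  \<comment> \<open>Two elements of level k together advance by 2k + 2, which is at least the k + 2
    required of their bracket. At level dim V, starting from \<open>C 0\<close>, the target is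
    \<open>C (Suc (dim V))\<close>, which is zero.\<close>
  have "act x v \<in> C (i + k + 1)"
    if "x \<in> derived_series br K k" "v \<in> C i" for x v i k
    using that
  proof (induction k arbitrary: x v i)
    case 0
    then show ?case using act_C by simp
  next
    case (Suc k)
    let ?D = "derived_series br K k" and ?W = "C (i + Suc k + 1)"
    have "{br a b | a b. a \<in> ?D \<and> b \<in> ?D} \<subseteq> {x. act x v \<in> ?W}"
    proof clarify
      fix a b assume ab: "a \<in> ?D" "b \<in> ?D"
      have "act a (act b v) \<in> C ((i + k + 1) + k + 1)" "act b (act a v) \<in> C ((i + k + 1) + k + 1)"
        using Suc.IH ab Suc.prems(2) by blast+
      moreover have "C ((i + k + 1) + k + 1) \<subseteq> ?W" using anti[of "i + Suc k + 1" k] by (simp add: ac_simps)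
      ultimately have "act a (act b v) - act b (act a v) \<in> ?W" using sC by (blast intro: subspace_diff)
      moreover have "a \<in> K" "b \<in> K" "v \<in> V" using ab derived_subset Suc.prems(2) CV by blast+
      ultimately show "act (br a b) v \<in> ?W" by (simp add: act_br)
    qed
    moreover have "subspace {x. act x v \<in> ?W}"
      by (rule linear_subspace_linear_preimage[OF bilinear_linear_left[OF bil_act] sC])
    ultimately have "derived_series br K (Suc k) \<subseteq> {x. act x v \<in> ?W}"
      unfolding derived_series.simps by (rule span_minimal)
    then show ?case using Suc.prems(1) by blast
  qed
  from this[of _ "dim V" _ 0] have "act x v = 0" if "x \<in> derived_series br K (dim V)" "v \<in> V" for x v
    using that C0 \<open>C (Suc (dim V)) = {0}\<close> by simp
  then show ?thesis using that by blast
qed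

lemma subspace_linear_eq: "linear f \<Longrightarrow> linear g \<Longrightarrow> subspace {v. f v = g v}"
  by (auto intro!: subspaceI simp: linear_0 linear_add linear_scale)

text \<open>Multiplication by the imaginary unit when (v, w) is read as v + i w: the product of
  \<open>V\<close> with itself is its complexification.\<close>

definition pair_J :: "'a::real_vector \<times> 'a \<Rightarrow> 'a \<times> 'a" where
  "pair_J w = (- snd w, fst w)"

interpretation pair: complex_structure pair_J
  by unfold_locales (auto intro!: linearI simp: pair_J_def)

lemma pair_cs: "pair.cs c w = (Re c *\<^sub>R fst w - Im c *\<^sub>R snd w, Re c *\<^sub>R snd w + Im c *\<^sub>R fst w)"
  by (simp add: pair.cs_def pair_J_def prod_eq_iff)

text \<open>\<open>R\<close> is the complexified action.  The commutator of the operator \<open>y\<close> of \<open>conjugate_operator\<close> with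
  \<open>R a\<close> acts as an element of the complexified derived algebra, by comparing weights, and this makes
  the trace of \<open>T \<circ> y\<close> vanish.\<close>

lemma (in lie_module) derived_nilpotent_of_trace_zero:
  assumes tr0: "\<And>x y. x \<in> L \<Longrightarrow> y \<in> L \<Longrightarrow> tr V (\<lambda>v. act x (act y v)) = 0"
    and x: "x \<in> derived_series br L 1"
  shows "\<exists>n. \<forall>v\<in>V. (act x ^^ n) v = 0"
proof -
  define K where "K = derived_series br L 1"
  have K: "K = span {br a b | a b. a \<in> L \<and> b \<in> L}" by (simp add: K_def)
  have KL: "K \<subseteq> L" and sK: "subspace K" unfolding K_def using derived_subset subspace_derived_series[OF subspace_L] by blast+
  have xL: "x \<in> L" and xK: "x \<in> K" using x KL by (auto simp: K_def)
  have brK: "br a b \<in> K" if "a \<in> L" "b \<in> L" for a b unfolding K using that by (intro span_base) blast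
  let ?LL = "L \<times> L" and ?KK = "K \<times> K" and ?VV = "V \<times> V"
  have fLL: "findim ?LL" and fVV: "findim ?VV" using findim_Times findim_L findim_V by blast+
  have sLL: "subspace ?LL" and sVV: "subspace ?VV" and sKK: "subspace ?KK"
    using fLL fVV findim_subspace subspace_Times[OF sK sK] by blast+
  \<comment> \<open>Complex multiplication rule: a1 + i a2 acts on w1 + i w2.\<close>
  define R where "R a w = (act (fst a) (fst w) - act (snd a) (snd w), act (fst a) (snd w) + act (snd a) (fst w))" for a w
  define T where "T w = (act x (fst w), act x (snd w))" for w
  define A where "A a = (br x (fst a), br x (snd a))" for a
  have bil_R: "bilinear R"
    by (rule bilinearI) (simp_all add: R_def act_simps algebra_simps)
  note R_simps = bilinear_simps[OF bil_R]
  have R_cs: "R (pair.cs c a) w = pair.cs c (R a w)" "R a (pair.cs c w) = pair.cs c (R a w)" for a c w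
    by (simp_all add: R_def pair_cs act_simps algebra_simps)
  interpret T: complex_linear_operator pair_J T
    by unfold_locales (auto intro!: linearI simp: T_def pair_J_def act_simps)
  interpret A: complex_linear_operator pair_J A
    by unfold_locales (auto intro!: linearI simp: A_def pair_J_def br_simps)
  have R_closed: "R a w \<in> ?VV" if "a \<in> ?LL" "w \<in> ?VV" for a w
    using that act_closed subspace_V by (auto simp: R_def intro!: subspace_add subspace_diff)
  have T_closed: "T w \<in> ?VV" if "w \<in> ?VV" for w using that act_closed xL by (auto simp: T_def)
  have A_closed: "A a \<in> ?KK" if "a \<in> ?LL" for a using that brK xL by (auto simp: A_def)
  have JV: "pair_J w \<in> ?VV" if "w \<in> ?VV" for w using that subspace_V by (auto simp: pair_J_def subspace_neg)
  have JL: "pair_J a \<in> ?LL" if "a \<in> ?LL" for a using that subspace_L by (auto simp: pair_J_def subspace_neg)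
  have JK: "pair_J a \<in> ?KK" if "a \<in> ?KK" for a using that sK by (auto simp: pair_J_def subspace_neg)
  have KKLL: "?KK \<subseteq> ?LL" using KL by blast
  have csK: "pair.cs c a \<in> ?KK" if "a \<in> ?KK" for c a using pair.cs_closed[OF sKK JK[OF that] that] .
  have csL: "pair.cs c a \<in> ?LL" if "a \<in> ?LL" for c a using pair.cs_closed[OF sLL JL[OF that] that] .
  have csV: "pair.cs c a \<in> ?VV" if "a \<in> ?VV" for c a using pair.cs_closed[OF sVV JV[OF that] that] .
  have A_closed': "A a \<in> ?LL" if "a \<in> ?LL" for a by (rule subsetD[OF KKLL A_closed[OF that]])
  have NA_closed: "A.N c a \<in> ?LL" if "a \<in> ?LL" for c a
    unfolding A.N_def by (rule subspace_diff[OF sLL A_closed'[OF that] csL[OF that]])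
  have NT_closed: "T.N c w \<in> ?VV" if "w \<in> ?VV" for c w
    unfolding T.N_def by (rule subspace_diff[OF sVV T_closed[OF that] csV[OF that]])
  obtain y where ly: "linear y" and y_closed: "\<forall>w\<in>?VV. y w \<in> ?VV"
    and y_eig: "\<forall>c n. \<forall>w\<in>?VV. (T.N c ^^ n) w = 0 \<longrightarrow> y w = pair.cs (cnj c) w"
    and spanV: "?VV \<subseteq> span {w \<in> ?VV. \<exists>c n. (T.N c ^^ n) w = 0}"
    and nilT: "tr ?VV (\<lambda>w. T (y w)) = 0 \<longrightarrow> (\<exists>n. \<forall>w\<in>?VV. (T ^^ n) w = 0)"
    by (rule exE[OF T.conjugate_operator[OF fVV JV T_closed]], assumption, assumption, elim conjE, rule that)
  have spanL: "?LL \<subseteq> span {a \<in> ?LL. \<exists>c n. (A.N c ^^ n) a = 0}"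
    by (rule exE[OF A.conjugate_operator[OF fLL JL A_closed']], assumption, assumption, elim conjE)
  \<comment> \<open>\<open>T\<close> and \<open>A\<close> are the actions of x on the complexified
    module and algebra. The action map intertwines them by Leibniz, so weights add.\<close>
  have leib: "T.N (c + d) (R a w) = R (A.N c a) w + R a (T.N d w)" if "a \<in> ?LL" "w \<in> ?VV" for a w c d
  proof -
    have "T (R a w) = R (A a) w + R a (T w)"
      using that xL by (auto simp: T_def R_def A_def act_br act_simps)
    then show ?thesis
      by (simp add: T.N_def A.N_def R_simps R_cs pair.cs_add_left)
  qed
  have leib_pow: "(T.N (c + d) ^^ n) (R a w) = 0"
    if "a \<in> ?LL" "w \<in> ?VV" "(A.N c ^^ p) a = 0" "(T.N d ^^ q) w = 0" "n = p + q" for a w c d p q n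
    using that
  proof (induction n arbitrary: p q a w)
    case 0
    then show ?case by (simp add: R_simps)
  next
    case (Suc n)
    have z: "(T.N (c + d) ^^ Suc n) 0 = 0" by (rule linear_0[OF linear_funpow[OF T.linear_N]])
    show ?case
    proof (cases "p = 0 \<or> q = 0")
      case True
      then have "R a w = 0" using Suc.prems by (auto simp: R_simps)
      then show ?thesis using z by simp
    next
      case False
      then obtain p' q' where pq: "p = Suc p'" "q = Suc q'" by (metis not0_implies_Suc)
      have 1: "(T.N (c + d) ^^ n) (R (A.N c a) w) = 0"
        by (rule Suc.IH[of _ _ p' q])
          (use Suc.prems pq NA_closed[OF Suc.prems(1)] in \<open>simp_all add: funpow_swap1\<close>)
      have 2: "(T.N (c + d) ^^ n) (R a (T.N d w)) = 0"
        by (rule Suc.IH[of _ _ p q'])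
          (use Suc.prems pq NT_closed[OF Suc.prems(2)] in \<open>simp_all add: funpow_swap1\<close>)
      have "(T.N (c + d) ^^ Suc n) (R a w) = (T.N (c + d) ^^ n) (T.N (c + d) (R a w))"
        by (simp add: funpow_swap1)
      then show ?thesis
        using 1 2 by (simp add: leib Suc.prems linear_add[OF linear_funpow[OF T.linear_N]])
    qed
  qed
  have lR: "linear (R a)" for a using bil_R by (rule bilinear_linear_right)
  \<comment> \<open>Those a whose commutator with \<open>y\<close> is again the action of an element
    over the derived algebra. Weight vectors span, so it suffices to place them in
    \<open>S\<close>.\<close>
  define S where "S = {a. \<exists>b\<in>?KK. \<forall>w\<in>?VV. y (R a w) - R a (y w) = R b w}"
  have eig_S: "a \<in> S" if a: "a \<in> ?LL" "(A.N c ^^ p) a = 0" for a c p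
  proof -
    let ?b = "pair.cs (cnj c) a"
    have sub: "?VV \<subseteq> {w. y (R a w) - R a (y w) = R ?b w}"
    proof (rule order_trans[OF spanV], rule span_minimal)
      have "y (R a w) - R a (y w) = R ?b w" if w: "w \<in> ?VV" "(T.N d ^^ q) w = 0" for w d q
      proof -
        have "y (R a w) = pair.cs (cnj (c + d)) (R a w)"
          by (rule y_eig[rule_format, OF R_closed[OF a(1) w(1)] leib_pow[OF a(1) w(1) a(2) w(2) refl]])
        moreover have "y w = pair.cs (cnj d) w" by (rule y_eig[rule_format, OF w])
        ultimately show ?thesis by (simp add: R_cs pair.cs_add_left)
      qed
      then show "{w \<in> ?VV. \<exists>c n. (T.N c ^^ n) w = 0} \<subseteq> {w. y (R a w) - R a (y w) = R ?b w}" by blast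
      show "subspace {w. y (R a w) - R a (y w) = R ?b w}"
        using linear_compose_sub[OF linear_compose[OF lR ly] linear_compose[OF ly lR]] lR
        by (intro subspace_linear_eq) (simp_all add: o_def)
    qed
    \<comment> \<open>For c = 0 the element is zero. Otherwise \<open>A\<close> maps into the
      derived part, so modulo it \<open>A.N c\<close> is the scalar -c. Its p-th power kills a,
      hence a nonzero multiple of a lies in the derived part.\<close>
    have "?b \<in> ?KK"
    proof (cases "c = 0")
      case True
      then show ?thesis using subspace_0[OF sKK] by simp
    next
      case False
      have NK: "A.N c u \<in> ?KK" if "u \<in> ?KK" for u
        unfolding A.N_def by (rule subspace_diff[OF sKK A_closed[OF subsetD[OF KKLL that]] csK[OF that]])
      have "(A.N c ^^ i) a - pair.cs ((- c) ^ i) a \<in> ?KK" for i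
      proof (induction i)
        case 0
        show ?case using subspace_0[OF sKK] by simp
      next
        case (Suc i)
        let ?k = "(A.N c ^^ i) a - pair.cs ((- c) ^ i) a"
        have "A.N c ((A.N c ^^ i) a) = A.N c ?k + A.N c (pair.cs ((- c) ^ i) a)"
          by (simp add: linear_diff[OF A.linear_N])
        then have "(A.N c ^^ Suc i) a - pair.cs ((- c) ^ Suc i) a = A.N c ?k + A (pair.cs ((- c) ^ i) a)"
          by (simp add: A.N_def[of c "pair.cs _ a"] pair.cs_minus_left flip: pair.cs_mult)
        then show ?case
          using subspace_add[OF sKK NK[OF Suc.IH] A_closed[OF csL[OF a(1)]]] by simp
      qed
      from this[of p] have "- pair.cs ((- c) ^ p) a \<in> ?KK" using a(2) by simp
      then have "pair.cs ((- c) ^ p) a \<in> ?KK" using subspace_neg[OF sKK, of "- pair.cs ((- c) ^ p) a"] by simp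
      then have "pair.cs (cnj c * inverse ((- c) ^ p)) (pair.cs ((- c) ^ p) a) \<in> ?KK" by (rule csK)
      moreover have "cnj c * inverse ((- c) ^ p) * (- c) ^ p = cnj c" using False by simp
      ultimately show ?thesis by (simp only: flip: pair.cs_mult)
    qed
    then show ?thesis unfolding S_def using sub[THEN subsetD]
      by (intro CollectI bexI[of _ ?b] ballI) (auto simp only: mem_Collect_eq)
  qed
  have sS: "subspace S"
  proof (rule subspaceI)
    show "0 \<in> S" unfolding S_def
      using subspace_0[OF sKK] by (intro CollectI bexI[of _ 0] ballI) (simp add: R_simps linear_0[OF ly])
    fix a assume "a \<in> S"
    then obtain b where b: "b \<in> ?KK" "\<And>w. w \<in> ?VV \<Longrightarrow> y (R a w) - R a (y w) = R b w" by (auto simp: S_def)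
    { fix a' assume "a' \<in> S"
      then obtain b' where b': "b' \<in> ?KK" "\<And>w. w \<in> ?VV \<Longrightarrow> y (R a' w) - R a' (y w) = R b' w" by (auto simp: S_def)
      have "y (R (a + a') w) - R (a + a') (y w) = R (b + b') w" if "w \<in> ?VV" for w
        using b(2)[OF that] b'(2)[OF that] by (simp add: R_simps linear_add[OF ly] algebra_simps)
      then show "a + a' \<in> S" unfolding S_def using subspace_add[OF sKK b(1) b'(1)]
        by (intro CollectI bexI[of _ "b + b'"] ballI) }
    { fix r
      have "y (R (r *\<^sub>R a) w) - R (r *\<^sub>R a) (y w) = R (r *\<^sub>R b) w" if "w \<in> ?VV" for w
        using b(2)[OF that] by (simp add: R_simps linear_scale[OF ly] flip: scaleR_diff_right)
      then show "r *\<^sub>R a \<in> S" unfolding S_def using subspace_scale[OF sKK b(1)]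
        by (intro CollectI bexI[of _ "r *\<^sub>R b"] ballI) }
  qed
  have LS: "?LL \<subseteq> S"
    by (rule order_trans[OF spanL], rule span_minimal[OF _ sS]) (use eig_S in blast)
  have z: "0 \<in> L" "0 \<in> V" using subspace_0 subspace_L subspace_V by blast+
  \<comment> \<open>The two diagonal blocks of the product are equal, and each has trace zero by
    \<open>tr0\<close>.\<close>
  have trR: "tr ?VV (\<lambda>w. R (a, 0) (R b w)) = 0" if a: "a \<in> L" and b: "b \<in> ?LL" for a b
  proof -
    have "tr ?VV (\<lambda>w. R (a, 0) (R b w))
        = tr V (\<lambda>v. fst (R (a, 0) (R b (v, 0)))) + tr V (\<lambda>v. snd (R (a, 0) (R b (0, v))))"
    proof (rule tr_Times[OF findim_V findim_V])
      show "linear (\<lambda>w. R (a, 0) (R b w))" using linear_compose[OF lR lR] by (simp add: o_def)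
      show "R (a, 0) (R b w) \<in> ?VV" if "w \<in> ?VV" for w
        using R_closed[OF _ R_closed[OF b that]] a z by simp
    qed
    also have "(\<lambda>v. fst (R (a, 0) (R b (v, 0)))) = (\<lambda>v. act a (act (fst b) v))"
      by (simp add: R_def act_simps)
    also have "(\<lambda>v. snd (R (a, 0) (R b (0, v)))) = (\<lambda>v. act a (act (fst b) v))"
      by (simp add: R_def act_simps)
    finally show ?thesis using tr0[OF a, of "fst b"] b by auto
  qed
  \<comment> \<open>The trace of [a,b] y equals that of a [b,y] by cyclicity, and [b,y] is minus the
    action of an element b' by membership in \<open>S\<close>; \<open>trR\<close> finishes.\<close>
  have tr_br: "tr ?VV (\<lambda>w. R (br a b, 0) (y w)) = 0" if ab: "a \<in> L" "b \<in> L" for a b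
  proof -
    have a: "(a, 0) \<in> ?LL" and b: "(b, 0) \<in> ?LL" using ab z by auto
    obtain b' where b': "b' \<in> ?KK" "\<And>w. w \<in> ?VV \<Longrightarrow> y (R (b, 0) w) - R (b, 0) (y w) = R b' w"
      using LS b by (auto simp: S_def)
    have yc: "y w \<in> ?VV" if "w \<in> ?VV" for w using that y_closed by blast
    have lRy: "linear (\<lambda>w. R (a, 0) (y w))" using linear_compose[OF ly lR] by (simp add: o_def)
    have "tr ?VV (\<lambda>w. R (br a b, 0) (y w))
        = tr ?VV (\<lambda>w. R (a, 0) (R (b, 0) (y w)) - R (b, 0) (R (a, 0) (y w)))"
    proof (rule tr_cong[OF fVV])
      fix w assume "w \<in> ?VV"
      then have "y w \<in> ?VV" by (rule yc)
      then have "fst (y w) \<in> V" "snd (y w) \<in> V" by (auto simp: mem_Times_iff)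
      then show "R (br a b, 0) (y w) = R (a, 0) (R (b, 0) (y w)) - R (b, 0) (R (a, 0) (y w))"
        using ab by (simp add: R_def act_br act_simps)
    qed
    also have "\<dots> = tr ?VV (\<lambda>w. R (a, 0) (R (b, 0) (y w))) - tr ?VV (\<lambda>w. R (b, 0) (R (a, 0) (y w)))"
      by (intro tr_diff fVV R_closed a b yc)
    also have "tr ?VV (\<lambda>w. R (b, 0) (R (a, 0) (y w))) = tr ?VV (\<lambda>w. R (a, 0) (y (R (b, 0) w)))"
      by (intro tr_comm[OF fVV fVV lR lRy] R_closed a b yc)
    also have "tr ?VV (\<lambda>w. R (a, 0) (R (b, 0) (y w))) - tr ?VV (\<lambda>w. R (a, 0) (y (R (b, 0) w)))
        = tr ?VV (\<lambda>w. R (a, 0) (R (b, 0) (y w)) - R (a, 0) (y (R (b, 0) w)))"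
      by (intro tr_diff[symmetric] fVV R_closed a b yc)
    also have "\<dots> = tr ?VV (\<lambda>w. (-1) *\<^sub>R R (a, 0) (R b' w))"
    proof (rule tr_cong[OF fVV])
      fix w assume "w \<in> ?VV"
      from b'(2)[OF this, symmetric]
      show "R (a, 0) (R (b, 0) (y w)) - R (a, 0) (y (R (b, 0) w)) = (-1) *\<^sub>R R (a, 0) (R b' w)"
        by (simp add: R_simps)
    qed
    also have "\<dots> = (-1) * tr ?VV (\<lambda>w. R (a, 0) (R b' w))"
    proof (rule tr_scale[OF fVV])
      fix w assume w: "w \<in> ?VV"
      show "R (a, 0) (R b' w) \<in> ?VV" by (rule R_closed[OF a R_closed[OF subsetD[OF KKLL b'(1)] w]])
    qed
    also have "tr ?VV (\<lambda>w. R (a, 0) (R b' w)) = 0" by (rule trR[OF ab(1) subsetD[OF KKLL b'(1)]])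
    finally show ?thesis by simp
  qed
  have "K \<subseteq> {u \<in> L. tr ?VV (\<lambda>w. R (u, 0) (y w)) = 0}"
    unfolding K
  proof (rule span_minimal)
    have Rc: "R (u, 0) (y w) \<in> ?VV" if "u \<in> L" "w \<in> ?VV" for u w
      using R_closed[of "(u, 0)" "y w"] y_closed that z by auto
    have plus: "(u + u', 0::'a) = (u, 0) + (u', 0)" "(r *\<^sub>R u, 0::'a) = r *\<^sub>R (u, 0)" for u u' :: 'a and r by simp_all
    show "subspace {u \<in> L. tr ?VV (\<lambda>w. R (u, 0) (y w)) = 0}"
    proof (rule subspaceI)
      have "tr ?VV (\<lambda>w. R (0, 0) (y w)) = tr ?VV (\<lambda>w. 0 *\<^sub>R w)"
        by (intro tr_cong fVV) (simp add: R_simps flip: zero_prod_def)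
      also have "\<dots> = 0" using tr_scale[OF fVV, of "\<lambda>w. w" 0] by simp
      finally show "0 \<in> {u \<in> L. tr ?VV (\<lambda>w. R (u, 0) (y w)) = 0}" using z by simp
    next
      fix u u' assume u: "u \<in> {u \<in> L. tr ?VV (\<lambda>w. R (u, 0) (y w)) = 0}"
        "u' \<in> {u \<in> L. tr ?VV (\<lambda>w. R (u, 0) (y w)) = 0}"
      have "tr ?VV (\<lambda>w. R (u, 0) (y w) + R (u', 0) (y w))
          = tr ?VV (\<lambda>w. R (u, 0) (y w)) + tr ?VV (\<lambda>w. R (u', 0) (y w))"
        using u by (intro tr_add fVV Rc) auto
      then show "u + u' \<in> {u \<in> L. tr ?VV (\<lambda>w. R (u, 0) (y w)) = 0}"
        using u subspace_add[OF subspace_L] by (simp add: plus R_simps del: add_Pair)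
    next
      fix r u assume u: "u \<in> {u \<in> L. tr ?VV (\<lambda>w. R (u, 0) (y w)) = 0}"
      have "tr ?VV (\<lambda>w. r *\<^sub>R R (u, 0) (y w)) = r * tr ?VV (\<lambda>w. R (u, 0) (y w))"
        using u by (intro tr_scale fVV Rc) auto
      then show "r *\<^sub>R u \<in> {u \<in> L. tr ?VV (\<lambda>w. R (u, 0) (y w)) = 0}"
        using u subspace_scale[OF subspace_L] by (simp add: plus R_simps del: scaleR_Pair)
    qed
  qed (use tr_br br_closed in blast)
  moreover have "T w = R (x, 0) w" for w by (simp add: T_def R_def act_simps)
  ultimately have "tr ?VV (\<lambda>w. T (y w)) = 0" using xK by auto
  then obtain n where n: "\<forall>w\<in>?VV. (T ^^ n) w = 0" using nilT by blast
  have "(T ^^ k) (v, 0) = ((act x ^^ k) v, 0)" for v k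
    by (induction k) (simp_all add: T_def act_simps)
  then have "\<forall>v\<in>V. (act x ^^ n) v = 0" using n z by (metis SigmaI prod.inject zero_prod_def)
  then show ?thesis by blast
qed

text \<open>The trace condition makes [L,L] act by nilpotent operators, and then some term of the
  derived series of [L,L] acts as zero.\<close>

lemma cartan_criterion:
  fixes L V :: "'a::real_vector set"
  assumes "lie_module L br V act"
    and "\<And>x y. x \<in> L \<Longrightarrow> y \<in> L \<Longrightarrow> tr V (\<lambda>v. act x (act y v)) = 0"
  obtains n where "\<And>x v. x \<in> derived_series br L n \<Longrightarrow> v \<in> V \<Longrightarrow> act x v = 0"
proof -
  interpret lie_module L br V act by fact
  have "lie_module (derived_series br L 1) br V act"
    using subspace_derived_series[OF subspace_L] derived_subset derived_closed by (rule restrict_algebra)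
  then obtain n where "\<And>x v. x \<in> derived_series br (derived_series br L 1) n \<Longrightarrow> v \<in> V \<Longrightarrow> act x v = 0"
    using nilpotent_module derived_nilpotent_of_trace_zero[OF assms(2)] by blast
  then show ?thesis using that[of "1 + n"] unfolding derived_series_add by blast
qed

section \<open>Semisimple Lie algebras\<close>

text \<open>Semisimplicity in a form free of the definite description behind
  \<open>lie_radical\<close>, usable for \<open>S\<close> with its projected bracket as
  well.\<close>

definition no_solvable_ideals :: "'a::real_vector set \<Rightarrow> ('a \<Rightarrow> 'a \<Rightarrow> 'a) \<Rightarrow> bool" where
  "no_solvable_ideals L br \<longleftrightarrow> (\<forall>I. lie_ideal L br I \<and> lie_solvable br I \<longrightarrow> I = {0})"

section \<open>Dual bases and invariant trace forms\<close>

lemma inj_endo_surj: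
  assumes J: "findim J" and T: "linear T" "\<And>x. x \<in> J \<Longrightarrow> T x \<in> J" and inj: "inj_on T J"
  shows "T ` J = J"
proof -
  obtain E where E: "finite E" "independent E" "span E = J" "card E = dim J"
    by (rule findim_basis[OF J])
  have EJ: "E \<subseteq> J" using E(3) span_superset by blast
  have "independent (T ` E)" using linear_independent_injective_image[OF T(1) E(2)] inj E(3) by simp
  moreover have "card (T ` E) = dim J" using card_image[OF inj_on_subset[OF inj EJ]] E(4) by simp
  ultimately have "dim J \<le> dim (T ` J)"
    using findim_independent(2)[OF findim_image[OF T(1) J], of "T ` E"] image_mono[OF EJ, of T] by simp
  moreover have "T ` J \<subseteq> J" using T(2) by (rule image_subsetI)
  ultimately show ?thesis
    by (intro findim_dim_eq[OF J linear_subspace_image[OF T(1) findim_subspace[OF J]]])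
qed

text \<open>The map \<open>T\<close> sends x to the combination of the basis with coefficients B x
  e. Nondegeneracy makes it injective, hence bijective on \<open>J\<close>, and d e is the preimage
  of e, which is exactly biorthogonality.\<close>

lemma dual_basis:
  fixes B :: "'a::real_vector \<Rightarrow> 'a \<Rightarrow> real"
  assumes J: "findim J"
    and sym: "\<And>x y. x \<in> J \<Longrightarrow> y \<in> J \<Longrightarrow> B x y = B y x"
    and add: "\<And>x y z. x \<in> J \<Longrightarrow> y \<in> J \<Longrightarrow> z \<in> J \<Longrightarrow> B (x + y) z = B x z + B y z"
    and scale: "\<And>c x y. x \<in> J \<Longrightarrow> y \<in> J \<Longrightarrow> B (c *\<^sub>R x) y = c * B x y"
    and nondeg: "\<And>x. x \<in> J \<Longrightarrow> (\<And>y. y \<in> J \<Longrightarrow> B x y = 0) \<Longrightarrow> x = 0"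
  obtains E d where "finite E" "card E = dim J" "\<And>e. e \<in> E \<Longrightarrow> e \<in> J" "\<And>e. e \<in> E \<Longrightarrow> d e \<in> J"
    "\<And>e. e \<in> E \<Longrightarrow> B (d e) e = 1"
    "\<And>x. x \<in> J \<Longrightarrow> x = (\<Sum>e\<in>E. B (d e) x *\<^sub>R e)"
    "\<And>x. x \<in> J \<Longrightarrow> x = (\<Sum>e\<in>E. B e x *\<^sub>R d e)"
proof -
  have sJ: "subspace J" using J by (rule findim_subspace)
  obtain E where E: "finite E" "independent E" "span E = J" "card E = dim J"
    by (rule findim_basis[OF J])
  have EJ: "e \<in> J" if "e \<in> E" for e using that E(3) span_base by blast
  \<comment> \<open>\<open>B\<close> is linear only on \<open>J\<close>; precomposing with
    \<open>p\<close> gives functionals that are linear on the whole type.\<close>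
  obtain p where p: "linear p" "\<And>x. p x \<in> J" "\<And>x. x \<in> J \<Longrightarrow> p x = x"
    by (rule projection_exists[OF sJ subspace_single_0]) (auto intro: that)
  have lB: "linear (\<lambda>x. B (p x) y)" if "y \<in> J" for y
    by (rule linearI) (simp_all add: linear_add[OF p(1)] linear_scale[OF p(1)] add scale p(2) that)
  have sum_l: "B (\<Sum>i\<in>I. c i *\<^sub>R x i) y = (\<Sum>i\<in>I. c i * B (x i) y)"
    if "y \<in> J" "\<And>i. i \<in> I \<Longrightarrow> x i \<in> J" for I :: "'a set" and c x y
  proof -
    have "(\<Sum>i\<in>I. c i *\<^sub>R x i) \<in> J" using that(2) sJ by (intro subspace_sum) (auto intro: subspace_scale)
    then have "B (\<Sum>i\<in>I. c i *\<^sub>R x i) y = (\<Sum>i\<in>I. B (p (c i *\<^sub>R x i)) y)"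
      using linear_sum[OF lB[OF that(1)], of "\<lambda>i. c i *\<^sub>R x i" I] p(3) by simp
    also have "\<dots> = (\<Sum>i\<in>I. c i * B (x i) y)"
      using that by (intro sum.cong refl) (simp add: p(3) scale subspace_scale[OF sJ])
    finally show ?thesis .
  qed
  define T where "T x = (\<Sum>e\<in>E. B (p x) e *\<^sub>R e)" for x
  have lT: "linear T"
    by (rule linearI) (simp_all add: T_def linear_add[OF lB[OF EJ]] linear_scale[OF lB[OF EJ]]
      scaleR_add_left sum.distrib scaleR_sum_right)
  have TJ: "T x \<in> J" for x
    unfolding T_def using EJ by (intro subspace_sum[OF sJ] subspace_scale[OF sJ])
  have ext: "x = y" if xy: "x \<in> J" "y \<in> J" "\<And>e. e \<in> E \<Longrightarrow> B x e = B y e" for x y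
  proof -
    have "x - y \<in> J" using xy sJ by (simp add: subspace_diff)
    moreover have Be: "B (x - y) e = 0" if "e \<in> E" for e
      using linear_diff[OF lB[OF EJ[OF that]], of x y] xy that subspace_diff[OF sJ] by (simp add: p(3))
    have "B (x - y) z = 0" if "z \<in> J" for z
    proof -
      have "z = (\<Sum>e\<in>E. representation E z e *\<^sub>R e)"
        using real_vector.sum_representation_eq[OF E(2) _ E(1) order_refl, of z] that E(3) by simp
      then have "B z (x - y) = (\<Sum>e\<in>E. representation E z e * B e (x - y))"
        using sum_l[where I = E and c = "representation E z" and x = "\<lambda>e. e", OF \<open>x - y \<in> J\<close> EJ] by simp
      also have "\<dots> = 0" using Be sym[OF \<open>x - y \<in> J\<close> EJ] by simp
      finally show ?thesis using sym[OF \<open>x - y \<in> J\<close> that] by simp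
    qed
    ultimately have "x - y = 0" using nondeg by blast
    then show ?thesis by simp
  qed
  have coeff: "c e = c' e" if "(\<Sum>e\<in>E. c e *\<^sub>R e) = (\<Sum>e\<in>E. c' e *\<^sub>R e)" "e \<in> E" for c c' :: "'a \<Rightarrow> real" and e
  proof -
    have "(\<Sum>e\<in>E. (c e - c' e) *\<^sub>R e) = 0" using that(1) by (simp add: scaleR_diff_left sum_subtractf)
    then have "c e - c' e = 0" by (rule independentD[OF E(2,1) order_refl _ that(2)])
    then show ?thesis by simp
  qed
  have inj: "inj_on T J"
  proof (rule inj_onI)
    fix x y assume xy: "x \<in> J" "y \<in> J" and eq: "T x = T y"
    have "B x e = B y e" if "e \<in> E" for e
      using coeff[OF eq[unfolded T_def] that] xy by (simp add: p(3))
    then show "x = y" by (rule ext[OF xy])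
  qed
  have "T ` J = J" by (rule inj_endo_surj[OF J lT TJ inj])
  then have "\<forall>e\<in>E. \<exists>x\<in>J. T x = e" using EJ by (metis imageE)
  then obtain d where d: "\<And>e. e \<in> E \<Longrightarrow> d e \<in> J" "\<And>e. e \<in> E \<Longrightarrow> T (d e) = e" by metis
  have delta: "B (d e) f = (if f = e then 1 else 0)" if "e \<in> E" "f \<in> E" for e f
  proof -
    have "(\<Sum>f\<in>E. B (d e) f *\<^sub>R f) = e" using d that(1) by (simp add: T_def p(3))
    also have "\<dots> = (\<Sum>f\<in>E. (if f = e then 1 else 0) *\<^sub>R f)"
      using E(1) that(1) by (simp add: if_distrib[of "\<lambda>c. c *\<^sub>R _"] cong: if_cong)
    finally show ?thesis by (rule coeff[OF _ that(2)])
  qed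
  have exp2: "x = (\<Sum>e\<in>E. B e x *\<^sub>R d e)" if "x \<in> J" for x
  proof (rule ext[OF that])
    show "(\<Sum>e\<in>E. B e x *\<^sub>R d e) \<in> J" using d(1) by (intro subspace_sum[OF sJ] subspace_scale[OF sJ])
    fix f assume f: "f \<in> E"
    have "B (\<Sum>e\<in>E. B e x *\<^sub>R d e) f = (\<Sum>e\<in>E. B e x * B (d e) f)"
      by (rule sum_l[OF EJ[OF f] d(1)])
    also have "\<dots> = (\<Sum>e\<in>E. if e = f then B e x else 0)"
      by (intro sum.cong refl) (simp add: delta f)
    also have "\<dots> = B f x" using E(1) f by simp
    finally show "B x f = B (\<Sum>e\<in>E. B e x *\<^sub>R d e) f" using sym[OF that EJ[OF f]] by simp
  qed
  have exp1: "x = (\<Sum>e\<in>E. B (d e) x *\<^sub>R e)" if "x \<in> J" for x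
  proof -
    have rep: "x = (\<Sum>e\<in>E. representation E x e *\<^sub>R e)"
      using real_vector.sum_representation_eq[OF E(2) _ E(1) order_refl, of x] that E(3) by simp
    have "B (d f) x = representation E x f" if f: "f \<in> E" for f
    proof -
      have "B x (d f) = (\<Sum>e\<in>E. representation E x e * B e (d f))"
        using sum_l[where I = E and c = "representation E x" and x = "\<lambda>e. e", OF d(1)[OF f] EJ] rep by simp
      also have "\<dots> = (\<Sum>e\<in>E. if e = f then representation E x e else 0)"
        using sym[OF EJ d(1)[OF f]] by (intro sum.cong refl) (simp add: delta f)
      also have "\<dots> = representation E x f" using E(1) f by simp
      finally show ?thesis using sym[OF d(1)[OF f] \<open>x \<in> J\<close>] by simp
    qed
    then show ?thesis using rep by simp
  qed
  show ?thesis
    by (rule that[OF E(1,4) EJ d(1) _ exp1 exp2]) (use delta in auto)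
qed

context lie_module
begin

text \<open>The trace form of the representation; for the adjoint module it is the Killing
  form.\<close>

definition form :: "'a \<Rightarrow> 'a \<Rightarrow> real" where
  "form x y = tr V (\<lambda>v. act x (act y v))"

lemma form_sym: "x \<in> L \<Longrightarrow> y \<in> L \<Longrightarrow> form x y = form y x"
  unfolding form_def by (rule tr_comm[OF findim_V findim_V linear_act linear_act act_closed act_closed])

lemma form_add: "x \<in> L \<Longrightarrow> y \<in> L \<Longrightarrow> z \<in> L \<Longrightarrow> form (x + y) z = form x z + form y z"
  using tr_add[OF findim_V, of "\<lambda>v. act x (act z v)" "\<lambda>v. act y (act z v)"] act_closed
  by (simp add: form_def act_simps)

lemma form_scale: "x \<in> L \<Longrightarrow> y \<in> L \<Longrightarrow> form (c *\<^sub>R x) y = c * form x y"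
  using tr_scale[OF findim_V, of "\<lambda>v. act x (act y v)" c] act_closed
  by (simp add: form_def act_simps)

lemma form_add_right: "x \<in> L \<Longrightarrow> y \<in> L \<Longrightarrow> z \<in> L \<Longrightarrow> form z (x + y) = form z x + form z y"
  using form_add form_sym subspace_add[OF subspace_L] by simp

lemma form_scale_right: "x \<in> L \<Longrightarrow> y \<in> L \<Longrightarrow> form x (c *\<^sub>R y) = c * form x y"
  using form_scale form_sym subspace_scale[OF subspace_L] by simp

lemma form_zero: "x \<in> L \<Longrightarrow> form 0 x = 0" "x \<in> L \<Longrightarrow> form x 0 = 0"
  using form_scale[of 0 x 0] form_scale_right[of x 0 0] subspace_0[OF subspace_L] by simp_all

lemma form_sum:
  assumes "\<And>i. i \<in> I \<Longrightarrow> x i \<in> L" "y \<in> L"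
  shows "form (\<Sum>i\<in>I. c i *\<^sub>R x i) y = (\<Sum>i\<in>I. c i * form (x i) y)"
  using assms(1)
proof (induction I rule: infinite_finite_induct)
  case (insert i I)
  have "(\<Sum>i\<in>I. c i *\<^sub>R x i) \<in> L"
    using insert.prems by (intro subspace_sum subspace_L subspace_scale) auto
  then show ?case
    using insert assms(2) by (simp add: form_add form_scale subspace_scale[OF subspace_L])
qed (simp_all add: form_zero assms(2))

text \<open>Expanding both brackets, the only terms that differ have traces equal by
  cyclicity.\<close>

lemma form_invariant:
  assumes "x \<in> L" "y \<in> L" "z \<in> L"
  shows "form (br x y) z = form x (br y z)"
proof -
  note c = act_closed[OF assms(1)] act_closed[OF assms(2)] act_closed[OF assms(3)]
  have lxz: "linear (\<lambda>v. act x (act z v))" using linear_compose[OF linear_act linear_act] by (simp add: o_def)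
  have "form (br x y) z = tr V (\<lambda>v. act x (act y (act z v)) - act y (act x (act z v)))"
    unfolding form_def using assms c by (intro tr_cong findim_V) (simp add: act_br)
  also have "\<dots> = tr V (\<lambda>v. act x (act y (act z v))) - tr V (\<lambda>v. act y (act x (act z v)))"
    by (intro tr_diff findim_V c)
  also have "tr V (\<lambda>v. act y (act x (act z v))) = tr V (\<lambda>v. act x (act z (act y v)))"
    by (intro tr_comm[OF findim_V findim_V linear_act lxz] c)
  also have "tr V (\<lambda>v. act x (act y (act z v))) - tr V (\<lambda>v. act x (act z (act y v)))
      = tr V (\<lambda>v. act x (act y (act z v)) - act x (act z (act y v)))"
    by (intro tr_diff[symmetric] findim_V c)
  also have "\<dots> = form x (br y z)"
    unfolding form_def using assms by (intro tr_cong findim_V) (simp add: act_br act_simps)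
  finally show ?thesis .
qed

lemma ideal_closed:
  assumes "lie_ideal L br I"
  shows "subspace I" "I \<subseteq> L" "\<And>x y. x \<in> L \<Longrightarrow> y \<in> I \<Longrightarrow> br x y \<in> I" "\<And>x y. x \<in> I \<Longrightarrow> y \<in> L \<Longrightarrow> br x y \<in> I"
proof -
  show s: "subspace I" "I \<subseteq> L" and l: "\<And>x y. x \<in> L \<Longrightarrow> y \<in> I \<Longrightarrow> br x y \<in> I"
    using assms by (auto simp: lie_ideal_def)
  fix x y assume xy: "x \<in> I" "y \<in> L"
  then have "x \<in> L" using s(2) by blast
  then have "br x y = - br y x" using br_skew[OF xy(2)] by simp
  then show "br x y \<in> I" using subspace_neg[OF s(1) l[OF xy(2,1)]] by simp
qed

lemma form_perp_ideal:
  assumes "lie_ideal L br I"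
  shows "lie_ideal L br {x \<in> L. \<forall>y\<in>I. form x y = 0}"
proof -
  note I = ideal_closed[OF assms]
  have IL: "y \<in> L" if "y \<in> I" for y using that I(2) by blast
  have "form (br x z) y = 0" if "x \<in> L" "z \<in> L" "\<forall>y\<in>I. form z y = 0" "y \<in> I" for x y z
  proof -
    have "form (br x z) y = form (- br z x) y" using br_skew[OF that(2,1)] by simp
    also have "\<dots> = - form (br z x) y"
      using form_scale[OF br_closed[OF that(2,1)] IL[OF that(4)], of "-1"] by simp
    also have "\<dots> = - form z (br x y)" using form_invariant that IL by simp
    also have "\<dots> = 0" using that I(3) by simp
    finally show ?thesis .
  qed
  moreover have "subspace {x \<in> L. \<forall>y\<in>I. form x y = 0}"
    by (rule subspaceI) (simp_all add: form_zero form_add form_scale IL subspace_0[OF subspace_L]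
      subspace_add[OF subspace_L] subspace_scale[OF subspace_L])
  ultimately show ?thesis unfolding lie_ideal_def using br_closed by simp
qed

lemma kernel_ideal: "lie_ideal L br {x \<in> L. \<forall>v\<in>V. act x v = 0}"
proof -
  have "act (br x y) v = 0" if "x \<in> L" "y \<in> L" "\<forall>v\<in>V. act y v = 0" "v \<in> V" for x y v
    using that by (simp add: act_br act_closed act_simps)
  moreover have "subspace {x \<in> L. \<forall>v\<in>V. act x v = 0}"
    by (rule subspaceI) (simp_all add: act_simps subspace_0[OF subspace_L]
      subspace_add[OF subspace_L] subspace_scale[OF subspace_L])
  ultimately show ?thesis unfolding lie_ideal_def using br_closed by simp
qed

lemma ideal_Int:
  assumes "lie_ideal L br I" "lie_ideal L br J"
  shows "lie_ideal L br (I \<inter> J)"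
  using assms by (auto simp: lie_ideal_def intro: subspace_inter)

end

text \<open>Cartan's criterion lets some derived term of \<open>I\<close> act as zero; faithfulness
  makes this term zero, so \<open>I\<close> is solvable.\<close>

lemma ideal_trivial_of_form_zero:
  fixes L V :: "'a::real_vector set"
  assumes "lie_module L br V act" and ss: "no_solvable_ideals L br" and I: "lie_ideal L br I"
    and form: "\<And>x y. x \<in> I \<Longrightarrow> y \<in> I \<Longrightarrow> lie_module.form V act x y = 0"
    and faithful: "\<And>x. x \<in> I \<Longrightarrow> (\<And>v. v \<in> V \<Longrightarrow> act x v = 0) \<Longrightarrow> x = 0"
  shows "I = {0}"
proof -
  interpret lie_module L br V act by fact
  note I' = ideal_closed[OF I]
  have Ic: "br x y \<in> I" if "x \<in> I" "y \<in> I" for x y using I'(3) that I'(2) by blast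
  interpret I: lie_module I br V act using I'(1,2) Ic by (rule restrict_algebra)
  obtain n where n: "\<And>x v. x \<in> derived_series br I n \<Longrightarrow> v \<in> V \<Longrightarrow> act x v = 0"
    using cartan_criterion[OF I.lie_module_axioms] form unfolding form_def by metis
  have "derived_series br I n \<subseteq> {0}"
  proof
    fix x assume "x \<in> derived_series br I n"
    then have "x \<in> I" "\<And>v. v \<in> V \<Longrightarrow> act x v = 0" using I.derived_subset n by blast+
    then show "x \<in> {0}" using faithful by simp
  qed
  moreover have "0 \<in> derived_series br I n"
    using subspace_0[OF subspace_derived_series[OF I'(1)]] .
  ultimately have "lie_solvable br I" unfolding lie_solvable_def by blast
  then show ?thesis using ss I unfolding no_solvable_ideals_def by blast
qed

section \<open>Killing form and derivations of a semisimple algebra\<close>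

locale semisimple_lie =
  fixes L :: "'a::real_vector set" and br :: "'a \<Rightarrow> 'a \<Rightarrow> 'a"
  assumes lie: "lie_module L br L br" and ss: "no_solvable_ideals L br"
begin

sublocale ad: lie_module L br L br by (rule lie)

lemma center_trivial:
  assumes "x \<in> L" "\<And>y. y \<in> L \<Longrightarrow> br x y = 0"
  shows "x = 0"
proof -
  let ?Z = "{x \<in> L. \<forall>v\<in>L. br x v = 0}"
  have "{br x y | x y. x \<in> ?Z \<and> y \<in> ?Z} \<subseteq> {0}" by auto
  then have "derived_series br ?Z 1 \<subseteq> {0}" by (simp add: span_minimal)
  moreover have "0 \<in> derived_series br ?Z 1" by (simp add: span_zero)
  ultimately have "lie_solvable br ?Z" unfolding lie_solvable_def by blast
  then have "?Z = {0}" using ad.kernel_ideal ss unfolding no_solvable_ideals_def by blast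
  then show ?thesis using assms by blast
qed

lemma ideal_trivial_of_killing_zero:
  assumes "lie_ideal L br I" "\<And>x y. x \<in> I \<Longrightarrow> y \<in> I \<Longrightarrow> ad.form x y = 0"
  shows "I = {0}"
  by (rule ideal_trivial_of_form_zero[OF lie ss assms(1)])
    (use assms(2) center_trivial ad.ideal_closed(2)[OF assms(1)] in \<open>auto simp: subset_iff\<close>)

text \<open>The radical of the Killing form is an ideal on which this form vanishes.\<close>

lemma killing_nondegenerate:
  assumes "x \<in> L" "\<And>y. y \<in> L \<Longrightarrow> ad.form x y = 0"
  shows "x = 0"
proof -
  have "lie_ideal L br L" using ad.subspace_L ad.br_closed by (simp add: lie_ideal_def)
  then have "{x \<in> L. \<forall>y\<in>L. ad.form x y = 0} = {0}"
    by (intro ideal_trivial_of_killing_zero ad.form_perp_ideal) auto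
  then show ?thesis using assms by blast
qed

lemma killing_dual_basis:
  obtains E d where "\<And>e. e \<in> E \<Longrightarrow> d e \<in> L"
    "\<And>x. x \<in> L \<Longrightarrow> x = (\<Sum>e\<in>E. ad.form (d e) x *\<^sub>R e)"
  by (rule dual_basis[OF ad.findim_L ad.form_sym ad.form_add ad.form_scale killing_nondegenerate])
    (assumption | rule that; assumption)+

lemma killing_represents:
  assumes "linear \<psi>"
  obtains d where "d \<in> L" "\<And>x. x \<in> L \<Longrightarrow> ad.form d x = (\<psi> x :: real)"
proof -
  obtain E d where E: "\<And>e. e \<in> E \<Longrightarrow> d e \<in> L" "\<And>x. x \<in> L \<Longrightarrow> x = (\<Sum>e\<in>E. ad.form (d e) x *\<^sub>R e)"
    by (rule killing_dual_basis) (rule that; assumption)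
  let ?d = "\<Sum>e\<in>E. \<psi> e *\<^sub>R d e"
  have dL: "?d \<in> L" using E(1) by (intro subspace_sum ad.subspace_L subspace_scale)
  have "ad.form ?d x = \<psi> x" if "x \<in> L" for x
  proof -
    have "\<psi> x = \<psi> (\<Sum>e\<in>E. ad.form (d e) x *\<^sub>R e)" using E(2)[OF that] by simp
    also have "\<dots> = (\<Sum>e\<in>E. ad.form (d e) x * \<psi> e)"
      by (simp add: linear_sum[OF assms] linear_scale[OF assms])
    finally show ?thesis using ad.form_sum[OF E(1) that] by (simp add: mult.commute)
  qed
  then show ?thesis using that dL by blast
qed

text \<open>The functional sending x to the trace of D ad x is represented by some d under the
  Killing form. For E = D - ad d all traces of E ad x vanish. Since ad (E x) = [E, ad x], the
  Killing form of E x and y is the trace of E ad [x,y], which is zero.\<close>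

lemma derivation_inner:
  assumes D: "linear D" "\<And>x. x \<in> L \<Longrightarrow> D x \<in> L"
    and leibniz: "\<And>x y. x \<in> L \<Longrightarrow> y \<in> L \<Longrightarrow> D (br x y) = br (D x) y + br x (D y)"
  obtains d where "d \<in> L" "\<And>x. x \<in> L \<Longrightarrow> D x = br d x"
proof -
  obtain p where p: "linear p" "\<And>x. p x \<in> L" "\<And>x. x \<in> L \<Longrightarrow> p x = x"
    by (rule projection_exists[OF ad.subspace_L subspace_single_0]) (auto intro: that)
  have DL: "D (br x y) \<in> L" if "x \<in> L" "y \<in> L" for x y using D(2) ad.br_closed that by blast
  define \<psi> where "\<psi> x = tr L (\<lambda>z. D (br (p x) z))" for x
  have l\<psi>: "linear \<psi>"
  proof (rule linearI)
    show "\<psi> (x + y) = \<psi> x + \<psi> y" for x y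
      using tr_add[OF ad.findim_L, of "\<lambda>z. D (br (p x) z)" "\<lambda>z. D (br (p y) z)"] DL[OF p(2)]
      by (simp add: \<psi>_def linear_add[OF p(1)] ad.br_simps linear_add[OF D(1)])
    show "\<psi> (c *\<^sub>R x) = c *\<^sub>R \<psi> x" for c x
      using tr_scale[OF ad.findim_L, of "\<lambda>z. D (br (p x) z)" c] DL[OF p(2)]
      by (simp add: \<psi>_def linear_scale[OF p(1)] ad.br_simps linear_scale[OF D(1)])
  qed
  obtain d where d: "d \<in> L" "\<And>x. x \<in> L \<Longrightarrow> ad.form d x = \<psi> x" using killing_represents[OF l\<psi>] by blast
  define E where "E x = D x - br d x" for x
  have lE: "linear E" unfolding E_def using D(1) ad.linear_br by (rule linear_compose_sub)
  have EL: "E x \<in> L" if "x \<in> L" for x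
    unfolding E_def using subspace_diff[OF ad.subspace_L D(2)[OF that] ad.br_closed[OF d(1) that]] .
  have Eder: "br (E x) z = E (br x z) - br x (E z)" if "x \<in> L" "z \<in> L" for x z
    using leibniz[OF that] ad.br_jacobi[OF d(1) that] by (simp add: E_def ad.br_simps)
  have tr0: "tr L (\<lambda>z. E (br x z)) = 0" if "x \<in> L" for x
  proof -
    have "tr L (\<lambda>z. E (br x z)) = tr L (\<lambda>z. D (br x z)) - tr L (\<lambda>z. br d (br x z))"
      unfolding E_def using DL[OF that] ad.br_closed[OF d(1) ad.br_closed[OF that]]
      by (rule tr_diff[OF ad.findim_L])
    also have "\<dots> = 0" using d(2)[OF that] p(3)[OF that] by (simp add: \<psi>_def ad.form_def)
    finally show ?thesis .
  qed
  have "E x = 0" if x: "x \<in> L" for x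
  proof (rule killing_nondegenerate[OF EL[OF x]])
    fix y assume y: "y \<in> L"
    note c = ad.br_closed[OF x] ad.br_closed[OF y] EL
    have l: "linear (\<lambda>z. E (br y z))" using linear_compose[OF ad.linear_br lE] by (simp add: o_def)
    have "ad.form (E x) y = tr L (\<lambda>z. E (br x (br y z)) - br x (E (br y z)))"
      unfolding ad.form_def using x c by (intro tr_cong ad.findim_L) (simp add: Eder)
    also have "\<dots> = tr L (\<lambda>z. E (br x (br y z))) - tr L (\<lambda>z. br x (E (br y z)))"
      by (intro tr_diff ad.findim_L c)
    also have "tr L (\<lambda>z. br x (E (br y z))) = tr L (\<lambda>z. E (br y (br x z)))"
      by (intro tr_comm[OF ad.findim_L ad.findim_L ad.linear_br l] c)
    also have "tr L (\<lambda>z. E (br x (br y z))) - tr L (\<lambda>z. E (br y (br x z)))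
        = tr L (\<lambda>z. E (br x (br y z)) - E (br y (br x z)))"
      by (intro tr_diff[symmetric] ad.findim_L c)
    also have "\<dots> = tr L (\<lambda>z. E (br (br x y) z))"
      using x y by (intro tr_cong ad.findim_L) (simp add: ad.br_jacobi linear_diff[OF lE])
    also have "\<dots> = 0" using tr0 ad.br_closed[OF x y] by blast
    finally show "ad.form (E x) y = 0" .
  qed
  then have "D x = br d x" if "x \<in> L" for x using that by (simp add: E_def)
  then show ?thesis using that d(1) by blast
qed

end

section \<open>Whitehead's second lemma\<close>

text \<open>Alternating 2-cocycles of the Chevalley-Eilenberg complex with coefficients in
  \<open>V\<close>.\<close>

definition two_cocycle ::
    "'a::real_vector set \<Rightarrow> ('a \<Rightarrow> 'a \<Rightarrow> 'a) \<Rightarrow> 'b::real_vector set \<Rightarrow> ('a \<Rightarrow> 'b \<Rightarrow> 'b) \<Rightarrow> ('a \<Rightarrow> 'a \<Rightarrow> 'b) \<Rightarrow> bool"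
  where
  "two_cocycle L br V act f \<longleftrightarrow>
     bilinear f \<and> (\<forall>x\<in>L. \<forall>y\<in>L. f x y \<in> V) \<and> (\<forall>x\<in>L. f x x = 0) \<and>
     (\<forall>x\<in>L. \<forall>y\<in>L. \<forall>z\<in>L. act x (f y z) - act y (f x z) + act z (f x y)
        - f (br x y) z + f (br x z) y - f (br y z) x = 0)"

lemma two_cocycle_skew:
  assumes "two_cocycle L br V act f" "subspace L" "x \<in> L" "y \<in> L"
  shows "f y x = - f x y"
proof -
  have f: "bilinear f" "\<And>x. x \<in> L \<Longrightarrow> f x x = 0" using assms(1) by (simp_all add: two_cocycle_def)
  have "f (x + y) (x + y) = 0" using assms by (intro f(2) subspace_add)
  then have "f y x + f x y = 0" using f(2) assms(3,4) by (simp add: bilinear_simps[OF f(1)] add.commute)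
  then show ?thesis by (simp add: eq_neg_iff_add_eq_0)
qed

text \<open>Invariance of the tensor formed by summing e \<otimes> d e, tested on arbitrary bilinear
  maps. Invariance of \<open>form\<close> makes the matrix of ad x on the basis the negative
  transpose of its matrix on the dual basis, so the two sums cancel.\<close>

lemma (in lie_module) dual_basis_invariant:
  fixes \<beta> :: "'a \<Rightarrow> 'a \<Rightarrow> 'c::real_vector"
  assumes J: "lie_ideal L br J" and dJ: "\<And>e. e \<in> E \<Longrightarrow> e \<in> J" "\<And>e. e \<in> E \<Longrightarrow> d e \<in> J"
    and exp: "\<And>x. x \<in> J \<Longrightarrow> x = (\<Sum>e\<in>E. form (d e) x *\<^sub>R e)"
      "\<And>x. x \<in> J \<Longrightarrow> x = (\<Sum>e\<in>E. form e x *\<^sub>R d e)"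
    and \<beta>: "bilinear \<beta>" and x: "x \<in> L"
  shows "(\<Sum>e\<in>E. \<beta> (br x e) (d e) + \<beta> e (br x (d e))) = 0"
proof -
  note J' = ideal_closed[OF J]
  have inL: "e \<in> L" "d e \<in> L" if "e \<in> E" for e using J'(2) dJ that by blast+
  have "(\<Sum>e\<in>E. \<beta> (br x e) (d e)) = (\<Sum>e\<in>E. \<Sum>g\<in>E. form (d g) (br x e) *\<^sub>R \<beta> g (d e))"
  proof (rule sum.cong[OF refl])
    fix e assume "e \<in> E"
    have "\<beta> (br x e) (d e) = \<beta> (\<Sum>g\<in>E. form (d g) (br x e) *\<^sub>R g) (d e)"
      using exp(1)[OF J'(3)[OF x dJ(1)[OF \<open>e \<in> E\<close>]]] by simp
    then show "\<beta> (br x e) (d e) = (\<Sum>g\<in>E. form (d g) (br x e) *\<^sub>R \<beta> g (d e))"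
      by (simp add: linear_sum[OF bilinear_linear_left[OF \<beta>]] bilinear_lmul[OF \<beta>])
  qed
  also have "\<dots> = (\<Sum>e\<in>E. \<Sum>g\<in>E. - (form e (br x (d g)) *\<^sub>R \<beta> g (d e)))"
  proof (intro sum.cong refl)
    fix e g assume e: "e \<in> E" and g: "g \<in> E"
    have c: "br x (d g) \<in> L" using br_closed[OF x inL(2)[OF g]] .
    have "form (d g) (br x e) = form (br (d g) x) e" using form_invariant[OF inL(2)[OF g] x inL(1)[OF e]] by simp
    also have "\<dots> = form (- br x (d g)) e" using br_skew[OF x inL(2)[OF g]] by simp
    also have "\<dots> = - form (br x (d g)) e" using form_scale[OF c inL(1)[OF e], of "-1"] by simp
    finally show "form (d g) (br x e) *\<^sub>R \<beta> g (d e) = - (form e (br x (d g)) *\<^sub>R \<beta> g (d e))"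
      using form_sym[OF c inL(1)[OF e]] by simp
  qed
  also have "\<dots> = (\<Sum>g\<in>E. \<Sum>e\<in>E. - (form e (br x (d g)) *\<^sub>R \<beta> g (d e)))" by (rule sum.swap)
  also have "\<dots> = - (\<Sum>g\<in>E. \<beta> g (br x (d g)))"
  proof -
    have "\<beta> g (br x (d g)) = (\<Sum>e\<in>E. form e (br x (d g)) *\<^sub>R \<beta> g (d e))" if "g \<in> E" for g
    proof -
      have "\<beta> g (br x (d g)) = \<beta> g (\<Sum>e\<in>E. form e (br x (d g)) *\<^sub>R d e)"
        using exp(2)[OF J'(3)[OF x dJ(2)[OF that]]] by simp
      then show ?thesis by (simp add: linear_sum[OF bilinear_linear_right[OF \<beta>]] bilinear_rmul[OF \<beta>])
    qed
    then show ?thesis by (simp add: sum_negf)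
  qed
  finally show ?thesis by (simp add: sum.distrib)
qed

text \<open>Only invariance of \<open>E\<close> and \<open>d\<close> is recorded, not duality for a
  form. Thus a pair that is dual for the trace form of one module also gives a Casimir operator on
  its submodules, whose own trace forms differ.\<close>

locale casimir = lie_module L br V act
  for L :: "'a::real_vector set" and br and V :: "'b::real_vector set" and act +
  fixes E :: "'a set" and d :: "'a \<Rightarrow> 'a"
  assumes E_L: "\<And>e. e \<in> E \<Longrightarrow> e \<in> L" and d_L: "\<And>e. e \<in> E \<Longrightarrow> d e \<in> L"
    and invariant: "\<And>(\<beta> :: 'a \<Rightarrow> 'a \<Rightarrow> 'b) x. bilinear \<beta> \<Longrightarrow> x \<in> L \<Longrightarrow>
      (\<Sum>e\<in>E. \<beta> (br x e) (d e) + \<beta> e (br x (d e))) = 0"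
begin

definition \<Omega> :: "'b \<Rightarrow> 'b" where
  "\<Omega> v = (\<Sum>e\<in>E. act e (act (d e) v))"

lemma linear_\<Omega>: "linear \<Omega>"
  unfolding \<Omega>_def using linear_compose[OF linear_act linear_act]
  by (intro linear_compose_sum) (simp add: o_def)

lemma \<Omega>_closed: "v \<in> V \<Longrightarrow> \<Omega> v \<in> V"
  unfolding \<Omega>_def by (intro subspace_sum subspace_V act_closed E_L d_L)

text \<open>The commutator of x with \<Omega> is the invariant tensor evaluated on the bilinear map
  taking u, w to u w v.\<close>

lemma \<Omega>_commutes:
  assumes x: "x \<in> L" and v: "v \<in> V"
  shows "\<Omega> (act x v) = act x (\<Omega> v)"
proof -
  have "bilinear (\<lambda>u w. act u (act w v))"
    by (rule bilinearI) (simp_all add: act_simps)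
  from invariant[OF this x]
  have 0: "(\<Sum>e\<in>E. act (br x e) (act (d e) v) + act e (act (br x (d e)) v)) = 0" .
  have "act x (\<Omega> v) - \<Omega> (act x v)
      = (\<Sum>e\<in>E. act x (act e (act (d e) v)) - act e (act (d e) (act x v)))"
    by (simp add: \<Omega>_def linear_sum[OF linear_act] sum_subtractf)
  also have "\<dots> = (\<Sum>e\<in>E. act (br x e) (act (d e) v) + act e (act (br x (d e)) v))"
    using x v by (intro sum.cong refl) (simp add: act_br act_closed E_L d_L act_simps)
  finally show ?thesis using 0 by simp
qed

text \<open>Contracting the cocycle identity at (d e, x, y) with e and summing expresses \<Omega> f
  as the coboundary of \<phi>, up to commuting e past x and y. These error terms pair with the terms
  f [x, d e] y and f [y, d e] x into sums that vanish by invariance.\<close>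

lemma homotopy:
  assumes f: "two_cocycle L br V act f" and x: "x \<in> L" and y: "y \<in> L"
  defines "\<phi> \<equiv> \<lambda>z. \<Sum>e\<in>E. act e (f (d e) z)"
  shows "\<Omega> (f x y) = act x (\<phi> y) - act y (\<phi> x) - \<phi> (br x y)"
proof -
  have bf: "bilinear f" and fV: "\<And>x y. x \<in> L \<Longrightarrow> y \<in> L \<Longrightarrow> f x y \<in> V" 
    and coc: "\<And>x y z. x \<in> L \<Longrightarrow> y \<in> L \<Longrightarrow> z \<in> L \<Longrightarrow>
      act x (f y z) - act y (f x z) + act z (f x y) - f (br x y) z + f (br x z) y - f (br y z) x = 0"
    using f by (simp_all add: two_cocycle_def)
  note f_simps = bilinear_simps[OF bf]
  have bil: "bilinear (\<lambda>u w. act u (f w z))" for z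
    by (rule bilinearI) (simp_all add: act_simps f_simps)
  have summand: "act e (act (d e) (f x y))
      = act x (act e (f (d e) y)) - act y (act e (f (d e) x)) - act e (f (d e) (br x y))
        - (act (br x e) (f (d e) y) + act e (f (br x (d e)) y))
        + (act (br y e) (f (d e) x) + act e (f (br y (d e)) x))" if e: "e \<in> E" for e
  proof -
    have eL: "e \<in> L" "d e \<in> L" using E_L d_L e by auto
    have s: "br (d e) x = - br x (d e)" "br (d e) y = - br y (d e)"
      using br_skew[OF x eL(2)] br_skew[OF y eL(2)] by simp_all
    have "f (br x y) (d e) = - f (d e) (br x y)"
      using two_cocycle_skew[OF f subspace_L eL(2) br_closed[OF x y]] .
    then have "act (d e) (f x y) = act x (f (d e) y) - act y (f (d e) x)
        + f (br (d e) x) y - f (br (d e) y) x + f (br x y) (d e)"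
      using coc[OF eL(2) x y] by (simp add: algebra_simps)
    also have "\<dots> = act x (f (d e) y) - act y (f (d e) x)
        - f (br x (d e)) y + f (br y (d e)) x - f (d e) (br x y)"
      using \<open>f (br x y) (d e) = _\<close> by (simp add: s f_simps)
    finally have 1: "act (d e) (f x y) = act x (f (d e) y) - act y (f (d e) x)
        - f (br x (d e)) y + f (br y (d e)) x - f (d e) (br x y)" .
    have 2: "act e (act z (f (d e) w)) = act z (act e (f (d e) w)) - act (br z e) (f (d e) w)"
      if "z \<in> L" "w \<in> L" for z w
      using act_br[OF that(1) eL(1) fV[OF eL(2) that(2)]] by simp
    show ?thesis unfolding 1 by (simp add: act_simps 2 x y)
  qed
  have "\<Omega> (f x y) = act x (\<phi> y) - act y (\<phi> x) - \<phi> (br x y)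
        - (\<Sum>e\<in>E. act (br x e) (f (d e) y) + act e (f (br x (d e)) y))
        + (\<Sum>e\<in>E. act (br y e) (f (d e) x) + act e (f (br y (d e)) x))"
    unfolding \<Omega>_def \<phi>_def linear_sum[OF linear_act] using summand
    by (simp only: sum.distrib sum_subtractf cong: sum.cong)
  then show ?thesis using invariant[OF bil x] invariant[OF bil y] by simp
qed

end

section \<open>Vanishing of the second cohomology\<close>

context semisimple_lie
begin

text \<open>A real coordinate F of f has the form F x y = \<kappa> (D x) y, where \<kappa> is the
  Killing form. The cocycle identity says that D is a derivation, so D = ad c for some c, and F x y
  = \<kappa> c [x,y] depends on the bracket alone.\<close>

lemma trivial_second_cohomology:
  fixes V :: "'b::real_vector set"
  assumes V: "findim V" and f: "bilinear f" "\<And>x y. x \<in> L \<Longrightarrow> y \<in> L \<Longrightarrow> f x y \<in> V"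
    and coc: "\<And>x y z. x \<in> L \<Longrightarrow> y \<in> L \<Longrightarrow> z \<in> L \<Longrightarrow> f (br x y) z - f (br x z) y + f (br y z) x = 0"
    and skew: "\<And>x y. x \<in> L \<Longrightarrow> y \<in> L \<Longrightarrow> f y x = - f x y"
  obtains \<phi> where "linear \<phi>" "\<And>x. \<phi> x \<in> V" "\<And>x y. x \<in> L \<Longrightarrow> y \<in> L \<Longrightarrow> f x y = - \<phi> (br x y)"
proof -
  obtain B where B: "finite B" "independent B" "span B = V"
    using findim_basis[OF V] by metis
  have "\<exists>g :: 'b \<Rightarrow> real. linear g \<and> (\<forall>b'\<in>B. g b' = (if b' = b then 1 else 0))" for b
    by (rule linear_independent_extend[OF B(2)])
  then obtain \<psi> :: "'b \<Rightarrow> 'b \<Rightarrow> real" where \<psi>: "\<And>b. linear (\<psi> b)"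
    "\<And>b b'. b' \<in> B \<Longrightarrow> \<psi> b b' = (if b' = b then 1 else 0)" by metis
  have coords: "(\<Sum>b\<in>B. \<psi> b v *\<^sub>R b) = v" if "v \<in> V" for v
  proof -
    have "subspace {v. (\<Sum>b\<in>B. \<psi> b v *\<^sub>R b) = v}"
      by (rule subspaceI) (simp_all add: linear_0[OF \<psi>(1)] linear_add[OF \<psi>(1)] linear_scale[OF \<psi>(1)]
        scaleR_add_left sum.distrib flip: scaleR_sum_right scaleR_scaleR)
    moreover have "B \<subseteq> {v. (\<Sum>b\<in>B. \<psi> b v *\<^sub>R b) = v}"
    proof
      fix b' assume b': "b' \<in> B"
      have "(\<Sum>b\<in>B. \<psi> b b' *\<^sub>R b) = (\<Sum>b\<in>B. if b = b' then b else 0)"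
        using b' by (intro sum.cong refl) (auto simp: \<psi>(2))
      then show "b' \<in> {v. (\<Sum>b\<in>B. \<psi> b v *\<^sub>R b) = v}" using B(1) b' by simp
    qed
    ultimately have "span B \<subseteq> {v. (\<Sum>b\<in>B. \<psi> b v *\<^sub>R b) = v}" by (rule span_minimal[rotated])
    then show ?thesis using that B(3) by blast
  qed
  obtain E d where E: "\<And>e. e \<in> E \<Longrightarrow> d e \<in> L" "\<And>x. x \<in> L \<Longrightarrow> x = (\<Sum>e\<in>E. ad.form (d e) x *\<^sub>R e)"
    by (rule killing_dual_basis) (rule that; assumption)
  note f_simps = bilinear_simps[OF f(1)]
  have "\<exists>c\<in>L. \<forall>x\<in>L. \<forall>y\<in>L. \<psi> b (f x y) = ad.form c (br x y)" for b
  proof -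
    define F where "F x y = \<psi> b (f x y)" for x y
    have bF: "bilinear F"
      unfolding F_def by (rule bilinearI) (simp_all add: f_simps linear_add[OF \<psi>(1)] linear_scale[OF \<psi>(1)])
    have F_coc: "F (br x y) z - F (br x z) y + F (br y z) x = 0" if "x \<in> L" "y \<in> L" "z \<in> L" for x y z
    proof -
      have "\<psi> b (f (br x y) z - f (br x z) y + f (br y z) x) = 0" using coc[OF that] linear_0[OF \<psi>(1)] by simp
      then show ?thesis by (simp add: F_def linear_add[OF \<psi>(1)] linear_diff[OF \<psi>(1)])
    qed
    have F_skew: "F y x = - F x y" if "x \<in> L" "y \<in> L" for x y
      using skew[OF that] by (simp add: F_def linear_neg[OF \<psi>(1)])
    define D where "D x = (\<Sum>e\<in>E. F x e *\<^sub>R d e)" for x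
    have lD: "linear D"
      unfolding D_def by (rule linearI) (simp_all add: bilinear_simps[OF bF] scaleR_add_left sum.distrib scaleR_sum_right)
    have DL: "D x \<in> L" for x unfolding D_def using E(1) by (intro subspace_sum ad.subspace_L subspace_scale)
    have KD: "ad.form (D x) y = F x y" if "y \<in> L" for x y
    proof -
      have "F x y = F x (\<Sum>e\<in>E. ad.form (d e) y *\<^sub>R e)" using E(2)[OF that] by simp
      also have "\<dots> = (\<Sum>e\<in>E. F x e * ad.form (d e) y)"
        by (simp add: linear_sum[OF bilinear_linear_right[OF bF]] bilinear_simps[OF bF] mult.commute)
      finally show ?thesis unfolding D_def using ad.form_sum[OF E(1) that] by simp
    qed
    have leib: "D (br x y) = br (D x) y + br x (D y)" if x: "x \<in> L" and y: "y \<in> L" for x y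
    proof -
      let ?r = "D (br x y) - (br (D x) y + br x (D y))"
      have rL: "br (D x) y \<in> L" "br x (D y) \<in> L" "br (D y) x \<in> L" using x y DL ad.br_closed by auto
      have "ad.form ?r z = 0" if z: "z \<in> L" for z
      proof -
        have "ad.form ?r z = ad.form (D (br x y) + (-1) *\<^sub>R br (D x) y + br (D y) x) z"
          using ad.br_skew[OF x DL, of y] by (simp add: algebra_simps)
        also have "\<dots> = ad.form (D (br x y)) z - ad.form (br (D x) y) z + ad.form (br (D y) x) z"
          using z rL DL subspace_scale[OF ad.subspace_L rL(1), of "-1"] subspace_diff[OF ad.subspace_L DL rL(1)]
            ad.form_add[of "D (br x y)" "- br (D x) y" z] ad.form_scale[OF rL(1) z, of "-1"]
          by (simp add: ad.form_add)
        also have "\<dots> = F (br x y) z - F x (br y z) + F y (br x z)"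
          using x y z DL by (simp add: ad.form_invariant KD ad.br_closed)
        also have "\<dots> = F (br x y) z - F (br x z) y + F (br y z) x"
          using F_skew[OF x ad.br_closed[OF y z]] F_skew[OF y ad.br_closed[OF x z]] by simp
        finally show ?thesis using F_coc[OF x y z] by simp
      qed
      moreover have "?r \<in> L" using rL DL ad.subspace_L by (simp add: subspace_add subspace_diff)
      ultimately have "?r = 0" using killing_nondegenerate by blast
      then show ?thesis by simp
    qed
    obtain c where c: "c \<in> L" "\<And>x. x \<in> L \<Longrightarrow> D x = br c x"
      using derivation_inner[OF lD DL leib] by metis
    have "\<psi> b (f x y) = ad.form c (br x y)" if "x \<in> L" "y \<in> L" for x y
      using KD[OF that(2), of x] c(2)[OF that(1)] ad.form_invariant[OF c(1) that] by (simp add: F_def)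
    then show ?thesis using c(1) by blast
  qed
  then obtain c where c: "\<And>b. c b \<in> L" "\<And>b x y. x \<in> L \<Longrightarrow> y \<in> L \<Longrightarrow> \<psi> b (f x y) = ad.form (c b) (br x y)"
    by metis
  obtain p where p: "linear p" "\<And>x. p x \<in> L" "\<And>x. x \<in> L \<Longrightarrow> p x = x"
    by (rule projection_exists[OF ad.subspace_L subspace_single_0]) (auto intro: that)
  \<comment> \<open>The minus sign matches a coboundary for the zero action, and \<open>p\<close>
    makes \<phi> linear on the whole type.\<close>
  define \<phi> where "\<phi> x = (\<Sum>b\<in>B. - ad.form (c b) (p x) *\<^sub>R b)" for x
  show ?thesis
  proof (rule that[of \<phi>])
    show "linear \<phi>"
      by (rule linearI) (simp_all add: \<phi>_def linear_add[OF p(1)] linear_scale[OF p(1)]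
        ad.form_add_right ad.form_scale_right c(1) p(2) scaleR_diff_left sum.distrib sum_subtractf
        sum_negf scaleR_sum_right algebra_simps)
    show "\<phi> x \<in> V" for x
      unfolding \<phi>_def B(3)[symmetric] by (intro span_sum span_scale span_base)
    show "f x y = - \<phi> (br x y)" if "x \<in> L" "y \<in> L" for x y
      using coords[OF f(2)[OF that]] that
      by (simp add: \<phi>_def c(2) p(3) ad.br_closed sum_negf)
  qed
qed

text \<open>The Casimir operator splits the module by Fitting's lemma: where it is invertible it is
  homotopic to zero, and the other part is smaller.\<close>

lemma second_cohomology:
  fixes V :: "'a set"
  assumes "lie_module L br V act" and "two_cocycle L br V act f"
  shows "\<exists>\<phi>. linear \<phi> \<and> (\<forall>x\<in>L. \<phi> x \<in> V) \<and>
    (\<forall>x\<in>L. \<forall>y\<in>L. f x y = act x (\<phi> y) - act y (\<phi> x) - \<phi> (br x y))"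
  using assms
proof (induction "dim V" arbitrary: V f rule: less_induct)
  case less
  interpret M: lie_module L br V act by fact
  note coc = less.prems(2)
  have bf: "bilinear f" and fV: "\<And>x y. x \<in> L \<Longrightarrow> y \<in> L \<Longrightarrow> f x y \<in> V"
    and feq: "\<And>x y z. x \<in> L \<Longrightarrow> y \<in> L \<Longrightarrow> z \<in> L \<Longrightarrow>
      act x (f y z) - act y (f x z) + act z (f x y) - f (br x y) z + f (br x z) y - f (br y z) x = 0"
    and falt: "\<And>x. x \<in> L \<Longrightarrow> f x x = 0"
    using coc by (simp_all add: two_cocycle_def)
  let ?k = "{x \<in> L. \<forall>v\<in>V. act x v = 0}"
  show ?case
  proof (cases "?k = L")
    case True
    then have act0: "act x v = 0" if "x \<in> L" "v \<in> V" for x v using that by blast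
    obtain \<phi> where \<phi>: "linear \<phi>" "\<And>x. \<phi> x \<in> V" "\<And>x y. x \<in> L \<Longrightarrow> y \<in> L \<Longrightarrow> f x y = - \<phi> (br x y)"
    proof (rule trivial_second_cohomology[OF M.findim_V bf fV])
      show "f (br x y) z - f (br x z) y + f (br y z) x = 0" if "x \<in> L" "y \<in> L" "z \<in> L" for x y z
        using feq[OF that] by (simp add: act0 that fV algebra_simps)
      show "f y x = - f x y" if "x \<in> L" "y \<in> L" for x y
        using two_cocycle_skew[OF coc M.subspace_L that] .
    qed (assumption | rule that; assumption)+
    then show ?thesis by (intro exI[of _ \<phi>]) (simp add: act0)
  next
    case False
    \<comment> \<open>The Killing-orthogonal complement of the kernel acts faithfully: on its
      intersection with the kernel the Killing form vanishes. The Casimir operator is built from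
      this ideal, where the trace form of \<open>V\<close> is nondegenerate.\<close>
    let ?J = "{x \<in> L. \<forall>y\<in>?k. ad.form x y = 0}"
    have kI: "lie_ideal L br ?k" by (rule M.kernel_ideal)
    have JI: "lie_ideal L br ?J" by (rule ad.form_perp_ideal[OF kI])
    note J' = ad.ideal_closed[OF JI]
    have fJ: "findim ?J" using findim_sub[OF M.findim_L J'(1,2)] .
    have Jk: "?J \<inter> ?k = {0}"
      by (rule ideal_trivial_of_killing_zero[OF ad.ideal_Int[OF JI kI]]) blast
    obtain a where a: "a \<in> L" "a \<notin> ?k" using False by blast
    have a0: "a \<noteq> 0" using a subspace_0[OF ad.ideal_closed(1)[OF kI]] by blast
    have "span {a} \<inter> ?k \<subseteq> {0}"
    proof
      fix u assume u: "u \<in> span {a} \<inter> ?k"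
      then obtain r where r: "u = r *\<^sub>R a" by (auto simp: span_singleton)
      have "r = 0"
      proof (rule ccontr)
        assume "r \<noteq> 0"
        then have "a = inverse r *\<^sub>R u" using r by simp
        then show False using a(2) u subspace_scale[OF ad.ideal_closed(1)[OF kI], of u "inverse r"] by blast
      qed
      then show "u \<in> {0}" using r by simp
    qed
    then obtain p where p: "linear p" "\<And>x. p x \<in> span {a}" "\<And>x. x \<in> span {a} \<Longrightarrow> p x = x"
      "\<And>x. x \<in> ?k \<Longrightarrow> p x = 0"
      by (rule projection_exists[OF subspace_span ad.ideal_closed(1)[OF kI]]) (assumption | rule that; assumption)+
    \<comment> \<open>The composite h p vanishes on the kernel and is 1 at a. Its Killing
      representative j is therefore a nonzero element of \<open>?J\<close>.\<close>
    obtain h :: "'a \<Rightarrow> real" where h: "linear h" "h a = 1"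
      using linear_independent_extend[of "{a}" "\<lambda>_. 1 :: real"] a0 by auto
    have lhp: "linear (\<lambda>x. h (p x))" using linear_compose[OF p(1) h(1)] by (simp add: o_def)
    obtain j where j: "j \<in> L" "\<And>x. x \<in> L \<Longrightarrow> ad.form j x = h (p x)"
      using killing_represents[OF lhp] by blast
    have "j \<in> ?J" using j p(4) linear_0[OF h(1)] by auto
    moreover have "j \<noteq> 0" using j(2)[OF a(1)] p(3)[of a] h(2) ad.form_zero(1)[OF a(1)] by (auto simp: span_base)
    ultimately have "?J \<noteq> {0}" by blast
    then have dimJ: "dim ?J \<noteq> 0" using findim_dim_0[OF fJ] by blast
    have nondeg: "x = 0" if x: "x \<in> ?J" "\<And>y. y \<in> ?J \<Longrightarrow> M.form x y = 0" for x
    proof -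
      have "?J \<inter> {x \<in> L. \<forall>y\<in>?J. M.form x y = 0} = {0}"
      proof (rule ideal_trivial_of_form_zero[OF M.lie_module_axioms ss])
        show "lie_ideal L br (?J \<inter> {x \<in> L. \<forall>y\<in>?J. M.form x y = 0})"
          by (rule M.ideal_Int[OF JI M.form_perp_ideal[OF JI]])
        fix x assume x: "x \<in> ?J \<inter> {x \<in> L. \<forall>y\<in>?J. M.form x y = 0}"
        { fix y assume "y \<in> ?J \<inter> {x \<in> L. \<forall>y\<in>?J. M.form x y = 0}"
          then show "M.form x y = 0" using x by blast }
        { assume "\<And>v. v \<in> V \<Longrightarrow> act x v = 0"
          then have "x \<in> ?J \<inter> ?k" using x by blast
          then show "x = 0" using Jk by blast }
      qed
      then show ?thesis using that J'(2) by blast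
    qed
    have JL: "x \<in> L" if "x \<in> ?J" for x using that by blast
    obtain E d where E: "finite E" "card E = dim ?J" "\<And>e. e \<in> E \<Longrightarrow> e \<in> ?J" "\<And>e. e \<in> E \<Longrightarrow> d e \<in> ?J"
      "\<And>e. e \<in> E \<Longrightarrow> M.form (d e) e = 1"
      "\<And>x. x \<in> ?J \<Longrightarrow> x = (\<Sum>e\<in>E. M.form (d e) x *\<^sub>R e)"
      "\<And>x. x \<in> ?J \<Longrightarrow> x = (\<Sum>e\<in>E. M.form e x *\<^sub>R d e)"
      by (rule dual_basis[OF fJ M.form_sym[OF JL JL] M.form_add[OF JL JL JL] M.form_scale[OF JL JL] nondeg])
        (assumption | rule that; assumption)+
    have EL: "e \<in> L" "d e \<in> L" if "e \<in> E" for e using JL E(3,4) that by blast+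
    have inv: "(\<Sum>e\<in>E. \<beta> (br x e) (d e) + \<beta> e (br x (d e))) = 0"
      if "bilinear \<beta>" "x \<in> L" for \<beta> :: "'a \<Rightarrow> 'a \<Rightarrow> 'a" and x
      by (rule M.dual_basis_invariant[OF JI E(3,4,6,7) that])
    interpret C: casimir L br V act E d
      by unfold_locales (use EL inv in auto)
    \<comment> \<open>The trace of the Casimir operator is dim J, which is nonzero, so it is not
      nilpotent and the Fitting summand \<open>V0\<close> is proper.\<close>
    have "tr V C.\<Omega> = (\<Sum>e\<in>E. M.form e (d e))"
      unfolding C.\<Omega>_def M.form_def using EL M.act_closed by (intro tr_sum M.findim_V) simp
    also have "\<dots> = (\<Sum>e\<in>E. 1)" using E(5) M.form_sym[OF EL] by (intro sum.cong refl) simp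
    finally have tr\<Omega>: "tr V C.\<Omega> \<noteq> 0" using dimJ E(2) by simp
    obtain n V0 V1 q where V0: "V0 = {v \<in> V. (C.\<Omega> ^^ n) v = 0}" and V1: "V1 = (C.\<Omega> ^^ n) ` V"
      and s0: "subspace V0" "V0 \<subseteq> V" and s1: "subspace V1" "V1 \<subseteq> V"
      and \<Omega>0: "\<And>v. v \<in> V0 \<Longrightarrow> C.\<Omega> v \<in> V0" and \<Omega>1: "\<And>v. v \<in> V1 \<Longrightarrow> C.\<Omega> v \<in> V1" and V01: "V0 \<inter> V1 = {0}"
      and inj: "\<And>v. v \<in> V1 \<Longrightarrow> C.\<Omega> v = 0 \<Longrightarrow> v = 0"
      and q: "linear q" "\<And>v. q v \<in> V0" "\<And>v. v \<in> V0 \<Longrightarrow> q v = v" "\<And>v. v \<in> V1 \<Longrightarrow> q v = 0"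
      "\<And>v. v \<in> V \<Longrightarrow> v - q v \<in> V1"
      by (rule fitting_decomposition[OF C.linear_\<Omega> M.findim_V C.\<Omega>_closed]) (assumption | rule that; assumption)+
    have "V0 \<noteq> V"
    proof
      assume "V0 = V"
      then have "tr V C.\<Omega> = 0"
        using V0 by (intro tr_nilpotent[OF M.findim_V C.linear_\<Omega> C.\<Omega>_closed, of n]) auto
      then show False using tr\<Omega> by simp
    qed
    then have dim0: "dim V0 < dim V" using findim_dim_less[OF M.findim_V s0] by blast
    have \<Omega>n: "(C.\<Omega> ^^ i) (act x v) = act x ((C.\<Omega> ^^ i) v)" if "x \<in> L" "v \<in> V" for i x v
    proof (induction i)
      case (Suc i)
      have "(C.\<Omega> ^^ i) v \<in> V" by (rule funpow_closed[OF C.\<Omega>_closed that(2)])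
      then show ?case using Suc C.\<Omega>_commutes[OF that(1)] by simp
    qed simp
    have act0: "act x v \<in> V0" if "x \<in> L" "v \<in> V0" for x v
      using that M.act_closed by (simp add: V0 \<Omega>n M.act_simps)
    have act1: "act x v \<in> V1" if xv: "x \<in> L" "v \<in> V1" for x v
    proof -
      obtain u where u: "u \<in> V" "v = (C.\<Omega> ^^ n) u" using xv(2) by (auto simp: V1)
      then have "act x v = (C.\<Omega> ^^ n) (act x u)" using \<Omega>n[OF xv(1)] by simp
      then show ?thesis unfolding V1 using M.act_closed[OF xv(1) u(1)] by blast
    qed
    interpret M0: lie_module L br V0 act using s0 act0 by (rule M.restrict_module)
    interpret M1: lie_module L br V1 act using s1 act1 by (rule M.restrict_module)
    \<comment> \<open>The same pair \<open>E\<close>, \<open>d\<close>, now acting on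
      \<open>V1\<close>.\<close>
    interpret C1: casimir L br V1 act E d
      by unfold_locales (use EL inv in auto)
    have q_act: "q (act x v) = act x (q v)" if "x \<in> L" "v \<in> V" for x v
    proof -
      have "act x v = act x (q v) + act x (v - q v)" by (simp add: M.act_simps)
      then have "q (act x v) = q (act x (q v)) + q (act x (v - q v))" by (metis linear_add[OF q(1)])
      then show ?thesis using q(3)[OF act0[OF that(1) q(2)]] q(4)[OF act1[OF that(1) q(5)[OF that(2)]]] by simp
    qed
    \<comment> \<open>The projection \<open>q\<close> commutes with the action, so both components
      of f are cocycles.\<close>
    let ?f0 = "\<lambda>x y. q (f x y)" and ?f1 = "\<lambda>x y. f x y - q (f x y)"
    note f_simps = bilinear_simps[OF bf]
    note q_simps = linear_add[OF q(1)] linear_diff[OF q(1)] linear_scale[OF q(1)] linear_0[OF q(1)]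
    have feq0: "act x (?f0 y z) - act y (?f0 x z) + act z (?f0 x y)
        - ?f0 (br x y) z + ?f0 (br x z) y - ?f0 (br y z) x = 0" if xyz: "x \<in> L" "y \<in> L" "z \<in> L" for x y z
    proof -
      have "q (act x (f y z) - act y (f x z) + act z (f x y)
        - f (br x y) z + f (br x z) y - f (br y z) x) = 0" using feq[OF xyz] q_simps(4) by simp
      then show ?thesis using xyz by (simp add: q_simps q_act fV)
    qed
    have coc0: "two_cocycle L br V0 act ?f0"
      unfolding two_cocycle_def
    proof (intro conjI ballI)
      show "bilinear ?f0" by (rule bilinearI) (simp_all add: f_simps q_simps)
    qed (use q(2) falt q_simps(4) feq0 in simp_all)
    have coc1: "two_cocycle L br V1 act ?f1"
      unfolding two_cocycle_def
    proof (intro conjI ballI)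
      show "bilinear ?f1" by (rule bilinearI) (simp_all add: f_simps q_simps algebra_simps)
      fix x y z assume xyz: "x \<in> L" "y \<in> L" "z \<in> L"
      show "act x (?f1 y z) - act y (?f1 x z) + act z (?f1 x y)
          - ?f1 (br x y) z + ?f1 (br x z) y - ?f1 (br y z) x = 0"
        using feq[OF xyz] feq0[OF xyz] by (simp add: M.act_simps algebra_simps)
    qed (use q(5) fV falt q_simps(4) in simp_all)
    obtain \<phi>0 where \<phi>0: "linear \<phi>0" "\<forall>x\<in>L. \<phi>0 x \<in> V0"
      "\<forall>x\<in>L. \<forall>y\<in>L. q (f x y) = act x (\<phi>0 y) - act y (\<phi>0 x) - \<phi>0 (br x y)"
      using less.hyps[OF dim0 M0.lie_module_axioms coc0] by blast
    define \<phi>1 where "\<phi>1 z = (\<Sum>e\<in>E. act e (?f1 (d e) z))" for z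
    have l\<phi>1: "linear \<phi>1"
      unfolding \<phi>1_def by (rule linearI) (simp_all add: f_simps q_simps M.act_simps sum.distrib sum_subtractf
        scaleR_sum_right algebra_simps)
    have \<phi>1V: "\<phi>1 x \<in> V1" if "x \<in> L" for x
      unfolding \<phi>1_def using EL act1 q(5) fV that by (intro subspace_sum s1(1)) simp
    have hom: "C.\<Omega> (?f1 x y) = act x (\<phi>1 y) - act y (\<phi>1 x) - \<phi>1 (br x y)" if "x \<in> L" "y \<in> L" for x y
      by (rule C1.homotopy[OF coc1 that, folded \<phi>1_def])
    have inj1: "inj_on C.\<Omega> V1"
    proof (rule inj_onI)
      fix u v assume "u \<in> V1" "v \<in> V1" "C.\<Omega> u = C.\<Omega> v"
      then have "u - v = 0" using inj[of "u - v"] subspace_diff[OF s1(1)] by (simp add: linear_diff[OF C.linear_\<Omega>])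
      then show "u = v" by simp
    qed
    \<comment> \<open>The inverse of \<Omega> on \<open>V1\<close>. It commutes with the action, so
      applying it to the homotopy formula exhibits \<open>?f1\<close> as the coboundary of S
      \<phi>1.\<close>
    obtain S where S: "linear S" "range S \<subseteq> V1" "\<And>v. v \<in> V1 \<Longrightarrow> S (C.\<Omega> v) = v"
      using linear_exists_left_inverse_on[OF C.linear_\<Omega> s1(1) inj1] by blast
    have surj: "\<exists>w\<in>V1. u = C.\<Omega> w" if "u \<in> V1" for u
      using inj_endo_surj[OF M1.findim_V C.linear_\<Omega> \<Omega>1 inj1] that by blast
    have S_act: "S (act x u) = act x (S u)" if xu: "x \<in> L" "u \<in> V1" for x u
    proof -
      obtain w where w: "w \<in> V1" "u = C.\<Omega> w" using surj[OF xu(2)] by blast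
      have "act x u = C.\<Omega> (act x w)" using C.\<Omega>_commutes[OF xu(1)] w s1(2) by auto
      then show ?thesis using S(3)[OF act1[OF xu(1) w(1)]] S(3)[OF w(1)] w(2) by simp
    qed
    have f1: "?f1 x y = act x (S (\<phi>1 y)) - act y (S (\<phi>1 x)) - S (\<phi>1 (br x y))" if "x \<in> L" "y \<in> L" for x y
    proof -
      have "?f1 x y = S (C.\<Omega> (?f1 x y))" using S(3)[OF q(5)[OF fV[OF that]]] by simp
      also have "\<dots> = S (act x (\<phi>1 y) - act y (\<phi>1 x) - \<phi>1 (br x y))" by (simp only: hom[OF that])
      also have "\<dots> = act x (S (\<phi>1 y)) - act y (S (\<phi>1 x)) - S (\<phi>1 (br x y))"
        using that by (simp add: linear_diff[OF S(1)] S_act \<phi>1V)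
      finally show ?thesis .
    qed
    show ?thesis
    proof (intro exI[of _ "\<lambda>x. \<phi>0 x + S (\<phi>1 x)"] conjI ballI)
      show "linear (\<lambda>x. \<phi>0 x + S (\<phi>1 x))"
        using \<phi>0(1) linear_compose[OF l\<phi>1 S(1)] by (intro linear_compose_add) (simp_all add: o_def)
      show "\<phi>0 x + S (\<phi>1 x) \<in> V" if "x \<in> L" for x
        using \<phi>0(2) S(2) s0(2) s1(2) that by (intro subspace_add[OF M.subspace_V]) auto
      fix x y assume xy: "x \<in> L" "y \<in> L"
      have "f x y = q (f x y) + ?f1 x y" by simp
      also have "\<dots> = (act x (\<phi>0 y) - act y (\<phi>0 x) - \<phi>0 (br x y))
          + (act x (S (\<phi>1 y)) - act y (S (\<phi>1 x)) - S (\<phi>1 (br x y)))"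
        using \<phi>0(3) xy f1[OF xy] by simp
      finally show "f x y = act x (\<phi>0 y + S (\<phi>1 y)) - act y (\<phi>0 x + S (\<phi>1 x))
          - (\<phi>0 (br x y) + S (\<phi>1 (br x y)))" by (simp add: M.act_simps algebra_simps)
    qed
  qed
qed

end

section \<open>Gradings\<close>

lemma subspace_subspace_sum:
  assumes "\<And>m. subspace (V m)"
  shows "subspace (subspace_sum V)"
proof (rule subspaceI)
  show "0 \<in> subspace_sum V" unfolding subspace_sum_def by (intro CollectI exI[of _ "{}"]) simp
  fix a assume "a \<in> subspace_sum V"
  then obtain M x where a: "finite M" "\<And>m. m \<in> M \<Longrightarrow> x m \<in> V m" "a = (\<Sum>m\<in>M. x m)"
    by (auto simp: subspace_sum_def)
  { fix b assume "b \<in> subspace_sum V"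
    then obtain M' x' where b: "finite M'" "\<And>m. m \<in> M' \<Longrightarrow> x' m \<in> V m" "b = (\<Sum>m\<in>M'. x' m)"
      by (auto simp: subspace_sum_def)
    let ?y = "\<lambda>m. (if m \<in> M then x m else 0) + (if m \<in> M' then x' m else 0)"
    have "a = (\<Sum>m\<in>M \<union> M'. if m \<in> M then x m else 0)"
      using a b(1) by (simp add: sum.inter_restrict[symmetric] Int_absorb1)
    moreover have "b = (\<Sum>m\<in>M \<union> M'. if m \<in> M' then x' m else 0)"
      using a(1) b by (simp add: sum.inter_restrict[symmetric] Int_absorb1)
    ultimately have "a + b = (\<Sum>m\<in>M \<union> M'. ?y m)" by (simp add: sum.distrib)
    moreover have "?y m \<in> V m" for m
      using a(2) b(2) assms by (intro subspace_add) (auto intro: subspace_0)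
    ultimately show "a + b \<in> subspace_sum V"
      unfolding subspace_sum_def using a(1) b(1) by (intro CollectI exI[of _ "M \<union> M'"] exI[of _ ?y]) simp }
  { fix c
    have "c *\<^sub>R a = (\<Sum>m\<in>M. c *\<^sub>R x m)" by (simp add: a(3) scaleR_sum_right)
    then show "c *\<^sub>R a \<in> subspace_sum V"
      unfolding subspace_sum_def using a(1,2) assms
      by (intro CollectI exI[of _ M] exI[of _ "\<lambda>m. c *\<^sub>R x m"]) (simp add: subspace_scale) }
qed

lemma subspace_sum_base: "x \<in> V m \<Longrightarrow> x \<in> subspace_sum V"
  unfolding subspace_sum_def by (intro CollectI exI[of _ "{m}"] exI[of _ "\<lambda>_. x"]) simp

lemma subspace_sum_subset: "subspace U \<Longrightarrow> (\<And>m. V m \<subseteq> U) \<Longrightarrow> subspace_sum V \<subseteq> U"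
  by (auto simp: subspace_sum_def intro!: subspace_sum)

text \<open>The grading is carried by its homogeneous projections, total linear maps; the finite set
  \<open>F\<close> contains every degree with a nonzero component, so sums over \<open>F\<close>
  recover elements.\<close>

locale graded_lie = lie_module g br g br
  for g :: "'a::real_vector set" and br +
  fixes G :: "'i::ab_group_add \<Rightarrow> 'a set" and F :: "'i set" and pr :: "'i \<Rightarrow> 'a \<Rightarrow> 'a"
  assumes finite_F: "finite F" and outside_F: "\<And>m. m \<notin> F \<Longrightarrow> G m = {0}"
    and G_g: "\<And>m. G m \<subseteq> g" and G_br: "\<And>x y m n. x \<in> G m \<Longrightarrow> y \<in> G n \<Longrightarrow> br x y \<in> G (m + n)"
    and linear_pr: "\<And>m. linear (pr m)" and pr_G: "\<And>m x. pr m x \<in> G m"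
    and pr_same: "\<And>m x. x \<in> G m \<Longrightarrow> pr m x = x"
    and pr_other: "\<And>m n x. x \<in> G n \<Longrightarrow> n \<noteq> m \<Longrightarrow> pr m x = 0"
    and sum_pr: "\<And>x. x \<in> g \<Longrightarrow> (\<Sum>m\<in>F. pr m x) = x"

lemma graded_lieI:
  assumes "lie_module g br g br" and gr: "lie_grading g br G"
  obtains F pr where "graded_lie g br G F pr"
proof -
  interpret lie_module g br g br by fact
  define F where "F = {m. G m \<noteq> {0}}"
  have sG: "subspace (G m)" and F: "finite F" and gG: "g = subspace_sum G"
    and dir: "direct_family G" and Gbr: "x \<in> G m \<Longrightarrow> y \<in> G n \<Longrightarrow> br x y \<in> G (m + n)" for m n x y
    using gr by (auto simp: lie_grading_def F_def)
  have "\<exists>p. linear p \<and> (\<forall>x. p x \<in> G m) \<and> (\<forall>x\<in>G m. p x = x) \<and> (\<forall>n x. x \<in> G n \<and> n \<noteq> m \<longrightarrow> p x = 0)" for m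
  proof -
    define V where "V n = (if n = m then {0} else G n)" for n
    have sV: "subspace (V n)" for n using sG by (simp add: V_def)
    have "G m \<inter> subspace_sum V \<subseteq> {0}"
    proof
      fix y assume y: "y \<in> G m \<inter> subspace_sum V"
      then obtain M x where x: "finite M" "\<And>n. n \<in> M \<Longrightarrow> x n \<in> V n" "y = (\<Sum>n\<in>M. x n)"
        by (auto simp: subspace_sum_def)
      \<comment> \<open>If y lies both in \<open>G m\<close> and in the sum of the other components,
        then -y in degree m is added to the other summands. Directness applied to this relation
        gives y = 0.\<close>
      let ?z = "\<lambda>n. if n = m then - y else x n"
      have "(\<Sum>n\<in>M. x n) = (\<Sum>n\<in>M - {m}. x n)"
        using x(1) x(2)[of m] by (intro sum.mono_neutral_right) (auto simp: V_def)
      then have "(\<Sum>n\<in>insert m (M - {m}). ?z n) = 0" using x(1,3) by (simp add: sum.insert_remove)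
      moreover have "?z n \<in> G n" if "n \<in> insert m (M - {m})" for n
        using that y x(2)[of n] sG[of n] by (auto simp: V_def subspace_neg)
      moreover have "finite (insert m (M - {m}))" using x(1) by simp
      ultimately have "\<forall>n\<in>insert m (M - {m}). ?z n = 0"
        using dir[unfolded direct_family_def, rule_format, of "insert m (M - {m})" ?z] by blast
      then show "y \<in> {0}" by simp
    qed
    then obtain p where p: "linear p" "\<And>x. p x \<in> G m" "\<And>x. x \<in> G m \<Longrightarrow> p x = x"
      "\<And>x. x \<in> subspace_sum V \<Longrightarrow> p x = 0"
      by (rule projection_exists[OF sG subspace_subspace_sum[OF sV]]) (assumption | rule that; assumption)+
    have "p x = 0" if "x \<in> G n \<and> n \<noteq> m" for n x
      using p(4) subspace_sum_base[of x V n] that by (simp add: V_def)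
    then show ?thesis using p(1-3) by (intro exI[of _ p] conjI allI ballI impI)
  qed
  then obtain pr where pr: "\<And>m. linear (pr m)" "\<And>m x. pr m x \<in> G m" "\<And>m x. x \<in> G m \<Longrightarrow> pr m x = x"
    "\<And>m n x. x \<in> G n \<Longrightarrow> n \<noteq> m \<Longrightarrow> pr m x = 0" by metis
  have G0: "G m = {0}" if "m \<notin> F" for m using that by (simp add: F_def)
  have "(\<Sum>m\<in>F. pr m x) = x" if "x \<in> g" for x
  proof -
    have "g \<subseteq> {x. (\<Sum>m\<in>F. pr m x) = x}"
      unfolding gG
    proof (rule subspace_sum_subset)
      show "subspace {x. (\<Sum>m\<in>F. pr m x) = x}"
        by (intro subspace_linear_eq linear_compose_sum) (auto simp: pr(1) intro!: linearI)
      show "G n \<subseteq> {x. (\<Sum>m\<in>F. pr m x) = x}" for n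
      proof
        fix x assume x: "x \<in> G n"
        have "(\<Sum>m\<in>F. pr m x) = (\<Sum>m\<in>F. if m = n then x else 0)"
          using x pr(3,4) by (intro sum.cong refl) auto
        also have "\<dots> = x" using F G0[of n] x by auto
        finally show "x \<in> {x. (\<Sum>m\<in>F. pr m x) = x}" by simp
      qed
    qed
    then show ?thesis using that by blast
  qed
  moreover have "G m \<subseteq> g" for m unfolding gG using subspace_sum_base[of _ G m] by (intro subsetI)
  ultimately have "graded_lie g br G F pr"
    by unfold_locales (use F G0 Gbr pr in \<open>auto simp: linear_add linear_scale\<close>)
  then show ?thesis by (rule that)
qed

context graded_lie
begin

lemma pr_g: "pr m x \<in> g"
  using pr_G G_g by blast

lemma pr_outside: "m \<notin> F \<Longrightarrow> pr m x = 0"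
  using pr_G[of m x] outside_F by simp

lemma pr_pr: "pr m (pr n x) = (if m = n then pr n x else 0)"
  using pr_same[OF pr_G] pr_other[OF pr_G] by auto

lemma pr_sum: "pr k (\<Sum>m\<in>F. pr m (f m)) = pr k (f k)"
proof -
  have "pr k (\<Sum>m\<in>F. pr m (f m)) = (\<Sum>m\<in>F. if m = k then pr k (f k) else 0)"
    unfolding linear_sum[OF linear_pr] by (intro sum.cong refl) (auto simp: pr_pr)
  also have "\<dots> = pr k (f k)" using finite_F pr_outside by simp
  finally show ?thesis .
qed

lemma pr_br:
  assumes "x \<in> G m" "y \<in> g"
  shows "pr (m + n) (br x y) = br x (pr n y)"
proof -
  have "br x y = (\<Sum>k\<in>F. br x (pr k y))"
    using sum_pr[OF assms(2)] by (metis linear_sum[OF linear_br])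
  then have "pr (m + n) (br x y) = (\<Sum>k\<in>F. pr (m + n) (br x (pr k y)))"
    by (simp add: linear_sum[OF linear_pr])
  also have "\<dots> = (\<Sum>k\<in>F. if k = n then br x (pr n y) else 0)"
  proof (intro sum.cong refl)
    fix k
    have "br x (pr k y) \<in> G (m + k)" using G_br[OF assms(1) pr_G] .
    then show "pr (m + n) (br x (pr k y)) = (if k = n then br x (pr n y) else 0)"
      using pr_same pr_other by auto
  qed
  also have "\<dots> = br x (pr n y)" using finite_F pr_outside[of n y] by (simp add: br_simps)
  finally show ?thesis .
qed

text \<open>Homogeneity as stability under the projections; \<open>graded_eq_sum\<close> links it to
  the sum of homogeneous parts.\<close>

definition graded :: "'a set \<Rightarrow> bool" where
  "graded U \<longleftrightarrow> subspace U \<and> U \<subseteq> g \<and> (\<forall>m. \<forall>x\<in>U. pr m x \<in> U)"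

lemma graded_eq_sum:
  assumes "graded U"
  shows "U = subspace_sum (\<lambda>m. U \<inter> G m)"
proof
  show "U \<subseteq> subspace_sum (\<lambda>m. U \<inter> G m)"
  proof
    fix x assume x: "x \<in> U"
    then have "x = (\<Sum>m\<in>F. pr m x)" using sum_pr assms by (auto simp: graded_def)
    then show "x \<in> subspace_sum (\<lambda>m. U \<inter> G m)"
      unfolding subspace_sum_def using finite_F x assms pr_G
      by (intro CollectI exI[of _ F] exI[of _ "\<lambda>m. pr m x"]) (auto simp: graded_def)
  qed
  show "subspace_sum (\<lambda>m. U \<inter> G m) \<subseteq> U"
    using assms by (intro subspace_sum_subset) (auto simp: graded_def)
qed

text \<open>The block-diagonal part of \<open>T\<close> with respect to the grading.\<close>

definition degree_zero :: "('a \<Rightarrow> 'a) \<Rightarrow> 'a \<Rightarrow> 'a" where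
  "degree_zero T x = (\<Sum>m\<in>F. pr m (T (pr m x)))"

lemma linear_degree_zero:
  assumes "linear T"
  shows "linear (degree_zero T)"
proof -
  have "linear (\<lambda>x. pr m (T (pr m x)))" for m
    using linear_compose[OF linear_compose[OF linear_pr assms] linear_pr] by (simp add: o_def)
  then show ?thesis unfolding degree_zero_def[abs_def] by (intro linear_compose_sum) blast
qed

lemma pr_degree_zero:
  assumes "linear T"
  shows "pr k (degree_zero T x) = pr k (T (pr k x))" "degree_zero T (pr k x) = pr k (T (pr k x))"
proof -
  show "pr k (degree_zero T x) = pr k (T (pr k x))" unfolding degree_zero_def by (rule pr_sum)
  have "degree_zero T (pr k x) = (\<Sum>m\<in>F. if m = k then pr k (T (pr k x)) else 0)"
    unfolding degree_zero_def using linear_0[OF assms] linear_0[OF linear_pr] by (intro sum.cong refl) (auto simp: pr_pr)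
  also have "\<dots> = pr k (T (pr k x))" using finite_F pr_outside by simp
  finally show "degree_zero T (pr k x) = pr k (T (pr k x))" .
qed

lemma degree_zero_closed:
  assumes "graded U" "\<And>m. T (pr m x) \<in> U"
  shows "degree_zero T x \<in> U"
  unfolding degree_zero_def using assms by (intro subspace_sum) (auto simp: graded_def)

text \<open>The block-diagonal part of any projection onto \<open>U\<close>. It still fixes
  \<open>U\<close>, because the homogeneous components of elements of \<open>U\<close> stay in
  \<open>U\<close>.\<close>

lemma graded_projection:
  assumes U: "graded U"
  obtains P where "linear P" "\<And>x. P x \<in> U" "\<And>x. x \<in> U \<Longrightarrow> P x = x" "\<And>m x. pr m (P x) = P (pr m x)"
proof -
  have sU: "subspace U" and Ug: "U \<subseteq> g" and prU: "\<And>m x. x \<in> U \<Longrightarrow> pr m x \<in> U" using U by (auto simp: graded_def)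
  obtain p where p: "linear p" "\<And>x. p x \<in> U" "\<And>x. x \<in> U \<Longrightarrow> p x = x"
    by (rule projection_exists[OF sU subspace_single_0]) (auto intro: that)
  show ?thesis
  proof (rule that[of "degree_zero p"])
    show "linear (degree_zero p)" by (rule linear_degree_zero[OF p(1)])
    show "degree_zero p x \<in> U" for x by (rule degree_zero_closed[OF U p(2)])
    show "degree_zero p x = x" if "x \<in> U" for x
    proof -
      have "degree_zero p x = (\<Sum>m\<in>F. pr m x)"
        unfolding degree_zero_def by (intro sum.cong refl) (simp add: p(3) prU[OF that] pr_pr)
      then show ?thesis using sum_pr that Ug by auto
    qed
    show "pr m (degree_zero p x) = degree_zero p (pr m x)" for m x by (simp only: pr_degree_zero[OF p(1)])
  qed
qed

lemma graded_kernel: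
  assumes "linear P" "\<And>m x. pr m (P x) = P (pr m x)" "graded U"
  shows "graded {x \<in> U. P x = 0}"
proof -
  have "subspace {x \<in> U. P x = 0}"
    using assms(3) subspace_inter[OF _ linear_subspace_kernel[OF assms(1)], of U]
    by (simp add: graded_def Int_def)
  moreover have "P (pr m x) = 0" if "P x = 0" for m x
    using assms(2)[of m x] that linear_0[OF linear_pr] by simp
  ultimately show ?thesis using assms(3) by (auto simp: graded_def)
qed

lemma bilinear_homogeneous:
  assumes U: "graded U" and h: "bilinear h"
    and z: "\<And>m n x y. x \<in> U \<Longrightarrow> x \<in> G m \<Longrightarrow> y \<in> U \<Longrightarrow> y \<in> G n \<Longrightarrow> h x y = 0"
    and xy: "x \<in> U" "y \<in> U"
  shows "h x y = 0"
proof -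
  have "x = (\<Sum>m\<in>F. pr m x)" "y = (\<Sum>m\<in>F. pr m y)" using sum_pr xy U by (auto simp: graded_def)
  then have "h x y = (\<Sum>(i, j)\<in>F \<times> F. h (pr i x) (pr j y))"
    by (metis bilinear_sum[OF h])
  also have "\<dots> = 0"
    using z[OF _ pr_G _ pr_G] xy U by (intro sum.neutral) (auto simp: graded_def)
  finally show ?thesis .
qed

text \<open>Leibniz gives the ideal property. For homogeneity, expand a bracket into brackets of
  homogeneous components; each projection either keeps or kills such a bracket.\<close>

lemma graded_derived_series:
  assumes r: "lie_ideal g br r" "graded r"
  shows "lie_ideal g br (derived_series br r k) \<and> graded (derived_series br r k)"
proof (induction k)
  case 0
  show ?case using r by simp
next
  case (Suc k)
  let ?R = "derived_series br r k" and ?S = "derived_series br r (Suc k)"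
  have R: "subspace ?R" "?R \<subseteq> g" "\<And>x y. x \<in> g \<Longrightarrow> y \<in> ?R \<Longrightarrow> br x y \<in> ?R" "\<And>m x. x \<in> ?R \<Longrightarrow> pr m x \<in> ?R"
    using Suc by (auto simp: lie_ideal_def graded_def)
  have S: "?S = span {br x y | x y. x \<in> ?R \<and> y \<in> ?R}" by simp
  have sS: "subspace ?S" by simp
  have base: "br x y \<in> ?S" if "x \<in> ?R" "y \<in> ?R" for x y unfolding S using that by (intro span_base) blast
  have Sg: "?S \<subseteq> g" unfolding S using R(2) br_closed subspace_L by (intro span_minimal) (auto simp: subset_iff)
  have "br z y \<in> ?S" if z: "z \<in> g" and y: "y \<in> ?S" for z y
  proof -
    have "?S \<subseteq> {y. br z y \<in> ?S}"
      unfolding S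
    proof (rule span_minimal, fold S)
      show "subspace {y. br z y \<in> ?S}" by (rule linear_subspace_linear_preimage[OF linear_br sS])
      show "{br x y | x y. x \<in> ?R \<and> y \<in> ?R} \<subseteq> {y. br z y \<in> ?S}"
      proof clarify
        fix x y assume xy: "x \<in> ?R" "y \<in> ?R"
        then have "x \<in> g" "y \<in> g" using R(2) by auto
        then have "br z (br x y) = br (br z x) y + br x (br z y)" using br_jacobi[OF z, of x y] by simp
        moreover have "br (br z x) y \<in> ?S" "br x (br z y) \<in> ?S" using R(3)[OF z] xy base by auto
        ultimately show "br z (br x y) \<in> ?S" using subspace_add[OF sS] by metis
      qed
    qed
    then show ?thesis using y by blast
  qed
  moreover have "pr m y \<in> ?S" if y: "y \<in> ?S" for m y
  proof -
    have "?S \<subseteq> {y. pr m y \<in> ?S}"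
      unfolding S
    proof (rule span_minimal, fold S)
      show "subspace {y. pr m y \<in> ?S}" by (rule linear_subspace_linear_preimage[OF linear_pr sS])
      show "{br x y | x y. x \<in> ?R \<and> y \<in> ?R} \<subseteq> {y. pr m y \<in> ?S}"
      proof clarify
        fix x y assume xy: "x \<in> ?R" "y \<in> ?R"
        have "x = (\<Sum>i\<in>F. pr i x)" "y = (\<Sum>i\<in>F. pr i y)" using sum_pr xy R(2) by auto
        then have "br x y = (\<Sum>(i, j)\<in>F \<times> F. br (pr i x) (pr j y))" by (metis bilinear_sum[OF bil_br])
        then have "pr m (br x y) = (\<Sum>(i, j)\<in>F \<times> F. pr m (br (pr i x) (pr j y)))"
          by (simp add: linear_sum[OF linear_pr] case_prod_unfold)
        also have "\<dots> \<in> ?S"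
        proof (rule subspace_sum[OF sS], clarify)
          fix i j
          have "br (pr i x) (pr j y) \<in> ?S" using base R(4) xy by blast
          then show "pr m (br (pr i x) (pr j y)) \<in> ?S"
            using pr_same[of _ m] pr_other[of _ "i + j" m] G_br[OF pr_G pr_G, of i x j y] subspace_0[OF sS]
            by (cases "i + j = m") auto
        qed
        finally show "pr m (br x y) \<in> ?S" .
      qed
    qed
    then show ?thesis using y by blast
  qed
  ultimately show ?case using sS Sg by (auto simp: lie_ideal_def graded_def)
qed

end

section \<open>Homogeneity of the radical\<close>

lemma (in lie_algebra) radical_maximal: "maximal_solvable_ideal L br (lie_radical L br)"
  unfolding lie_radical_def by (rule theI'[OF ex1_maximal_solvable_ideal])

text \<open>Sums of solvable ideals are solvable ideals, which upgrades maximality to being the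
  greatest.\<close>

lemma (in lie_algebra) radical_greatest:
  assumes I: "lie_ideal L br I" "lie_solvable br I"
  shows "I \<subseteq> lie_radical L br"
proof -
  let ?R = "lie_radical L br" and ?S = "{x + y | x y. x \<in> lie_radical L br \<and> y \<in> I}"
  have R: "lie_ideal L br ?R" "lie_solvable br ?R"
    and max: "\<And>J. lie_ideal L br J \<Longrightarrow> lie_solvable br J \<Longrightarrow> ?R \<subseteq> J \<Longrightarrow> J = ?R"
    using radical_maximal by (auto simp: maximal_solvable_ideal_def)
  have 0: "0 \<in> ?R" "0 \<in> I" using R(1) I(1) subspace_0 by (auto simp: lie_ideal_def)
  have "?R \<subseteq> ?S" "I \<subseteq> ?S" using 0 by force+
  moreover have "?S = ?R" using max[OF solvable_ideal_sum[OF R I] \<open>?R \<subseteq> ?S\<close>] .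
  ultimately show ?thesis by blast
qed

locale lie_with_radical = lie_module g br g br
  for g :: "'a::real_vector set" and br +
  fixes r :: "'a set"
  assumes r_ideal: "lie_ideal g br r" and r_solvable: "lie_solvable br r"
    and r_greatest: "\<And>I. lie_ideal g br I \<Longrightarrow> lie_solvable br I \<Longrightarrow> I \<subseteq> r"
begin

lemmas r_facts = ideal_closed[OF r_ideal]

text \<open>The bracket \<open>br'\<close> only has to agree with \<open>br\<close> modulo the radical, so this covers ideals both
  of a subalgebra and of a complement with the projected bracket.\<close>

lemma solvable_in_radical:
  assumes I: "subspace I" "I \<subseteq> g" "\<And>x y. x \<in> I \<Longrightarrow> y \<in> I \<Longrightarrow> br' x y \<in> I"
    and close: "\<And>x y. x \<in> I \<Longrightarrow> y \<in> I \<Longrightarrow> br x y - br' x y \<in> r"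
    and ideal: "\<And>x y. x \<in> g \<Longrightarrow> y \<in> I \<Longrightarrow> br x y \<in> {i + s | i s. i \<in> I \<and> s \<in> r}"
    and solv: "lie_solvable br' I"
  shows "I \<subseteq> r"
proof -
  \<comment> \<open>H = I + r is an ideal of \<open>g\<close>, and modulo \<open>r\<close> its
    derived series follows that of \<open>I\<close> for \<open>br'\<close>. Hence \<open>H\<close>
    is solvable and contained in \<open>r\<close>.\<close>
  define H where "H = {i + s | i s. i \<in> I \<and> s \<in> r}"
  have sH: "subspace H" unfolding H_def by (rule subspace_sums[OF I(1) r_facts(1)])
  have Hg: "H \<subseteq> g" unfolding H_def using I(2) r_facts(2) subspace_add[OF subspace_L] by auto
  have rH: "s \<in> H" if "s \<in> r" for s unfolding H_def using that subspace_0[OF I(1)] by force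
  have IH: "i \<in> H" if "i \<in> I" for i unfolding H_def using that subspace_0[OF r_facts(1)] by force
  have "br x y \<in> H" if x: "x \<in> g" and y: "y \<in> H" for x y
  proof -
    obtain i s where y': "y = i + s" "i \<in> I" "s \<in> r" using y by (auto simp: H_def)
    have "br x y = br x i + br x s" using y'(1) by (simp add: br_simps)
    moreover have "br x i \<in> H" using ideal[OF x y'(2)] by (simp add: H_def)
    ultimately show ?thesis using rH[OF r_facts(3)[OF x y'(3)]] subspace_add[OF sH] by simp
  qed
  then have H_ideal: "lie_ideal g br H" using sH Hg by (simp add: lie_ideal_def)
  have DI: "derived_series br' I k \<subseteq> I" for k
  proof (induction k)
    case (Suc k)
    then have "{br' x y | x y. x \<in> derived_series br' I k \<and> y \<in> derived_series br' I k} \<subseteq> I"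
      using I(3) by (auto simp: subset_iff)
    then show ?case using I(1) by (simp add: span_minimal)
  qed simp
  have step: "derived_series br H k \<subseteq> {i + s | i s. i \<in> derived_series br' I k \<and> s \<in> r}" for k
  proof (induction k)
    case 0
    show ?case by (simp add: H_def)
  next
    case (Suc k)
    let ?A = "derived_series br' I k" and ?B = "derived_series br' I (Suc k)"
    let ?T = "{i + s | i s. i \<in> ?B \<and> s \<in> r}"
    have sT: "subspace ?T" by (rule subspace_sums[OF _ r_facts(1)]) simp
    have "br u v \<in> ?T" if uv: "u \<in> derived_series br H k" "v \<in> derived_series br H k" for u v
    proof -
      obtain i s where u: "u = i + s" "i \<in> ?A" "s \<in> r" using uv(1) Suc by blast
      obtain j t where v: "v = j + t" "j \<in> ?A" "t \<in> r" using uv(2) Suc by blast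
      have ij: "i \<in> I" "j \<in> I" using u v DI by blast+
      have vg: "v \<in> g" using ij(2) v I(2) r_facts(2) subspace_add[OF subspace_L] by auto
      have "br u v = br' i j + ((br i j - br' i j) + (br i t + br s v))"
        using u v by (simp add: br_simps)
      moreover have "br' i j \<in> ?B" using u(2) v(2) by (auto intro: span_base)
      moreover have "(br i j - br' i j) + (br i t + br s v) \<in> r"
      proof (intro subspace_add[OF r_facts(1)])
        show "br i j - br' i j \<in> r" by (rule close[OF ij])
        show "br i t \<in> r" using r_facts(3) v(3) ij(1) I(2) by blast
        show "br s v \<in> r" by (rule r_facts(4)[OF u(3) vg])
      qed
      ultimately show ?thesis by blast
    qed
    then have "span {br x y | x y. x \<in> derived_series br H k \<and> y \<in> derived_series br H k} \<subseteq> ?T"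
      by (intro span_minimal[OF _ sT]) blast
    then show ?case by simp
  qed
  obtain n where n: "derived_series br' I n = {0}" using solv by (auto simp: lie_solvable_def)
  obtain m where m: "derived_series br r m = {0}" using r_solvable by (auto simp: lie_solvable_def)
  have "derived_series br H n \<subseteq> r" using step[of n] n by auto
  then have "derived_series br H (n + m) \<subseteq> {0}"
    unfolding derived_series_add using derived_series_mono[of _ r br m] m by blast
  moreover have "0 \<in> derived_series br H (n + m)"
    by (rule subspace_0[OF subspace_derived_series[OF sH]])
  ultimately have "lie_solvable br H" unfolding lie_solvable_def by blast
  then have "H \<subseteq> r" using r_greatest H_ideal by blast
  then show ?thesis using IH by blast
qed

end

text \<open>To reach the component of l, choose \<Phi> i that distinguishes l from k. Subtracting
  the scalar of k removes the k component and rescales that of l by a nonzero factor, and the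
  shorter sum is covered by induction.\<close>

lemma eigencomponents_in_invariant_subspace:
  assumes M: "finite M" and U: "subspace U"
    and \<Phi>: "\<And>i. i \<in> I \<Longrightarrow> linear (\<Phi> i)" "\<And>i u. i \<in> I \<Longrightarrow> u \<in> U \<Longrightarrow> \<Phi> i u \<in> U"
    and sep: "\<And>m n. m \<noteq> n \<Longrightarrow> \<exists>i\<in>I. \<theta> i m \<noteq> \<theta> i n"
    and eig: "\<And>i m. i \<in> I \<Longrightarrow> m \<in> M \<Longrightarrow> \<Phi> i (x m) = \<theta> i m *\<^sub>R x m"
    and sum: "(\<Sum>m\<in>M. x m) \<in> U"
  shows "\<forall>m\<in>M. x m \<in> U"
  using M eig sum
proof (induction M arbitrary: x rule: finite_induct)
  case (insert k M)
  have M: "x l \<in> U" if l: "l \<in> M" for l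
  proof -
    have "l \<noteq> k" using l insert.hyps(2) by blast
    then obtain i where i: "i \<in> I" "\<theta> i l \<noteq> \<theta> i k" using sep by blast
    let ?x = "\<lambda>m. (\<theta> i m - \<theta> i k) *\<^sub>R x m"
    have "\<forall>m\<in>M. ?x m \<in> U"
    proof (rule insert.IH)
      show "\<Phi> j (?x m) = \<theta> j m *\<^sub>R ?x m" if "j \<in> I" "m \<in> M" for j m
        using insert.prems(1)[of j m] that \<Phi>(1) by (simp add: linear_scale)
      have "\<Phi> i (\<Sum>m\<in>insert k M. x m) - \<theta> i k *\<^sub>R (\<Sum>m\<in>insert k M. x m) \<in> U"
        using \<Phi>(2)[OF i(1)] insert.prems(2) U by (simp add: subspace_diff subspace_scale)
      also have "\<Phi> i (\<Sum>m\<in>insert k M. x m) = (\<Sum>m\<in>insert k M. \<theta> i m *\<^sub>R x m)"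
        using insert.prems(1)[OF i(1)] by (simp only: linear_sum[OF \<Phi>(1)[OF i(1)]] cong: sum.cong)
      also have "\<dots> - \<theta> i k *\<^sub>R (\<Sum>m\<in>insert k M. x m) = (\<Sum>m\<in>M. ?x m)"
        using insert.hyps by (simp add: scaleR_diff_left sum_subtractf scaleR_sum_right scaleR_add_right)
      finally show "(\<Sum>m\<in>M. ?x m) \<in> U" .
    qed
    from subspace_scale[OF U bspec[OF this l], of "inverse (\<theta> i l - \<theta> i k)"]
    show ?thesis using i(2) by simp
  qed
  have "(\<Sum>m\<in>insert k M. x m) - (\<Sum>m\<in>M. x m) \<in> U"
    by (rule subspace_diff[OF U insert.prems(2) subspace_sum[OF U M]])
  then have "x k \<in> U" using insert.hyps by simp
  then show ?case using M by blast
qed simp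

locale graded_lie_with_radical = graded_lie g br G F pr + lie_with_radical g br r
  for g :: "'a::real_vector set" and br and G :: "'i::ab_group_add \<Rightarrow> 'a set" and F pr r
begin

text \<open>The diagonal operator of weight \<theta>; for a nowhere zero multiplicative \<theta> it
  is an automorphism of the graded algebra.\<close>

definition scaling :: "('i \<Rightarrow> real) \<Rightarrow> 'a \<Rightarrow> 'a" where
  "scaling \<theta> x = (\<Sum>m\<in>F. \<theta> m *\<^sub>R pr m x)"

lemma linear_scaling: "linear (scaling \<theta>)"
  by (rule linearI) (simp_all add: scaling_def linear_add[OF linear_pr] linear_scale[OF linear_pr]
    scaleR_add_right sum.distrib scaleR_sum_right mult.commute)

lemma scaling_G: "x \<in> G m \<Longrightarrow> scaling \<theta> x = \<theta> m *\<^sub>R x"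
proof -
  assume x: "x \<in> G m"
  have "scaling \<theta> x = (\<Sum>n\<in>F. if n = m then \<theta> m *\<^sub>R x else 0)"
    unfolding scaling_def using pr_same[OF x] pr_other[OF x] by (intro sum.cong refl) auto
  also have "\<dots> = \<theta> m *\<^sub>R x" using finite_F outside_F[of m] x by auto
  finally show ?thesis .
qed

lemma scaling_closed: "scaling \<theta> x \<in> g"
  unfolding scaling_def by (intro subspace_sum subspace_L subspace_scale pr_g)

lemma scaling_inverse:
  assumes "\<And>m. \<theta> m \<noteq> 0" "x \<in> g"
  shows "scaling \<theta> (scaling (\<lambda>m. inverse (\<theta> m)) x) = x"
proof -
  have "scaling \<theta> (scaling (\<lambda>m. inverse (\<theta> m)) x)
      = (\<Sum>m\<in>F. scaling \<theta> (inverse (\<theta> m) *\<^sub>R pr m x))"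
    unfolding scaling_def[of "\<lambda>m. inverse (\<theta> m)"] by (rule linear_sum[OF linear_scaling])
  also have "\<dots> = (\<Sum>m\<in>F. pr m x)"
    using assms(1) by (intro sum.cong refl) (simp add: linear_scale[OF linear_scaling] scaling_G[OF pr_G])
  finally show ?thesis using sum_pr[OF assms(2)] by simp
qed

lemma scaling_br:
  assumes "\<And>m n. \<theta> (m + n) = \<theta> m * \<theta> n" "x \<in> g" "y \<in> g"
  shows "scaling \<theta> (br x y) = br (scaling \<theta> x) (scaling \<theta> y)"
proof -
  have "graded g" by (simp add: graded_def subspace_L pr_g)
  moreover have "bilinear (\<lambda>x y. scaling \<theta> (br x y) - br (scaling \<theta> x) (scaling \<theta> y))"
    by (rule bilinearI) (simp_all add: br_simps linear_add[OF linear_scaling] linear_scale[OF linear_scaling]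
      scaleR_diff_right algebra_simps)
  moreover have "scaling \<theta> (br x y) - br (scaling \<theta> x) (scaling \<theta> y) = 0" if "x \<in> G m" "y \<in> G n" for m n x y
    using that by (simp add: scaling_G[OF G_br] scaling_G assms(1) br_simps)
  ultimately have "scaling \<theta> (br x y) - br (scaling \<theta> x) (scaling \<theta> y) = 0"
    using bilinear_homogeneous[of g "\<lambda>x y. scaling \<theta> (br x y) - br (scaling \<theta> x) (scaling \<theta> y)"] assms(2,3)
    by blast
  then show ?thesis by simp
qed

text \<open>The image of \<open>r\<close> under an automorphism is again a solvable ideal;
  invertibility is what moves an arbitrary x of \<open>g\<close> to the source side in the ideal
  property.\<close>

lemma scaling_radical:
  assumes \<theta>: "\<And>m n. \<theta> (m + n) = \<theta> m * \<theta> n" "\<And>m. \<theta> m \<noteq> 0" and u: "u \<in> r"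
  shows "scaling \<theta> u \<in> r"
proof -
  let ?\<Phi> = "scaling \<theta>" and ?\<Psi> = "scaling (\<lambda>m. inverse (\<theta> m))"
  have "?\<Phi> ` r \<subseteq> r"
  proof (rule r_greatest)
    show "lie_ideal g br (?\<Phi> ` r)"
      unfolding lie_ideal_def
    proof (intro conjI ballI)
      show "subspace (?\<Phi> ` r)" by (rule linear_subspace_image[OF linear_scaling r_facts(1)])
      show "?\<Phi> ` r \<subseteq> g" using scaling_closed by blast
      fix x y assume x: "x \<in> g" and "y \<in> ?\<Phi> ` r"
      then obtain v where v: "v \<in> r" "y = ?\<Phi> v" by blast
      have "br x y = br (?\<Phi> (?\<Psi> x)) (?\<Phi> v)" using scaling_inverse[OF \<theta>(2) x] v(2) by simp
      also have "\<dots> = ?\<Phi> (br (?\<Psi> x) v)"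
        using scaling_br[OF \<theta>(1) scaling_closed] v(1) r_facts(2) by auto
      finally show "br x y \<in> ?\<Phi> ` r" using r_facts(3)[OF scaling_closed v(1)] by blast
    qed
    have D: "derived_series br (?\<Phi> ` r) n = ?\<Phi> ` derived_series br r n \<and> derived_series br r n \<subseteq> g" for n
    proof (induction n)
      case 0
      show ?case using r_facts(2) by simp
    next
      case (Suc n)
      let ?D = "derived_series br r n"
      have hom: "br (?\<Phi> x) (?\<Phi> y) = ?\<Phi> (br x y)" if "x \<in> ?D" "y \<in> ?D" for x y
        using scaling_br[of \<theta> x y, OF \<theta>(1)] Suc that by (simp add: subset_iff)
      have "{br x y | x y. x \<in> ?\<Phi> ` ?D \<and> y \<in> ?\<Phi> ` ?D} = ?\<Phi> ` {br x y | x y. x \<in> ?D \<and> y \<in> ?D}" (is "?A = ?B")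
      proof
        show "?A \<subseteq> ?B"
        proof clarify
          fix x y assume "x \<in> ?D" "y \<in> ?D"
          then show "br (?\<Phi> x) (?\<Phi> y) \<in> ?B" using hom by blast
        qed
        show "?B \<subseteq> ?A"
        proof clarify
          fix x y assume "x \<in> ?D" "y \<in> ?D"
          then show "\<exists>a b. ?\<Phi> (br x y) = br a b \<and> a \<in> ?\<Phi> ` ?D \<and> b \<in> ?\<Phi> ` ?D"
            using hom[of x y] by (intro exI[of _ "?\<Phi> x"] exI[of _ "?\<Phi> y"]) simp
        qed
      qed
      moreover have "{br x y | x y. x \<in> ?D \<and> y \<in> ?D} \<subseteq> g" using Suc br_closed by (auto simp: subset_iff)
      ultimately show ?case
        using Suc by (simp add: linear_span_image[OF linear_scaling] span_minimal subspace_L)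
    qed
    obtain n where "derived_series br r n = {0}" using r_solvable by (auto simp: lie_solvable_def)
    then have "derived_series br (?\<Phi> ` r) n = {0}" using D[of n] linear_0[OF linear_scaling] by simp
    then show "lie_solvable br (?\<Phi> ` r)" by (auto simp: lie_solvable_def)
  qed
  then show ?thesis using u by blast
qed

lemma radical_graded:
  fixes \<theta> :: "'j \<Rightarrow> 'i \<Rightarrow> real"
  assumes \<theta>: "\<And>i m n. \<theta> i (m + n) = \<theta> i m * \<theta> i n" "\<And>i m. \<theta> i m \<noteq> 0"
    and sep: "\<And>m n. m \<noteq> n \<Longrightarrow> \<exists>i. \<theta> i m \<noteq> \<theta> i n"
  shows "graded r"
proof -
  have "pr m u \<in> r" if u: "u \<in> r" for m u
  proof (cases "m \<in> F")
    case True
    have "\<forall>m\<in>F. pr m u \<in> r"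
    proof (rule eigencomponents_in_invariant_subspace[where I = UNIV and \<Phi> = "\<lambda>i. scaling (\<theta> i)" and \<theta> = \<theta>])
      show "scaling (\<theta> i) v \<in> r" if "v \<in> r" for i v by (rule scaling_radical[OF \<theta> that])
      show "scaling (\<theta> i) (pr m u) = \<theta> i m *\<^sub>R pr m u" for i m by (rule scaling_G[OF pr_G])
      show "(\<Sum>m\<in>F. pr m u) \<in> r" using sum_pr u r_facts(2) by auto
    qed (use finite_F r_facts(1) linear_scaling sep in auto)
    then show ?thesis using True by blast
  next
    case False
    then show ?thesis using pr_outside r_facts(1) by (simp add: subspace_0)
  qed
  then show ?thesis using r_facts by (simp add: graded_def)
qed

end

section \<open>Graded Levi subalgebras\<close>

locale graded_levi = graded_lie_with_radical +
  fixes P :: "'a \<Rightarrow> 'a"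
  assumes r_graded: "graded r"
    and linear_P: "linear P" and P_r: "\<And>x. P x \<in> r" and P_id: "\<And>x. x \<in> r \<Longrightarrow> P x = x"
    and pr_P: "\<And>m x. pr m (P x) = P (pr m x)"
begin

text \<open>With the bracket \<open>brS\<close>, a homogeneous model of the quotient g/r.\<close>

definition S :: "'a set" where
  "S = {x \<in> g. P x = 0}"

definition q :: "'a \<Rightarrow> 'a" where
  "q x = x - P x"

definition brS :: "'a \<Rightarrow> 'a \<Rightarrow> 'a" where
  "brS x y = q (br x y)"

abbreviation R :: "nat \<Rightarrow> 'a set" where
  "R k \<equiv> derived_series br r k"

lemma linear_q: "linear q"
  unfolding q_def[abs_def] by (intro linear_compose_sub linear_P) (auto intro!: linearI)

lemmas q_simps = linear_add[OF linear_q] linear_diff[OF linear_q] linear_scale[OF linear_q] linear_0[OF linear_q]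

lemma q_r: "x \<in> r \<Longrightarrow> q x = 0"
  by (simp add: q_def P_id)

lemma q_S: "x \<in> g \<Longrightarrow> q x \<in> S"
  using P_r P_id[OF P_r] r_facts(2) subspace_diff[OF subspace_L]
  by (auto simp: q_def S_def linear_diff[OF linear_P] subset_iff)

lemma graded_S: "graded S"
proof -
  have "graded g" by (simp add: graded_def subspace_L pr_g)
  from graded_kernel[OF linear_P pr_P this] show ?thesis by (simp add: S_def)
qed

lemma S_g: "x \<in> S \<Longrightarrow> x \<in> g"
  by (simp add: S_def)

lemma S_r: "x \<in> S \<Longrightarrow> x \<in> r \<Longrightarrow> x = 0"
  using P_id by (simp add: S_def)

lemma pr_q: "pr m (q x) = q (pr m x)"
  by (simp add: q_def linear_diff[OF linear_pr] pr_P)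

lemma subspace_S: "subspace S" and pr_S: "x \<in> S \<Longrightarrow> pr m x \<in> S"
  using graded_S by (auto simp: graded_def)

lemma q_br:
  assumes "x \<in> g" "y \<in> g"
  shows "q (br (q x) y) = q (br x y)" "q (br x (q y)) = q (br x y)"
proof -
  have "q (br (P x) y) = 0" "q (br x (P y)) = 0"
    using q_r r_facts(4)[OF P_r assms(2)] r_facts(3)[OF assms(1) P_r] by auto
  then show "q (br (q x) y) = q (br x y)" "q (br x (q y)) = q (br x y)"
    by (simp_all add: q_def[of x] q_def[of y] br_simps q_simps)
qed

lemma lie_S: "lie_module S brS S brS"
proof unfold_locales
  show "findim S" by (rule findim_sub[OF findim_L subspace_S]) (auto simp: S_def)
  show "bilinear brS" unfolding brS_def by (rule bilinearI) (simp_all add: br_simps q_simps)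
  show "brS x y \<in> S" if "x \<in> S" "y \<in> S" for x y
    unfolding brS_def by (intro q_S br_closed S_g that)
  show "brS x x = 0" if "x \<in> S" for x
    by (simp add: brS_def br_alt[OF S_g[OF that]] q_simps)
  show "brS (brS x y) z = brS x (brS y z) - brS y (brS x z)" if "x \<in> S" "y \<in> S" "z \<in> S" for x y z
    using that[THEN S_g] by (simp add: brS_def q_br br_closed br_jacobi q_simps)
qed

text \<open>A solvable ideal of \<open>S\<close> lies in \<open>r\<close> by
  \<open>solvable_in_radical\<close>, and \<open>S\<close> meets \<open>r\<close> trivially.\<close>

lemma S_semisimple: "no_solvable_ideals S brS"
  unfolding no_solvable_ideals_def
proof (intro allI impI)
  fix I assume "lie_ideal S brS I \<and> lie_solvable brS I"
  then have I: "subspace I" "I \<subseteq> S" "\<And>x y. x \<in> S \<Longrightarrow> y \<in> I \<Longrightarrow> brS x y \<in> I" "lie_solvable brS I"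
    by (auto simp: lie_ideal_def)
  have "I \<subseteq> r"
  proof (rule solvable_in_radical[OF I(1) _ _ _ _ I(4)])
    show "I \<subseteq> g" using I(2) S_g by blast
    show "brS x y \<in> I" if "x \<in> I" "y \<in> I" for x y using I(2,3) that by blast
    show "br x y - brS x y \<in> r" for x y by (simp add: brS_def q_def P_r)
    show "br x y \<in> {i + s | i s. i \<in> I \<and> s \<in> r}" if x: "x \<in> g" and y: "y \<in> I" for x y
    proof -
      have yg: "y \<in> g" using y I(2) S_g by blast
      have "brS (q x) y \<in> I" using I(3)[OF q_S[OF x] y] .
      then have "q (br x y) \<in> I" using q_br(1)[OF x yg] by (simp add: brS_def)
      moreover have "br x y = q (br x y) + P (br x y)" by (simp add: q_def)
      ultimately show ?thesis using P_r by blast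
    qed
  qed
  then have "x = 0" if "x \<in> I" for x using that I(2) by (intro S_r) auto
  then show "I = {0}" using subspace_0[OF I(1)] by blast
qed

lemma semisimple_S: "semisimple_lie S brS"
  by unfold_locales (use lie_S S_semisimple in \<open>auto simp: lie_module_def\<close>)

definition section_mod :: "nat \<Rightarrow> ('a \<Rightarrow> 'a) \<Rightarrow> bool" where
  "section_mod k \<sigma> \<longleftrightarrow> linear \<sigma> \<and> (\<forall>x\<in>S. \<sigma> x - x \<in> r) \<and> (\<forall>m. \<forall>x\<in>S. pr m (\<sigma> x) = \<sigma> (pr m x)) \<and>
     (\<forall>x\<in>S. \<forall>y\<in>S. br (\<sigma> x) (\<sigma> y) - \<sigma> (brS x y) \<in> R k)"

lemma section_mod_0: "section_mod 0 (\<lambda>x. x)"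
proof -
  have "br x y - brS x y \<in> r" for x y by (simp add: brS_def q_def P_r)
  then show ?thesis using subspace_0[OF r_facts(1)] by (auto simp: section_mod_def intro!: linearI)
qed

text \<open>Writing the new section as \<sigma> - \<psi>, its defect lies in
  \<open>R (Suc k)\<close> exactly when the coboundary of \<psi> is the class of the old defect,
  because the term quadratic in \<psi> is already there.\<close>

lemma section_mod_Suc:
  assumes \<sigma>: "section_mod k \<sigma>"
  shows "\<exists>\<sigma>'. section_mod (Suc k) \<sigma>'"
proof -
  interpret s: semisimple_lie S brS by (rule semisimple_S)
  have l\<sigma>: "linear \<sigma>" and \<sigma>r: "\<And>x. x \<in> S \<Longrightarrow> \<sigma> x - x \<in> r"
    and pr\<sigma>: "\<And>m x. x \<in> S \<Longrightarrow> pr m (\<sigma> x) = \<sigma> (pr m x)"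
    and \<sigma>c: "\<And>x y. x \<in> S \<Longrightarrow> y \<in> S \<Longrightarrow> br (\<sigma> x) (\<sigma> y) - \<sigma> (brS x y) \<in> R k"
    using \<sigma> by (auto simp: section_mod_def)
  have \<sigma>g: "\<sigma> x \<in> g" if "x \<in> S" for x
  proof -
    have "(\<sigma> x - x) + x \<in> g" using \<sigma>r[OF that] r_facts(2) S_g[OF that] by (intro subspace_add[OF subspace_L]) auto
    then show ?thesis by simp
  qed
  note \<sigma>_simps = linear_add[OF l\<sigma>] linear_diff[OF l\<sigma>] linear_scale[OF l\<sigma>] linear_0[OF l\<sigma>]
  let ?a = "R k" and ?b = "R (Suc k)"
  have aI: "lie_ideal g br ?a" and ga: "graded ?a" and bI: "lie_ideal g br ?b" and gb: "graded ?b"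
    using graded_derived_series[OF r_ideal r_graded] by blast+
  note a = ideal_closed[OF aI] and b = ideal_closed[OF bI]
  have ab: "br x y \<in> ?b" if "x \<in> ?a" "y \<in> ?a" for x y using that by (auto intro: span_base)
  have ba: "?b \<subseteq> ?a"
    unfolding derived_series.simps by (rule span_minimal[OF _ a(1)]) (use a(2,3) in blast)
  have ar: "?a \<subseteq> r"
    by (rule lie_module.derived_subset[OF restrict_algebra[OF r_facts(1,2)]]) (use r_facts(2,3) in blast)
  obtain Pb where Pb: "linear Pb" "\<And>x. Pb x \<in> ?b" "\<And>x. x \<in> ?b \<Longrightarrow> Pb x = x" "\<And>m x. pr m (Pb x) = Pb (pr m x)"
    by (rule graded_projection[OF gb]) (rule that; assumption)
  \<comment> \<open>A homogeneous complement of \<open>R (Suc k)\<close> in \<open>R k\<close>, with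
    \<pi> as the quotient map.\<close>
  define V where "V = {x \<in> ?a. Pb x = 0}"
  define \<pi> where "\<pi> x = x - Pb x" for x
  have gV: "graded V" unfolding V_def by (rule graded_kernel[OF Pb(1,4) ga])
  have sV: "subspace V" and Vpr: "\<And>m x. x \<in> V \<Longrightarrow> pr m x \<in> V" using gV by (auto simp: graded_def)
  have Va: "x \<in> ?a" if "x \<in> V" for x using that by (simp add: V_def)
  have Vg: "x \<in> g" if "x \<in> V" for x using Va[OF that] a(2) by blast
  have l\<pi>: "linear \<pi>" unfolding \<pi>_def[abs_def] by (intro linear_compose_sub Pb(1)) (auto intro!: linearI)
  note \<pi>_simps = linear_add[OF l\<pi>] linear_diff[OF l\<pi>] linear_scale[OF l\<pi>] linear_0[OF l\<pi>]
  have \<pi>b: "\<pi> x = 0" if "x \<in> ?b" for x using Pb(3)[OF that] by (simp add: \<pi>_def)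
  have \<pi>V: "\<pi> x \<in> V" if "x \<in> ?a" for x
  proof -
    have "x - Pb x \<in> ?a" using subspace_diff[OF a(1) that] Pb(2) ba by blast
    then show ?thesis using Pb(3)[OF Pb(2)] by (simp add: V_def \<pi>_def linear_diff[OF Pb(1)])
  qed
  have \<pi>_id: "\<pi> x = x" if "x \<in> V" for x using that by (simp add: V_def \<pi>_def)
  have pr\<pi>: "pr m (\<pi> x) = \<pi> (pr m x)" for m x by (simp add: \<pi>_def linear_diff[OF linear_pr] Pb(4))
  have \<pi>_br: "\<pi> (br x (\<pi> v)) = \<pi> (br x v)" if "x \<in> g" for x v
  proof -
    have "br x v = br x (\<pi> v) + br x (Pb v)" by (simp add: \<pi>_def flip: br_simps(2))
    then show ?thesis using \<pi>b[OF b(3)[OF that Pb(2)]] by (simp add: \<pi>_simps)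
  qed
  define act where "act x v = \<pi> (br (\<sigma> x) v)" for x v
  have bil_act: "bilinear act"
    unfolding act_def by (rule bilinearI) (simp_all add: br_simps \<sigma>_simps \<pi>_simps)
  note act_simps = bilinear_simps[OF bil_act]
  have actV: "act x v \<in> V" if "x \<in> S" "v \<in> V" for x v
    unfolding act_def by (rule \<pi>V[OF a(3)[OF \<sigma>g[OF that(1)] Va[OF that(2)]]])
  define c where "c x y = br (\<sigma> x) (\<sigma> y) - \<sigma> (brS x y)" for x y
  have ca: "c x y \<in> ?a" if "x \<in> S" "y \<in> S" for x y unfolding c_def by (rule \<sigma>c[OF that])
  define f where "f x y = \<pi> (c x y)" for x y
  interpret V: lie_module S brS V act
  proof unfold_locales
    show "findim V" using findim_sub[OF findim_L sV] Vg by blast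
    fix x y v assume xy: "x \<in> S" "y \<in> S" and v: "v \<in> V"
    have g: "\<sigma> x \<in> g" "\<sigma> y \<in> g" "v \<in> g" using \<sigma>g xy Vg v by auto
    have "act x (act y v) - act y (act x v) = \<pi> (br (\<sigma> x) (br (\<sigma> y) v) - br (\<sigma> y) (br (\<sigma> x) v))"
      using g by (simp add: act_def \<pi>_br \<pi>_simps)
    also have "\<dots> = \<pi> (br (br (\<sigma> x) (\<sigma> y)) v)" using br_jacobi[OF g] by simp
    also have "\<dots> = \<pi> (br (\<sigma> (brS x y)) v) + \<pi> (br (c x y) v)"
      by (simp add: c_def br_simps \<pi>_simps)
    \<comment> \<open>Here the derived series enters: the defect and v both lie in
      \<open>R k\<close>, so their bracket is in \<open>R (Suc k)\<close>. Thus \<open>act\<close>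
      is a representation although \<sigma> is not yet a homomorphism.\<close>
    also have "\<pi> (br (c x y) v) = 0" using \<pi>b[OF ab[OF ca[OF xy] Va[OF v]]] .
    finally show "act (brS x y) v = act x (act y v) - act y (act x v)" by (simp add: act_def)
  qed (use bil_act actV lie_S[unfolded lie_module_def] in auto)
  have coc: "two_cocycle S brS V act f"
    unfolding two_cocycle_def
  proof (intro conjI ballI)
    show "bilinear f"
      unfolding f_def c_def by (rule bilinearI)
        (simp_all add: br_simps s.ad.br_simps \<sigma>_simps \<pi>_simps scaleR_diff_right)
    show "f x y \<in> V" if "x \<in> S" "y \<in> S" for x y unfolding f_def by (rule \<pi>V[OF ca[OF that]])
    show "f x x = 0" if "x \<in> S" for x
      using br_alt[OF \<sigma>g[OF that]] s.ad.br_alt[OF that] by (simp add: f_def c_def \<sigma>_simps \<pi>_simps)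
    fix x y z assume xyz: "x \<in> S" "y \<in> S" "z \<in> S"
    note g = xyz[THEN \<sigma>g]
    note sb = s.ad.br_closed[OF xyz(1,2)] s.ad.br_closed[OF xyz(1,3)] s.ad.br_closed[OF xyz(2,3)]
    note gb = sb[THEN \<sigma>g]
    have af: "act u (f v w) = \<pi> (br (\<sigma> u) (c v w))" if "u \<in> S" for u v w
      unfolding act_def f_def by (rule \<pi>_br[OF \<sigma>g[OF that]])
    have 1: "br (br (\<sigma> x) (\<sigma> y)) (\<sigma> z) = br (\<sigma> x) (br (\<sigma> y) (\<sigma> z)) - br (\<sigma> y) (br (\<sigma> x) (\<sigma> z))"
      by (rule br_jacobi[OF g])
    have 2: "br (\<sigma> z) (br (\<sigma> x) (\<sigma> y)) = - br (br (\<sigma> x) (\<sigma> y)) (\<sigma> z)"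
      by (rule br_skew[OF br_closed[OF g(1,2)] g(3)])
    have 3: "br (\<sigma> (brS x y)) (\<sigma> z) = - br (\<sigma> z) (\<sigma> (brS x y))"
      "br (\<sigma> (brS x z)) (\<sigma> y) = - br (\<sigma> y) (\<sigma> (brS x z))"
      "br (\<sigma> (brS y z)) (\<sigma> x) = - br (\<sigma> x) (\<sigma> (brS y z))"
      by (rule br_skew[OF g(3) gb(1)], rule br_skew[OF g(2) gb(2)], rule br_skew[OF g(1) gb(3)])
    have "brS (brS x y) z = brS x (brS y z) - brS y (brS x z)" by (rule s.ad.br_jacobi[OF xyz])
    then have 4: "brS (brS x y) z - brS (brS x z) y + brS (brS y z) x = 0"
      using s.ad.br_skew[OF xyz(1) sb(3)] s.ad.br_skew[OF xyz(2) sb(2)] by simp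
    \<comment> \<open>A Bianchi identity: it holds for the defect itself, before reduction by \<pi>,
      from the Jacobi identities of \<open>g\<close> and of \<open>S\<close>.\<close>
    have "br (\<sigma> x) (c y z) - br (\<sigma> y) (c x z) + br (\<sigma> z) (c x y) - c (brS x y) z + c (brS x z) y - c (brS y z) x
        = \<sigma> (brS (brS x y) z - brS (brS x z) y + brS (brS y z) x)"
      by (simp add: c_def br_simps 1 2 3 \<sigma>_simps)
    also have "\<dots> = 0" by (simp only: 4 \<sigma>_simps)
    finally have "\<pi> (br (\<sigma> x) (c y z) - br (\<sigma> y) (c x z) + br (\<sigma> z) (c x y)
        - c (brS x y) z + c (brS x z) y - c (brS y z) x) = 0" by (simp add: \<pi>_simps)
    then show "act x (f y z) - act y (f x z) + act z (f x y) - f (brS x y) z + f (brS x z) y - f (brS y z) x = 0"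
      unfolding af[OF xyz(1)] af[OF xyz(2)] af[OF xyz(3)] by (simp add: f_def \<pi>_simps)
  qed
  obtain \<phi> where \<phi>: "linear \<phi>" "\<forall>x\<in>S. \<phi> x \<in> V"
    "\<forall>x\<in>S. \<forall>y\<in>S. f x y = act x (\<phi> y) - act y (\<phi> x) - \<phi> (brS x y)"
    using s.second_cohomology[OF V.lie_module_axioms coc] by blast
  \<comment> \<open>\<phi> need not preserve degrees, whereas the corrected section must.\<close>
  define \<psi> where "\<psi> = degree_zero \<phi>"
  have l\<psi>: "linear \<psi>" unfolding \<psi>_def by (rule linear_degree_zero[OF \<phi>(1)])
  note \<psi>_simps = linear_add[OF l\<psi>] linear_diff[OF l\<psi>] linear_scale[OF l\<psi>] linear_0[OF l\<psi>]
  have \<psi>V: "\<psi> x \<in> V" if "x \<in> S" for x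
    unfolding \<psi>_def using \<phi>(2) pr_S[OF that] by (intro degree_zero_closed[OF gV]) blast
  have pr\<psi>: "pr m (\<psi> x) = \<psi> (pr m x)" for m x
    unfolding \<psi>_def by (simp only: pr_degree_zero[OF \<phi>(1)])
  have \<psi>G: "\<psi> x = pr m (\<phi> x)" if "x \<in> G m" for x m
    using pr_degree_zero(2)[OF \<phi>(1), of m x] pr_same[OF that] by (simp add: \<psi>_def)
  define h where "h x y = f x y - (act x (\<psi> y) - act y (\<psi> x) - \<psi> (brS x y))" for x y
  have bh: "bilinear h"
    unfolding h_def using coc
    by (intro bilinearI) (simp_all add: two_cocycle_def bilinear_simps[of f] act_simps s.ad.br_simps
      \<psi>_simps scaleR_diff_right)
  \<comment> \<open>By bilinearity, x and y may be taken of degrees m and n. Then f x y has degree m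
    + n, and projecting its expression through \<phi> to this degree replaces \<phi> by \<psi> in
    every term.\<close>
  have "h x y = 0" if "x \<in> S" "y \<in> S" for x y
  proof (rule bilinear_homogeneous[OF graded_S bh _ that])
    fix m n x y assume x: "x \<in> S" "x \<in> G m" and y: "y \<in> S" "y \<in> G n"
    have \<sigma>G: "\<sigma> x \<in> G m" "\<sigma> y \<in> G n"
      using pr_G[of m "\<sigma> x"] pr_G[of n "\<sigma> y"] pr\<sigma>[OF x(1)] pr\<sigma>[OF y(1)] pr_same[OF x(2)] pr_same[OF y(2)] by simp_all
    have sG: "brS x y \<in> G (m + n)"
      using pr_G[of "m + n" "brS x y"] pr_same[OF G_br[OF x(2) y(2)]] by (simp add: brS_def pr_q)
    have pr_act: "pr (m + n) (act x (\<phi> y)) = act x (\<psi> y)" "pr (n + m) (act y (\<phi> x)) = act y (\<psi> x)"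
      using pr_br[OF \<sigma>G(1), of "\<phi> y" n] pr_br[OF \<sigma>G(2), of "\<phi> x" m] \<phi>(2) Vg x y
      by (simp_all add: act_def pr\<pi> \<psi>G)
    have "pr (m + n) (\<sigma> (brS x y)) = \<sigma> (brS x y)"
      using pr\<sigma>[OF s.ad.br_closed[OF x(1) y(1)], of "m + n"] pr_same[OF sG] by simp
    then have "pr (m + n) (f x y) = f x y"
      using pr_same[OF G_br[OF \<sigma>G]] by (simp add: f_def c_def pr\<pi> linear_diff[OF linear_pr])
    then have "f x y = pr (m + n) (act x (\<phi> y) - act y (\<phi> x) - \<phi> (brS x y))"
      using \<phi>(3) x(1) y(1) by simp
    also have "\<dots> = act x (\<psi> y) - act y (\<psi> x) - \<psi> (brS x y)"
      using pr_act by (simp add: linear_diff[OF linear_pr] \<psi>G[OF sG] add.commute[of n m])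
    finally show "h x y = 0" by (simp add: h_def)
  qed
  then have f\<psi>: "f x y = act x (\<psi> y) - act y (\<psi> x) - \<psi> (brS x y)" if "x \<in> S" "y \<in> S" for x y
    using that by (simp add: h_def)
  define \<sigma>' where "\<sigma>' x = \<sigma> x - \<psi> x" for x
  have "section_mod (Suc k) \<sigma>'"
    unfolding section_mod_def
  proof (intro conjI ballI allI)
    show "linear \<sigma>'" unfolding \<sigma>'_def[abs_def] by (rule linear_compose_sub[OF l\<sigma> l\<psi>])
    show "\<sigma>' x - x \<in> r" if "x \<in> S" for x
    proof -
      have "(\<sigma> x - x) - \<psi> x \<in> r" by (rule subspace_diff[OF r_facts(1) \<sigma>r[OF that] subsetD[OF ar Va[OF \<psi>V[OF that]]]])
      then show ?thesis by (simp add: \<sigma>'_def algebra_simps)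
    qed
    show "pr m (\<sigma>' x) = \<sigma>' (pr m x)" if "x \<in> S" for m x
      using pr\<sigma>[OF that] by (simp add: \<sigma>'_def linear_diff[OF linear_pr] pr\<psi>)
    fix x y assume xy: "x \<in> S" "y \<in> S"
    note \<psi>xy = xy[THEN \<psi>V] and gxy = xy[THEN \<sigma>g] and sxy = s.ad.br_closed[OF xy]
    have sk: "br (\<psi> x) (\<sigma> y) = - br (\<sigma> y) (\<psi> x)" by (rule br_skew[OF gxy(2) Vg[OF \<psi>xy(1)]])
    \<comment> \<open>Its term quadratic in \<psi> dies under \<pi>; the rest is the coboundary
      equation, so \<pi> kills \<open>?u\<close>, that is, \<open>?u\<close> lies in
      \<open>R (Suc k)\<close>.\<close>
    let ?u = "c x y - br (\<sigma> x) (\<psi> y) + br (\<sigma> y) (\<psi> x) + br (\<psi> x) (\<psi> y) + \<psi> (brS x y)"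
    have u: "br (\<sigma>' x) (\<sigma>' y) - \<sigma>' (brS x y) = ?u"
      by (simp add: \<sigma>'_def c_def br_simps sk)
    have "?u \<in> ?a"
      using ca[OF xy] a(3)[OF gxy(1) Va[OF \<psi>xy(2)]] a(3)[OF gxy(2) Va[OF \<psi>xy(1)]]
        subsetD[OF ba ab[OF Va[OF \<psi>xy(1)] Va[OF \<psi>xy(2)]]] Va[OF \<psi>V[OF sxy]]
      by (intro subspace_add[OF a(1)] subspace_diff[OF a(1)])
    have "\<pi> ?u = f x y - act x (\<psi> y) + act y (\<psi> x) + \<psi> (brS x y)"
      using \<pi>b[OF ab[OF Va[OF \<psi>xy(1)] Va[OF \<psi>xy(2)]]] \<pi>_id[OF \<psi>V[OF sxy]]
      by (simp add: f_def act_def \<pi>_simps)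
    also have "\<dots> = 0" by (simp add: f\<psi>[OF xy])
    finally have "?u = Pb ?u" by (simp add: \<pi>_def)
    then have "?u \<in> ?b" using Pb(2) by metis
    then show "br (\<sigma>' x) (\<sigma>' y) - \<sigma>' (brS x y) \<in> R (Suc k)" using u by simp
  qed
  then show ?thesis by blast
qed

lemma homomorphic_section:
  obtains \<sigma> where "linear \<sigma>" "\<And>x. x \<in> S \<Longrightarrow> \<sigma> x - x \<in> r" "\<And>m x. x \<in> S \<Longrightarrow> pr m (\<sigma> x) = \<sigma> (pr m x)"
    "\<And>x y. x \<in> S \<Longrightarrow> y \<in> S \<Longrightarrow> br (\<sigma> x) (\<sigma> y) = \<sigma> (brS x y)"
proof -
  have ex: "\<exists>\<sigma>. section_mod k \<sigma>" for k
    by (induction k) (use section_mod_0 section_mod_Suc in blast)+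
  obtain n where n: "R n = {0}" using r_solvable by (auto simp: lie_solvable_def)
  obtain \<sigma> where \<sigma>: "section_mod n \<sigma>" by (rule exE[OF ex])
  show ?thesis
    by (rule that[of \<sigma>]) (use \<sigma> n in \<open>auto simp: section_mod_def\<close>)
qed

text \<open>The image of a homomorphic section that preserves degrees. It complements
  \<open>r\<close> because \<sigma> x - x lies in \<open>r\<close>, and a solvable ideal of it lies
  in \<open>r\<close> by \<open>solvable_in_radical\<close>.\<close>

lemma graded_levi_subalgebra:
  assumes rad: "lie_radical g br = r"
  obtains l where "levi_subalgebra g br l" "graded l"
proof -
  obtain \<sigma> where l\<sigma>: "linear \<sigma>" and \<sigma>r: "\<And>x. x \<in> S \<Longrightarrow> \<sigma> x - x \<in> r"
    and pr\<sigma>: "\<And>m x. x \<in> S \<Longrightarrow> pr m (\<sigma> x) = \<sigma> (pr m x)"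
    and hom: "\<And>x y. x \<in> S \<Longrightarrow> y \<in> S \<Longrightarrow> br (\<sigma> x) (\<sigma> y) = \<sigma> (brS x y)"
    by (rule homomorphic_section) (rule that; assumption)
  define l where "l = \<sigma> ` S"
  have sl: "subspace l" unfolding l_def by (rule linear_subspace_image[OF l\<sigma> subspace_S])
  have \<sigma>g: "\<sigma> x \<in> g" if "x \<in> S" for x
  proof -
    have "(\<sigma> x - x) + x \<in> g" using \<sigma>r[OF that] r_facts(2) S_g[OF that] by (intro subspace_add[OF subspace_L]) auto
    then show ?thesis by simp
  qed
  have lg: "l \<subseteq> g" unfolding l_def using \<sigma>g by blast
  have lc: "br x y \<in> l" if xy: "x \<in> l" "y \<in> l" for x y
  proof -
    obtain a b where "a \<in> S" "b \<in> S" "x = \<sigma> a" "y = \<sigma> b" using xy by (auto simp: l_def)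
    then show ?thesis using hom[of a b] lie_module.br_closed[OF lie_S, of a b] by (auto simp: l_def)
  qed
  have lr: "l \<inter> r = {0}"
  proof -
    have "\<sigma> x = 0" if "x \<in> S" "\<sigma> x \<in> r" for x
    proof -
      have "\<sigma> x - (\<sigma> x - x) \<in> r" by (rule subspace_diff[OF r_facts(1) that(2) \<sigma>r[OF that(1)]])
      then have "x = 0" using S_r[OF that(1)] by simp
      then show ?thesis using linear_0[OF l\<sigma>] by simp
    qed
    then show ?thesis using subspace_0[OF sl] subspace_0[OF r_facts(1)] by (auto simp: l_def)
  qed
  have split: "\<exists>y\<in>l. \<exists>s\<in>r. x = y + s" if x: "x \<in> g" for x
  proof (intro bexI)
    show "x = \<sigma> (q x) + (P x - (\<sigma> (q x) - q x))" by (simp add: q_def)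
    show "P x - (\<sigma> (q x) - q x) \<in> r" by (intro subspace_diff[OF r_facts(1)] P_r \<sigma>r q_S x)
    show "\<sigma> (q x) \<in> l" unfolding l_def using q_S[OF x] by blast
  qed
  interpret l: lie_algebra l br
  proof
    show "\<exists>B. finite B \<and> l = span B" using findim_sub[OF findim_L sl lg] by (simp add: findim_def)
    fix x y z assume "x \<in> l" "y \<in> l" "z \<in> l"
    then have xyz: "x \<in> g" "y \<in> g" "z \<in> g" using lg by auto
    show "br x (br y z) + br y (br z x) + br z (br x y) = 0"
      using br_jacobi[OF xyz] br_skew[OF xyz(1,3)] br_skew[OF br_closed[OF xyz(1,2)] xyz(3)]
      by (simp add: br_simps)
  qed (use sl lc lg br_alt in \<open>auto simp: br_simps\<close>)
  have "I = {0}" if I: "lie_ideal l br I" "lie_solvable br I" for I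
  proof -
    have I': "subspace I" "I \<subseteq> l" "\<And>x y. x \<in> l \<Longrightarrow> y \<in> I \<Longrightarrow> br x y \<in> I" using I(1) by (auto simp: lie_ideal_def)
    have "I \<subseteq> r"
    proof (rule solvable_in_radical[OF I'(1) _ _ _ _ I(2)])
      show "I \<subseteq> g" using I'(2) lg by blast
      show "br x y \<in> I" if "x \<in> I" "y \<in> I" for x y using I'(2,3) that by blast
      show "br x y - br x y \<in> r" for x y using subspace_0[OF r_facts(1)] by simp
      fix x y assume x: "x \<in> g" and y: "y \<in> I"
      obtain z s where zs: "z \<in> l" "s \<in> r" "x = z + s" using split[OF x] by blast
      have "br x y = br z y + br s y" using zs(3) by (simp add: br_simps)
      moreover have "br z y \<in> I" by (rule I'(3)[OF zs(1) y])
      moreover have "br s y \<in> r" using r_facts(4)[OF zs(2)] y I'(2) lg by blast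
      ultimately show "br x y \<in> {i + s | i s. i \<in> I \<and> s \<in> r}" by blast
    qed
    then show ?thesis using I'(2) lr subspace_0[OF I'(1)] by blast
  qed
  moreover have "lie_ideal l br (lie_radical l br)" "lie_solvable br (lie_radical l br)"
    using l.radical_maximal by (auto simp: maximal_solvable_ideal_def)
  ultimately have "lie_semisimple l br" by (simp add: lie_semisimple_def)
  moreover have "g = {x + y | x y. x \<in> l \<and> y \<in> r}"
    using split lg r_facts(2) subspace_add[OF subspace_L] by blast
  ultimately have "levi_subalgebra g br l"
    unfolding levi_subalgebra_def rad lie_subalgebra_def using sl lg lc lr by blast
  moreover have "graded l"
    unfolding graded_def using sl lg pr\<sigma> pr_S by (auto simp: l_def)
  ultimately show ?thesis by (rule that)
qed

end

text \<open>The grading group enters only through a separating family of nowhere zero real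
  characters \<theta>.\<close>

lemma graded_radical_and_levi:
  fixes G :: "'i::ab_group_add \<Rightarrow> 'a::real_vector set" and \<theta> :: "'j \<Rightarrow> 'i \<Rightarrow> real"
  assumes lie: "lie_algebra g br" and bil: "bilinear br" and gr: "lie_grading g br G"
    and \<theta>: "\<And>i m n. \<theta> i (m + n) = \<theta> i m * \<theta> i n" "\<And>i m. \<theta> i m \<noteq> 0"
    and sep: "\<And>m n. m \<noteq> n \<Longrightarrow> \<exists>i. \<theta> i m \<noteq> \<theta> i n"
  shows "lie_radical g br = subspace_sum (\<lambda>m. lie_radical g br \<inter> G m) \<and>
    (\<exists>l. levi_subalgebra g br l \<and> l = subspace_sum (\<lambda>m. l \<inter> G m))"
proof -
  interpret A: lie_algebra g br by fact
  have skew: "br y x = - br x y" if "x \<in> g" "y \<in> g" for x y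
  proof -
    have "br (x + y) (x + y) = 0" using that A.subspace_carrier by (simp add: A.alternating subspace_add)
    then have "br y x + br x y = 0" using that by (simp add: bilinear_simps[OF bil] A.alternating add.commute)
    then show ?thesis by (simp add: eq_neg_iff_add_eq_0)
  qed
  have mod: "lie_module g br g br"
  proof
    fix x y z assume xyz: "x \<in> g" "y \<in> g" "z \<in> g"
    show "br (br x y) z = br x (br y z) - br y (br x z)"
      using A.jacobi[OF xyz] skew[OF xyz(1,3)] skew[OF A.bracket_closed[OF xyz(1,2)] xyz(3)]
      by (simp add: bilinear_simps[OF bil] algebra_simps)
  qed (use A.findim_carrier bil A.bracket_closed A.alternating in auto)
  obtain F pr where "graded_lie g br G F pr" using graded_lieI[OF mod gr] .
  then interpret graded_lie g br G F pr .
  let ?r = "lie_radical g br"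
  interpret graded_lie_with_radical g br G F pr ?r
    by unfold_locales (use A.radical_maximal A.radical_greatest in \<open>auto simp: maximal_solvable_ideal_def\<close>)
  have rg: "graded ?r" by (rule radical_graded[OF \<theta> sep])
  obtain P where P: "linear P" "\<And>x. P x \<in> ?r" "\<And>x. x \<in> ?r \<Longrightarrow> P x = x" "\<And>m x. pr m (P x) = P (pr m x)"
    by (rule graded_projection[OF rg]) (rule that; assumption)
  interpret graded_levi g br G F pr ?r P
    by unfold_locales (use rg P in \<open>auto simp: linear_add linear_scale\<close>)
  obtain l where "levi_subalgebra g br l" "graded l" by (rule graded_levi_subalgebra[OF refl])
  then show ?thesis using graded_eq_sum rg by blast
qed

section \<open>Transfer between brackets that agree on the carrier\<close>

lemma lie_solvable_cong:
  assumes eq: "\<And>x y. x \<in> K \<Longrightarrow> y \<in> K \<Longrightarrow> br x y = br' x y"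
    and K: "subspace K" "\<And>x y. x \<in> K \<Longrightarrow> y \<in> K \<Longrightarrow> br x y \<in> K"
  shows "lie_solvable br K \<longleftrightarrow> lie_solvable br' K"
proof -
  have "derived_series br K n = derived_series br' K n \<and> derived_series br K n \<subseteq> K" for n
  proof (induction n)
    case (Suc n)
    let ?D = "derived_series br K n"
    have "{br x y | x y. x \<in> ?D \<and> y \<in> ?D} = {br' x y | x y. x \<in> ?D \<and> y \<in> ?D}"
      using eq Suc by (metis (no_types, lifting) subsetD)
    moreover have "{br x y | x y. x \<in> ?D \<and> y \<in> ?D} \<subseteq> K" using K(2) Suc by (auto simp: subset_iff)
    ultimately show ?case using Suc K(1) by (simp add: span_minimal)
  qed simp
  then show ?thesis by (simp add: lie_solvable_def)
qed

lemma lie_ideal_cong: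
  assumes "\<And>x y. x \<in> L \<Longrightarrow> y \<in> L \<Longrightarrow> br x y = br' x y"
  shows "lie_ideal L br I \<longleftrightarrow> lie_ideal L br' I"
  using assms unfolding lie_ideal_def by (metis subsetD)

lemma lie_radical_cong:
  assumes eq: "\<And>x y. x \<in> L \<Longrightarrow> y \<in> L \<Longrightarrow> br x y = br' x y"
  shows "lie_radical L br = lie_radical L br'"
proof -
  have "lie_ideal L br I \<and> lie_solvable br I \<longleftrightarrow> lie_ideal L br' I \<and> lie_solvable br' I" for I
  proof (cases "lie_ideal L br I")
    case True
    then have I: "subspace I" "I \<subseteq> L" "\<And>x y. x \<in> L \<Longrightarrow> y \<in> I \<Longrightarrow> br x y \<in> I" by (auto simp: lie_ideal_def)
    have "lie_solvable br I \<longleftrightarrow> lie_solvable br' I"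
      by (rule lie_solvable_cong[OF _ I(1)]) (use I(2,3) eq in blast)+
    then show ?thesis using lie_ideal_cong[of L br br' I, OF eq] by simp
  next
    case False
    then show ?thesis using lie_ideal_cong[of L br br' I, OF eq] by simp
  qed
  then have "maximal_solvable_ideal L br R = maximal_solvable_ideal L br' R" for R
    unfolding maximal_solvable_ideal_def by (metis (no_types, lifting))
  then show ?thesis by (simp add: lie_radical_def)
qed

lemma levi_subalgebra_cong:
  assumes eq: "\<And>x y. x \<in> L \<Longrightarrow> y \<in> L \<Longrightarrow> br x y = br' x y" and l: "levi_subalgebra L br l"
  shows "levi_subalgebra L br' l"
proof -
  have l': "subspace l" "l \<subseteq> L" "\<And>x y. x \<in> l \<Longrightarrow> y \<in> l \<Longrightarrow> br x y \<in> l"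
    using l by (auto simp: levi_subalgebra_def lie_subalgebra_def)
  have eq': "br x y = br' x y" if "x \<in> l" "y \<in> l" for x y using eq that l'(2) by blast
  have "lie_radical l br = lie_radical l br'" by (rule lie_radical_cong[OF eq'])
  moreover have "lie_subalgebra L br' l" unfolding lie_subalgebra_def using l' eq' by simp
  ultimately show ?thesis
    using l lie_radical_cong[of L br br', OF eq] unfolding levi_subalgebra_def lie_semisimple_def by simp
qed

theorem corollary3p1:
  fixes g :: "'a::real_vector set"
    and br :: "'a \<Rightarrow> 'a \<Rightarrow> 'a"
    and G :: "int ^ 'd::finite \<Rightarrow> 'a set"
  assumes "lie_algebra g br"
    and "lie_grading g br G"
  shows "lie_radical g br = subspace_sum (\<lambda>m. lie_radical g br \<inter> G m) \<and>
    (\<exists>l. levi_subalgebra g br l \<and> l = subspace_sum (\<lambda>m. l \<inter> G m))"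
proof -
  interpret lie_algebra g br by fact
  obtain p where p: "linear p" "\<And>x. p x \<in> g" "\<And>x. x \<in> g \<Longrightarrow> p x = x"
    by (rule projection_exists[OF subspace_carrier subspace_single_0]) (auto intro: that)
  \<comment> \<open>The given bracket is controlled only on \<open>g\<close>; precomposing with a
    projection makes it bilinear on the whole type without changing it on \<open>g\<close>.\<close>
  define br' where "br' x y = br (p x) (p y)" for x y
  have eq: "br x y = br' x y" if "x \<in> g" "y \<in> g" for x y using that p(3) by (simp add: br'_def)
  have bil: "bilinear br'"
    unfolding br'_def by (rule bilinearI)
      (simp_all add: linear_add[OF p(1)] linear_scale[OF p(1)] p(2) add_left add_right scale_left scale_right)
  have lie': "lie_algebra g br'"
  proof
    show "\<exists>B. finite B \<and> g = span B" by (rule finite_dim)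
    fix x y z assume xyz: "x \<in> g" "y \<in> g" "z \<in> g"
    show "br' x (br' y z) + br' y (br' z x) + br' z (br' x y) = 0"
      using jacobi[OF xyz] xyz by (simp add: bracket_closed flip: eq)
  qed (use subspace_carrier bracket_closed alternating in \<open>auto simp: bilinear_simps[OF bil] simp flip: eq\<close>)
  have "G m \<subseteq> g" for m using assms(2) subspace_sum_base[of _ G m] by (auto simp: lie_grading_def)
  then have gr: "lie_grading g br' G"
    using assms(2) eq unfolding lie_grading_def by (metis subsetD)
  \<comment> \<open>One character per coordinate. Base 2 serves because its integer powers,
    including negative ones, are nonzero and pairwise distinct.\<close>
  define \<theta> :: "'d \<Rightarrow> int ^ 'd \<Rightarrow> real" where "\<theta> i m = 2 powi (m $ i)" for i m
  have "lie_radical g br' = subspace_sum (\<lambda>m. lie_radical g br' \<inter> G m) \<and>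
    (\<exists>l. levi_subalgebra g br' l \<and> l = subspace_sum (\<lambda>m. l \<inter> G m))"
  proof (rule graded_radical_and_levi[OF lie' bil gr])
    show "\<theta> i (m + n) = \<theta> i m * \<theta> i n" for i m n by (simp add: \<theta>_def power_int_add)
    show "\<theta> i m \<noteq> 0" for i m by (simp add: \<theta>_def)
    show "\<exists>i. \<theta> i m \<noteq> \<theta> i n" if mn: "m \<noteq> n" for m n
    proof -
      obtain i where "m $ i \<noteq> n $ i" using mn by (auto simp: vec_eq_iff)
      then have "(2::real) powi (m $ i) \<noteq> 2 powi (n $ i)"
        using power_int_strict_increasing[of "m $ i" "n $ i" "2::real"]
          power_int_strict_increasing[of "n $ i" "m $ i" "2::real"] by linarith
      then show ?thesis by (auto simp: \<theta>_def)
    qed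
  qed
  then show ?thesis
    using lie_radical_cong[of g br br', OF eq] levi_subalgebra_cong[of g br' br] eq by metis
qed

end
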